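(* For every integer $t\ge 3$, let $W^{(3)}_t$ be the $3$-uniform wheel on $t$ vertices $v_0,v_1,\dots,v_{t-1}$, whose edges are $\{v_0,v_i,v_{i+1}\}$ for $i=1,\dots,t-1$, with indices of the rim vertices taken cyclically so that $v_t:=v_1$. Then $\pi_{u}(W^{(3)}_t)=1/4$ if $t$ is even, and $\pi_{u}(W^{(3)}_t)=0$ if $t$ is odd.
   Context: A $3$-graph is a pair $H=(V,E)$ with $E\subseteq [V]^3$. $H$ is $F$-free if it contains no (not necessarily induced) copy of $F$. For $d\in[0,1]$, $\mu>0$, $H=(V,E)$ is $(d,\mu)$-dense if every $U\subseteq V$ satisfies $|[U]^3\cap E|\ge d\binom{|U|}{3}-\mu|V|^3$. The uniform Turán density is $\pi_{u}(F)=\sup\{d\in[0,1]:$ for every $\mu>0$ and $n_0\in\mathbb N$ there is an $F$-free $(d,\mu)$-dense $3$-graph $H$ with $|V(H)|\ge n_0\}$. *)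

theory Defs
  imports Complex_Main "HOL-Library.Ramsey"
begin

text \<open>A 3-graph is a pair \<open>(V, E)\<close> of a finite vertex set and a set of 3-element subsets of \<open>V\<close>;
  \<open>[V]\<^bsup>3\<^esup>\<close> is the library's notation for \<open>nsets V 3\<close>.\<close>

type_synonym 'a hypergraph = "'a set \<times> 'a set set"

abbreviation verts :: "'a hypergraph \<Rightarrow> 'a set" where
  "verts H \<equiv> fst H"

abbreviation edges :: "'a hypergraph \<Rightarrow> 'a set set" where
  "edges H \<equiv> snd H"

definition three_graph :: "'a hypergraph \<Rightarrow> bool" where
  "three_graph H \<longleftrightarrow> finite (verts H) \<and> edges H \<subseteq> [verts H]\<^bsup>3\<^esup>"

definition contains_copy :: "'a hypergraph \<Rightarrow> 'b hypergraph \<Rightarrow> bool" where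
  "contains_copy H F \<longleftrightarrow>
     (\<exists>f. inj_on f (verts F) \<and> f ` verts F \<subseteq> verts H \<and> (\<forall>e\<in>edges F. f ` e \<in> edges H))"

definition free_of :: "'b hypergraph \<Rightarrow> 'a hypergraph \<Rightarrow> bool" where
  "free_of F H \<longleftrightarrow> \<not> contains_copy H F"

definition mu_dense :: "real \<Rightarrow> real \<Rightarrow> 'a hypergraph \<Rightarrow> bool" where
  "mu_dense d \<mu> H \<longleftrightarrow>
     (\<forall>U \<subseteq> verts H.
        real (card ([U]\<^bsup>3\<^esup> \<inter> edges H)) \<ge> d * real (card U choose 3) - \<mu> * real (card (verts H)) ^ 3)"

text \<open>Every finite 3-graph is isomorphic to one with vertices in \<open>nat\<close>, so it suffices that the
  host graphs \<open>H\<close> range over 3-graphs on \<open>nat\<close>. If \<open>F\<close> has an edge, the set below contains \<open>0\<close>; it is bounded by \<open>1\<close>,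
  so \<open>Sup\<close> on the reals is the genuine supremum.\<close>

definition uniform_turan_density :: "'b hypergraph \<Rightarrow> real" where
  "uniform_turan_density F =
     Sup {d \<in> {0..1}. \<forall>\<mu>>0. \<forall>n\<^sub>0::nat. \<exists>H :: nat hypergraph.
            three_graph H \<and> free_of F H \<and> mu_dense d \<mu> H \<and> card (verts H) \<ge> n\<^sub>0}"

text \<open>Vertex \<open>i\<close> stands for \<open>v\<^sub>i\<close>: the hub is \<open>0\<close> and the rim is \<open>1, \<dots>, t - 1\<close>, taken cyclically.
  For \<open>t = 3\<close> the two rim pairs coincide and the wheel is a single edge.\<close>

definition wheel :: "nat \<Rightarrow> nat hypergraph" where
  "wheel t = ({0..<t}, {{0, i, if i = t - 1 then 1 else i + 1} | i. i \<in> {1..t - 1}})"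

end

theory Submission
  imports Defs
begin

text \<open>
  For odd \<open>t\<close> the rim is an even cycle, and a graph of positive density (here: some link)
  contains \<open>K\<^sub>k\<^sub>,\<^sub>k\<close>, hence the rim. For even \<open>t\<close> the lower bound is given by the cyclic triangles of a
  quasirandom tournament: the link of a vertex is bipartite between its in- and out-neighbours, so it
  has no odd cycle.

  For the upper bound at even \<open>t\<close> it suffices that some link \<open>G\<^sub>x\<close> has many triangles: then many
  of them share a vertex \<open>y\<close>, so \<open>G\<^sub>x\<close> contains some \<open>K\<^sub>k\<^sub>,\<^sub>k\<close> inside the neighbourhood of \<open>y\<close>. Otherwise
  each \<open>G\<^sub>x\<close> is, up to few edges, a blow-up of a triangle-free graph \<open>L\<^sub>x\<close> on boundedly many colours,
  with blow-up map \<open>c\<^sub>x\<close>. Regularising the relations \<open>c\<^sub>x(y) \<in> S\<close> and selecting random cells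
  \<open>V\<^sub>1, \<dots>, V\<^sub>m\<close> of the regular partition, the density of a triple \<open>V\<^sub>i, V\<^sub>j, V\<^sub>k\<close> is at most the average
  over \<open>(x, y) \<in> V\<^sub>i \<times> V\<^sub>j\<close> of the product of the relative sizes in \<open>V\<^sub>k\<close> of the neighbourhood of the colour
  \<open>c\<^sub>x(y)\<close> in \<open>L\<^sub>x\<close> and of the neighbourhood of \<open>c\<^sub>y(x)\<close> in \<open>L\<^sub>y\<close>. These neighbourhoods are independent sets.
  By Ramsey's theorem the largest independent sets may be assumed to have size \<open>a\<close> towards all
  later cells and size \<open>b\<close> towards all earlier cells. If \<open>a \<le> 1/2\<close> or \<open>b \<le> 1/2\<close> the average is at most
  \<open>1/4\<close>. Otherwise consider the first and the last cell: a colour inside a largest independent set has a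
  neighbourhood of size at most \<open>1 - a\<close> (or \<open>1 - b\<close>), and for \<open>a \<ge> b\<close> the average is at most
  \<open>(1 - a) b (1 + 2a - 2b) \<le> 1/4\<close>.
\<close>

section \<open>Ramsey's theorem at several levels\<close>

text \<open>The order of the constants shapes the argument. The number of selected cells determines
  how small the error of the triangle-free structure must be, that error determines the number
  \<open>K\<close> of colours, and only then can the partition be regularised. A Ramsey argument
  that remembers colours would make the number of cells depend on \<open>K\<close>; remembering only
  sizes rounded to multiples of \<open>1 / q\<close>, with \<open>q\<close> depending on \<epsilon>
  alone, breaks the circle.

  How large an independent set can be "towards all later cells" depends on how many cells one set
  has to serve. Bounding neighbourhoods needs that no set is large towards any \<open>r\<close>
  cells, while the last case needs one set that is large towards far more than \<open>r\<close>
  cells. Levels can only fall when more cells are served and take only \<open>q + 1\<close> values,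
  so along a geometric sequence of sizes they agree at two consecutive sizes; the ratio makes
  \<open>r\<close> exceptional cells negligible against the larger size. Hence homogeneity is
  required for subsets of several sizes at once.\<close>

lemma ramsey_homogeneous:
  "\<exists>N. \<forall>A::'a set. \<forall>col. card A \<ge> N \<longrightarrow> finite A \<longrightarrow> (\<forall>T. col T < (q::nat)) \<longrightarrow>
     (\<exists>B\<subseteq>A. card B = M \<and> (\<exists>c. \<forall>T\<in>[B]\<^bsup>r\<^esup>. col T = c))"
proof -
  obtain N :: nat where N: "partn_lst {..<N} (replicate q M) r"
    using ramsey_full by blast
  show ?thesis
  proof (intro exI[of _ N] allI impI)
    fix A :: "'a set" and col :: "'a set \<Rightarrow> nat"
    assume A: "card A \<ge> N" "finite A" and col: "\<forall>T. col T < q"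
    obtain h where h: "inj_on h {..<N}" "h ` {..<N} \<subseteq> A"
      using A card_le_inj[of "{..<N}" A] by auto
    have "(\<lambda>T. col (h ` T)) \<in> nsets {..<N} r \<rightarrow> {..<length (replicate q M)}"
      using col by auto
    then obtain i H where iH: "i < q" "H \<in> nsets {..<N} (replicate q M ! i)"
      "(\<lambda>T. col (h ` T)) ` nsets H r \<subseteq> {i}"
      using N unfolding partn_lst_def monochromatic_def by (metis length_replicate)
    have H: "H \<subseteq> {..<N}" "card H = M" using iH by (auto simp: nsets_def)
    have inj: "inj_on h H" using H h inj_on_subset by blast
    show "\<exists>B\<subseteq>A. card B = M \<and> (\<exists>c. \<forall>T\<in>[B]\<^bsup>r\<^esup>. col T = c)"
    proof (intro exI[of _ "h ` H"] conjI exI[of _ i] ballI)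
      show "h ` H \<subseteq> A" using H h by auto
      show "card (h ` H) = M" using inj H card_image by metis
      fix T assume T: "T \<in> [h ` H]\<^bsup>r\<^esup>"
      then obtain T' where "T' \<subseteq> H" "T = h ` T'"
        unfolding nsets_def by (auto simp: subset_image_iff)
      moreover from this have "T' \<in> nsets H r"
        using T inj H finite_subset[of T' "{..<N}"] card_image[OF inj_on_subset[OF inj, of T']]
        by (auto simp: nsets_def)
      ultimately show "col T = i" using iH by auto
    qed
  qed
qed

text \<open>Homogeneity for one size survives passing to subsets, so the sizes are treated one after
  another. The constant colour may differ from size to size.\<close>

lemma ramsey_homogeneous_levels:
  "\<exists>N. \<forall>A::'a set. \<forall>col. card A \<ge> N \<longrightarrow> finite A \<longrightarrow> (\<forall>T. col T < (q::nat)) \<longrightarrow>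
     (\<exists>B\<subseteq>A. card B = M \<and> (\<forall>r\<in>set rs. \<exists>c. \<forall>T\<in>[B]\<^bsup>r\<^esup>. col T = c))"
proof (induction rs)
  case Nil
  show ?case
  proof (intro exI[of _ M] allI impI)
    fix A :: "'a set" assume "M \<le> card A"
    then show "\<exists>B\<subseteq>A. card B = M \<and> (\<forall>r\<in>set []. \<exists>c. \<forall>T\<in>[B]\<^bsup>r\<^esup>. col T = c)" for col :: "'a set \<Rightarrow> nat"
      using obtain_subset_with_card_n by (metis empty_iff list.set(1))
  qed
next
  case (Cons r rs)
  then obtain N1 where N1: "\<And>A::'a set. \<And>col. card A \<ge> N1 \<Longrightarrow> finite A \<Longrightarrow> (\<forall>T. col T < q) \<Longrightarrow>
     (\<exists>B\<subseteq>A. card B = M \<and> (\<forall>r\<in>set rs. \<exists>c. \<forall>T\<in>[B]\<^bsup>r\<^esup>. col T = c))" by blast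
  obtain N2 where N2: "\<And>A::'a set. \<And>col. card A \<ge> N2 \<Longrightarrow> finite A \<Longrightarrow> (\<forall>T. col T < q) \<Longrightarrow>
     (\<exists>B\<subseteq>A. card B = N1 \<and> (\<exists>c. \<forall>T\<in>[B]\<^bsup>r\<^esup>. col T = c))"
    using ramsey_homogeneous[where ?'a='a, of q N1 r] by blast
  show ?case
  proof (intro exI[of _ N2] allI impI)
    fix A :: "'a set" and col :: "'a set \<Rightarrow> nat"
    assume A: "card A \<ge> N2" "finite A" and col: "\<forall>T. col T < q"
    obtain B1 c where B1: "B1 \<subseteq> A" "card B1 = N1" "\<forall>T\<in>[B1]\<^bsup>r\<^esup>. col T = c"
      using N2[OF A col] by blast
    obtain B where B: "B \<subseteq> B1" "card B = M" "\<forall>r\<in>set rs. \<exists>c. \<forall>T\<in>[B]\<^bsup>r\<^esup>. col T = c"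
      using N1[of B1 col] B1 A col finite_subset by blast
    have "\<forall>T\<in>[B]\<^bsup>r\<^esup>. col T = c" using B1 nsets_mono[OF B(1)] by blast
    then show "\<exists>B\<subseteq>A. card B = M \<and> (\<forall>r\<in>set (r#rs). \<exists>c. \<forall>T\<in>[B]\<^bsup>r\<^esup>. col T = c)"
      using B B1(1) by (intro exI[of _ B]) auto
  qed
qed

section \<open>Weighted reduced structures\<close>

definition max_level :: "(nat \<Rightarrow> bool) \<Rightarrow> nat \<Rightarrow> nat" where
  "max_level P q = Max {h \<in> {..q}. P h}"

lemma max_level_le: "P 0 \<Longrightarrow> max_level P q \<le> q"
  unfolding max_level_def by (subst Max_le_iff) auto

lemma max_level_holds: "P 0 \<Longrightarrow> P (max_level P q)"
  unfolding max_level_def using Max_in[of "{h \<in> {..q}. P h}"] by auto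

lemma max_level_ge: "P h \<Longrightarrow> h \<le> q \<Longrightarrow> h \<le> max_level P q"
  unfolding max_level_def by (intro Max_ge) auto

lemma max_level_mono: 
  assumes "P 0" "\<And>h. P h \<Longrightarrow> P' h" shows "max_level P q \<le> max_level P' q"
  using assms max_level_le max_level_holds max_level_ge by metis

text \<open>The sum of both sequences starts at most \<open>2*q\<close> and cannot drop
  \<open>2*q + 1\<close> times. Both have to stall at the same step because the two levels are later
  compared at the same pair of sizes.\<close>

lemma two_monotone_sequences_stall:
  fixes f g :: "nat \<Rightarrow> nat"
  assumes "\<And>s. s \<le> 2*q \<Longrightarrow> f (Suc s) \<le> f s" "\<And>s. s \<le> 2*q \<Longrightarrow> g (Suc s) \<le> g s"
    and "f 0 \<le> q" "g 0 \<le> q"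
  shows "\<exists>s\<le>2*q. f (Suc s) = f s \<and> g (Suc s) = g s"
proof (rule ccontr)
  assume "\<not> ?thesis"
  then have less: "f (Suc s) + g (Suc s) < f s + g s" if "s \<le> 2*q" for s
    using assms(1,2)[OF that] that by (metis add_le_less_mono add_less_le_mono le_neq_implies_less)
  have "f s + g s + s \<le> 2*q" if "s \<le> Suc (2*q)" for s
    using that
  proof (induction s)
    case (Suc s) then show ?case using less[of s] by auto
  qed (use assms in auto)
  from this[of "Suc (2*q)"] show False by auto
qed

text \<open>At \<open>\<eta> = 0\<close> the left side is
  \<open>(1-a) * b * (1 + 2*a - 2*b)\<close>. It is kept as the four contributions produced by
  colours inside or outside the two large independent sets; \<eta> is the rounding error
  \<open>1 / q\<close>.\<close>

lemma two_sided_bound: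
  fixes a b \<eta> :: real
  assumes "1/2 \<le> b" "b \<le> a" "a \<le> 1" "0 \<le> \<eta>" "\<eta> \<le> 1"
  shows "(1-a)*(1-b) + (1-b)*(2*a-1+\<eta>)*(1-a) + (1-a)*(2*b-1+\<eta>)*(1-b)
      + (2*a-1+\<eta>)*(2*b-1+\<eta>)*(1-a) \<le> 1/4 + 3*\<eta>" (is "?l \<le> _")
proof -
  \<comment> \<open>These coordinates move the extremal point \<open>a = b = 1/2\<close> to the
    origin; the deficit from 1/4 becomes a positive definite form plus a term that is non-negative
    for \<open>0 \<le> q \<le> p\<close>.\<close>
  define p q where "p = 2*a-1" and "q = 2*b-1"
  have pq: "0 \<le> q" "q \<le> p" "p \<le> 1" using assms by (auto simp: p_def q_def)
  have ab: "a = (1+p)/2" "b = (1+q)/2" by (auto simp: p_def q_def)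
  have "?l = (1-a)*(1-b) + (1-b)*(2*a-1)*(1-a) + (1-a)*(2*b-1)*(1-b) + (2*a-1)*(2*b-1)*(1-a)
     + \<eta> * (2*(1-a)*(1-b) + (2*a-1+2*b-1+\<eta>)*(1-a))"
    by (simp add: algebra_simps)
  also have "(1-a)*(1-b) + (1-b)*(2*a-1)*(1-a) + (1-a)*(2*b-1)*(1-b) + (2*a-1)*(2*b-1)*(1-a)
     = (1 - (p*p - p*q + q*q) - p*q*(p-q))/4"
    unfolding ab by (simp add: field_simps)
  also have "(1 - (p*p - p*q + q*q) - p*q*(p-q))/4 \<le> 1/4"
  proof -
    have "p*p \<ge> p*q" using pq by (intro mult_left_mono) auto
    then have A: "0 \<le> p*p - p*q + q*q" by (smt (verit) zero_le_square)
    have B: "0 \<le> p*q*(p-q)" using pq by auto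
    have "(1 - A - B)/4 \<le> 1/4" if "0 \<le> A" "0 \<le> B" for A B :: real using that by simp
    from this[OF A B] show ?thesis .
  qed
  also have "\<eta> * (2*(1-a)*(1-b) + (2*a-1+2*b-1+\<eta>)*(1-a)) \<le> \<eta> * 3"
  proof (rule mult_left_mono)
    have "2*(1-a)*(1-b) \<le> 2*(1/2)*(1/2)" using assms by (intro mult_mono) auto
    moreover have "(2*a-1+2*b-1+\<eta>)*(1-a) \<le> 3 * (1/2)" using assms by (intro mult_mono) auto
    ultimately show "2*(1-a)*(1-b) + (2*a-1+2*b-1+\<eta>)*(1-a) \<le> 3" by linarith
  qed (use assms in auto)
  finally show ?thesis by simp
qed

text \<open>Both factors are at most 1, so an exceptional index costs at most 1. The loss
  \<open>2 * r\<close> does not grow with \<open>J\<close>.\<close>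

lemma sum_product_le_exceptions:
  fixes f g :: "'a \<Rightarrow> real"
  assumes "finite J" "\<And>j. j \<in> J \<Longrightarrow> 0 \<le> f j \<and> f j \<le> 1" "\<And>j. j \<in> J \<Longrightarrow> 0 \<le> g j \<and> g j \<le> 1"
    and "card {j\<in>J. f j > u} \<le> r" "card {j\<in>J. g j > v} \<le> r" "0 \<le> u" "0 \<le> v"
  shows "(\<Sum>j\<in>J. f j * g j) \<le> real (card J) * (u*v) + 2 * real r"
proof -
  have "(\<Sum>j\<in>J. f j * g j) \<le> (\<Sum>j\<in>J. u * v + of_bool (f j > u) + of_bool (g j > v))"
  proof (rule sum_mono)
    fix j assume j: "j \<in> J"
    show "f j * g j \<le> u * v + of_bool (f j > u) + of_bool (g j > v)"
    proof (cases "f j > u \<or> g j > v")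
      case True
      have "f j * g j \<le> 1" using assms(2,3)[OF j] by (simp add: mult_le_one)
      then show ?thesis using True assms(6,7) by (auto simp: add_increasing add_increasing2)
    next
      case False
      then have "f j * g j \<le> u * v" using assms(2,3)[OF j] assms(6) by (intro mult_mono) auto
      then show ?thesis by simp
    qed
  qed
  also have "\<dots> = real (card J) * (u*v) + real (card {j\<in>J. f j > u}) + real (card {j\<in>J. g j > v})"
    using assms(1) by (simp add: sum.distrib Int_def of_bool_def sum.If_cases)
  finally show ?thesis using assms(4,5) by linarith
qed

text \<open>
  Indices \<open>i\<close> stand for cells \<open>V\<^sub>i\<close> and \<open>L i\<close> for the common triangle-free graph of the links of the
  vertices of \<open>V\<^sub>i\<close>; \<open>P i j a b\<close> is the proportion of pairs \<open>(x, y) \<in> V\<^sub>i \<times> V\<^sub>j\<close> such that \<open>y\<close> has colour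
  \<open>a\<close> in the link of \<open>x\<close> and \<open>x\<close> has colour \<open>b\<close> in the link of \<open>y\<close>. Then \<open>sz i S j\<close> is the relative size of
  the colour set \<open>S\<close> in \<open>V\<^sub>j\<close> as seen from \<open>V\<^sub>i\<close>, and \<open>tri i j k\<close> bounds the density of \<open>V\<^sub>i, V\<^sub>j, V\<^sub>k\<close>.
\<close>

locale coloured_array =
  fixes I :: "nat set" and C :: "'c set" and L :: "nat \<Rightarrow> 'c \<Rightarrow> 'c \<Rightarrow> bool"
    and P :: "nat \<Rightarrow> nat \<Rightarrow> 'c \<Rightarrow> 'c \<Rightarrow> real"
  assumes finite_C: "finite C"
    and L_sym: "L i a b \<Longrightarrow> L i b a"
    and triangle_free: "L i a b \<Longrightarrow> L i b c \<Longrightarrow> \<not> L i a c"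
    and P_nonneg: "0 \<le> P i j a b"
    and P_sym: "P i j a b = P j i b a"
    and P_sum: "i \<in> I \<Longrightarrow> j \<in> I \<Longrightarrow> (\<Sum>a\<in>C. \<Sum>b\<in>C. P i j a b) = 1"
begin

definition nb :: "nat \<Rightarrow> 'c \<Rightarrow> 'c set" where
  "nb i a = {b \<in> C. L i a b}"

definition sz :: "nat \<Rightarrow> 'c set \<Rightarrow> nat \<Rightarrow> real" where
  "sz i S j = (\<Sum>a\<in>S. \<Sum>b\<in>C. P i j a b)"

definition indep :: "nat \<Rightarrow> 'c set \<Rightarrow> bool" where
  "indep i S \<longleftrightarrow> S \<subseteq> C \<and> (\<forall>a\<in>S. \<forall>b\<in>S. \<not> L i a b)"

definition tri :: "nat \<Rightarrow> nat \<Rightarrow> nat \<Rightarrow> real" where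
  "tri i j k = (\<Sum>a\<in>C. \<Sum>b\<in>C. P i j a b * (sz i (nb i a) k * sz j (nb j b) k))"

text \<open>Triangle-freeness enters the estimates only here: it lets bounds on independent sets
  control neighbourhoods.\<close>

lemma nb_indep: "indep i (nb i a)"
  unfolding indep_def nb_def using triangle_free by blast

lemma sz_nonneg: "0 \<le> sz i S j"
  unfolding sz_def by (intro sum_nonneg P_nonneg)

lemma sz_mono: "S \<subseteq> S' \<Longrightarrow> S' \<subseteq> C \<Longrightarrow> sz i S j \<le> sz i S' j"
  unfolding sz_def using finite_C finite_subset by (intro sum_mono2 sum_nonneg P_nonneg) auto

lemma sz_C: "i \<in> I \<Longrightarrow> j \<in> I \<Longrightarrow> sz i C j = 1"
  unfolding sz_def by (rule P_sum)

lemma sz_le_1: "i \<in> I \<Longrightarrow> j \<in> I \<Longrightarrow> S \<subseteq> C \<Longrightarrow> sz i S j \<le> 1"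
  using sz_mono[of S C i j] sz_C by simp

lemma sz_disjoint:
  assumes "i \<in> I" "j \<in> I" "S \<subseteq> C" "S' \<subseteq> C" "S \<inter> S' = {}"
  shows "sz i S j \<le> 1 - sz i S' j"
proof -
  have "sz i (S \<union> S') j = sz i S j + sz i S' j"
    unfolding sz_def using assms finite_C finite_subset by (intro sum.union_disjoint) auto
  with sz_le_1[of i j "S \<union> S'"] assms show ?thesis by auto
qed

lemma sz_complement:
  assumes "i \<in> I" "j \<in> I" "S \<subseteq> C"
  shows "(\<Sum>a\<in>C. \<Sum>b\<in>C. P i j a b * of_bool (a \<notin> S)) = 1 - sz i S j"
proof -
  have "(\<Sum>a\<in>C. \<Sum>b\<in>C. P i j a b * of_bool (a \<notin> S)) = (\<Sum>a\<in>C - S. \<Sum>b\<in>C. P i j a b)"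
    using finite_C by (intro sum.mono_neutral_cong_right) auto
  also have "\<dots> = sz i C j - sz i S j"
    unfolding sz_def using finite_C finite_subset assms by (intro sum_diff) auto
  finally show ?thesis using sz_C assms by simp
qed

text \<open>Summing over the third cell first, with the colours of the pair fixed, allows bounds
  \<open>u\<close> and \<open>v\<close> that depend on the colour. Since the weights
  \<open>P i j\<close> add up to 1, the exceptions cost \<open>2 * r\<close> in total and not per
  colour.\<close>

lemma sum_tri_le:
  assumes I: "i \<in> I" "j \<in> I" "K \<subseteq> I" "finite K"
    and u: "\<And>a. a \<in> C \<Longrightarrow> 0 \<le> u a \<and> card {k\<in>K. sz i (nb i a) k > u a} \<le> r"
    and v: "\<And>b. b \<in> C \<Longrightarrow> 0 \<le> v b \<and> card {k\<in>K. sz j (nb j b) k > v b} \<le> r"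
  shows "(\<Sum>k\<in>K. tri i j k) \<le> real (card K) * (\<Sum>a\<in>C. \<Sum>b\<in>C. P i j a b * (u a * v b)) + 2 * real r"
proof -
  have "(\<Sum>k\<in>K. tri i j k) = (\<Sum>a\<in>C. \<Sum>b\<in>C. P i j a b * (\<Sum>k\<in>K. sz i (nb i a) k * sz j (nb j b) k))"
    unfolding tri_def sum_distrib_left
    by (subst sum.swap, intro sum.cong refl, subst sum.swap, rule refl)
  also have "\<dots> \<le> (\<Sum>a\<in>C. \<Sum>b\<in>C. P i j a b * (real (card K) * (u a * v b) + 2 * real r))"
  proof (intro sum_mono mult_left_mono P_nonneg sum_product_le_exceptions)
    fix a b k assume "k \<in> K"
    then have "k \<in> I" using I by auto
    then show "0 \<le> sz i (nb i a) k \<and> sz i (nb i a) k \<le> 1" "0 \<le> sz j (nb j b) k \<and> sz j (nb j b) k \<le> 1"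
      using I sz_nonneg sz_le_1 nb_indep unfolding indep_def by auto
  qed (use u v I in auto)
  also have "\<dots> = real (card K) * (\<Sum>a\<in>C. \<Sum>b\<in>C. P i j a b * (u a * v b))
      + 2 * real r * (\<Sum>a\<in>C. \<Sum>b\<in>C. P i j a b)"
    by (simp add: sum_distrib_left sum.distrib algebra_simps)
  finally show ?thesis using P_sum I by simp
qed

text \<open>Sizes are rounded to multiples of \<open>1/q\<close>, which bounds the number of Ramsey colours independently
  of the number of colours in \<open>C\<close>.\<close>

definition lev :: "nat \<Rightarrow> nat \<Rightarrow> nat set \<Rightarrow> nat" where
  "lev q i J = max_level (\<lambda>h. \<exists>S. indep i S \<and> (\<forall>j\<in>J. sz i S j \<ge> real h / real q)) q"

lemma lev_0: "\<exists>S. indep i S \<and> (\<forall>j\<in>J. sz i S j \<ge> real 0 / real q)"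
  by (rule exI[of _ "{}"]) (auto simp: indep_def sz_nonneg)

lemma lev_le: "lev q i J \<le> q"
  unfolding lev_def by (rule max_level_le) (rule lev_0)

lemma lev_witness:
  obtains S where "indep i S" "\<And>j. j \<in> J \<Longrightarrow> sz i S j \<ge> real (lev q i J) / real q"
  using max_level_holds[of "\<lambda>h. \<exists>S. indep i S \<and> (\<forall>j\<in>J. sz i S j \<ge> real h / real q)", OF lev_0]
  unfolding lev_def by blast

lemma lev_antimono: "J \<subseteq> J' \<Longrightarrow> lev q i J' \<le> lev q i J"
  unfolding lev_def by (rule max_level_mono) (use lev_0 in blast)+

text \<open>A single set may be large towards a few cells, but not towards any \<open>r\<close> of them at once; averaging
  over the third cell removes these exceptions.\<close>

lemma card_exceptions:
  assumes q: "0 < q" and r: "0 < r" and K: "finite K" "K \<subseteq> I" and i: "i \<in> I"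
    and lev: "\<And>J. J \<subseteq> K \<Longrightarrow> card J = r \<Longrightarrow> lev q i J \<le> g"
    and S: "indep i S"
  shows "card {j\<in>K. sz i S j > real (Suc g) / real q} \<le> r"
proof (rule ccontr)
  assume "\<not> ?thesis"
  then obtain J where J: "J \<subseteq> {j\<in>K. sz i S j > real (Suc g) / real q}" "card J = r"
    using obtain_subset_with_card_n[of r] by (metis linorder_not_le nless_le)
  then have le: "lev q i J \<le> g" using lev by blast
  \<comment> \<open>Within the cap \<open>q\<close> the set \<open>S\<close> would contradict the
    bound on the level; beyond the cap the threshold exceeds 1, which no size does.\<close>
  have "\<not> Suc g \<le> q"
  proof
    assume "Suc g \<le> q"
    have "\<exists>S. indep i S \<and> (\<forall>j\<in>J. sz i S j \<ge> real (Suc g) / real q)"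
      using S J by (intro exI[of _ S]) (auto intro: less_imp_le)
    from max_level_ge[of "\<lambda>h. \<exists>S. indep i S \<and> (\<forall>j\<in>J. sz i S j \<ge> real h / real q)", OF this \<open>Suc g \<le> q\<close>]
    show False using le unfolding lev_def by simp
  qed
  moreover obtain j where "j \<in> J" using J r by fastforce
  moreover from this have "sz i S j \<le> 1" using J K S i by (intro sz_le_1) (auto simp: indep_def)
  moreover have "real (Suc g) / real q \<le> sz i S j" using \<open>j \<in> J\<close> J by auto
  moreover have "1 < real (Suc g) / real q"
    using q \<open>\<not> Suc g \<le> q\<close> by (subst less_divide_eq_1_pos) auto
  ultimately show False by linarith
qed

section \<open>Averaging over the third cell\<close>

lemma tri_small_of_small_levels:
  assumes q: "0 < q" and \<epsilon>: "0 < \<epsilon>" "6 \<le> \<epsilon> * real q" and r: "0 < r"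
    and I: "i \<in> I" "j \<in> I" "K \<subseteq> I" "finite K" and K: "4 * real r < \<epsilon> * real (card K)"
    and lev: "\<And>J. J \<subseteq> K \<Longrightarrow> card J = r \<Longrightarrow> lev q i J \<le> g \<and> lev q j J \<le> g"
    and g: "2 * g \<le> q"
  shows "\<exists>k\<in>K. tri i j k < 1/4 + \<epsilon>"
proof (rule ccontr)
  assume "\<not> ?thesis"
  then have "real (card K) * (1/4 + \<epsilon>) \<le> (\<Sum>k\<in>K. tri i j k)"
    by (intro sum_bounded_below) auto
  also define u where "u = real (Suc g) / real q"
  have "(\<Sum>k\<in>K. tri i j k) \<le> real (card K) * (\<Sum>a\<in>C. \<Sum>b\<in>C. P i j a b * (u * u)) + 2 * real r"
    unfolding u_def
    by (rule sum_tri_le)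
       (use I card_exceptions[OF q r I(4,3) I(1), of g] card_exceptions[OF q r I(4,3) I(2), of g] lev nb_indep in auto)
  also have "(\<Sum>a\<in>C. \<Sum>b\<in>C. P i j a b * (u * u)) = u * u"
    using P_sum I by (simp flip: sum_distrib_right)
  finally have *: "real (card K) * (1/4 + \<epsilon>) \<le> real (card K) * (u*u) + 2 * real r" .
  \<comment> \<open>Rounding costs at most \<open>2 / q \<le> \<epsilon> / 3\<close> and the
    exceptions less than \<open>\<epsilon> / 2\<close> per cell, together less than
    \<epsilon>.\<close>
  have "1 / real q \<le> \<epsilon> / 6" using \<epsilon> q by (simp add: field_simps)
  moreover have q1: "1 / real q \<le> 1" using q by simp
  moreover have "u \<le> 1/2 + 1 / real q" using g q by (simp add: u_def field_simps)
  then have "u * u \<le> (1/2 + 1 / real q) * (1/2 + 1 / real q)" by (intro mult_mono) (auto simp: u_def)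
  moreover have "(1/real q) * (1/real q) \<le> 1 / real q" using q1 by (intro mult_left_le) auto
  ultimately have "u * u \<le> 1/4 + \<epsilon>/3" by (simp add: algebra_simps)
  then have "real (card K) * (u*u) \<le> real (card K) * (1/4 + \<epsilon>/3)" by (intro mult_left_mono) auto
  with * K show False using \<epsilon> by (simp add: algebra_simps)
qed

text \<open>For \<open>c\<close> inside \<open>S\<close> the neighbourhood avoids \<open>S\<close>,
  so it is small towards every cell, without exceptions. For \<open>c\<close> outside
  \<open>S\<close> only the bound by the level is available.\<close>

lemma card_exceptions_indep:
  assumes q: "0 < q" and r: "0 < r" and J: "finite J" "J \<subseteq> I" and i: "i \<in> I"
    and lev: "\<And>J'. J' \<subseteq> J \<Longrightarrow> card J' = r \<Longrightarrow> lev q i J' \<le> g"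
    and S: "indep i S" "\<And>j. j \<in> J \<Longrightarrow> s \<le> sz i S j"
  shows "card {j\<in>J. sz i (nb i c) j > (if c \<in> S then 1 - s else real (Suc g) / real q)} \<le> r"
proof (cases "c \<in> S")
  case True
  then have "nb i c \<inter> S = {}" using S(1) by (auto simp: indep_def nb_def)
  then have "sz i (nb i c) j \<le> 1 - s" if "j \<in> J" for j
    using that S(2)[OF that] sz_disjoint[of i j "nb i c" S] i J S(1) by (auto simp: nb_def indep_def)
  then have "{j\<in>J. sz i (nb i c) j > 1 - s} = {}" by force
  then show ?thesis unfolding if_P[OF True] by (metis card.empty le0)
next
  case False
  then show ?thesis unfolding if_not_P[OF False] by (intro card_exceptions[OF q r J i lev nb_indep])
qed

lemma tri_small_of_large_levels:
  assumes q: "0 < q" and \<epsilon>: "0 < \<epsilon>" "6 \<le> \<epsilon> * real q" and r: "0 < r"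
    and I: "i \<in> I" "k \<in> I" "J \<subseteq> I" "finite J" and J: "4 * real r < \<epsilon> * real (card J)"
    and lev: "\<And>J'. J' \<subseteq> J \<Longrightarrow> card J' = r \<Longrightarrow> lev q i J' \<le> g \<and> lev q k J' \<le> h"
    and lev_i: "g \<le> lev q i (insert k J)" and lev_k: "h \<le> lev q k (insert i J)"
    and g: "q \<le> 2 * g" "q \<le> 2 * h"
  shows "\<exists>j\<in>J. tri i k j < 1/4 + \<epsilon>"
proof (rule ccontr)
  assume "\<not> ?thesis"
  then have big: "real (card J) * (1/4 + \<epsilon>) \<le> (\<Sum>j\<in>J. tri i k j)"
    by (intro sum_bounded_below) auto
  define a b \<eta> where "a = real g / real q" and "b = real h / real q" and "\<eta> = 1 / real q"
  have \<eta>: "0 \<le> \<eta>" "\<eta> \<le> 1" "\<eta> \<le> \<epsilon>/6" using q \<epsilon> by (auto simp: \<eta>_def field_simps)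
  obtain S where S: "indep i S" "\<And>j. j \<in> insert k J \<Longrightarrow> sz i S j \<ge> real (lev q i (insert k J)) / real q"
    using lev_witness by blast
  have Sa: "sz i S j \<ge> a" if "j \<in> insert k J" for j
    using S(2)[OF that] lev_i q unfolding a_def by (smt (verit, best) divide_right_mono of_nat_0_le_iff of_nat_mono)
  obtain S' where S': "indep k S'" "\<And>j. j \<in> insert i J \<Longrightarrow> sz k S' j \<ge> real (lev q k (insert i J)) / real q"
    using lev_witness by blast
  have Sb: "sz k S' j \<ge> b" if "j \<in> insert i J" for j
    using S'(2)[OF that] lev_k q unfolding b_def by (smt (verit, best) divide_right_mono of_nat_0_le_iff of_nat_mono)
  have sub: "S \<subseteq> C" "S' \<subseteq> C" using S(1) S'(1) by (auto simp: indep_def)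
  have "a \<le> 1" "b \<le> 1" using Sa[of k] Sb[of i] sz_le_1[of i k S] sz_le_1[of k i S'] I sub by auto
  have half: "1/2 \<le> a" "1/2 \<le> b" using g q by (auto simp: a_def b_def field_simps)
  \<comment> \<open>Value \<open>1 - a\<close> on \<open>S\<close> and \<open>a + \<eta>\<close> off
    \<open>S\<close>, written affinely in the indicator so that the average of
    \<open>u c * v d\<close> splits into four terms.\<close>
  define u where "u c = 1 - a + (2*a-1+\<eta>) * of_bool (c \<notin> S)" for c
  define v where "v c = 1 - b + (2*b-1+\<eta>) * of_bool (c \<notin> S')" for c
  have eu: "real (Suc g) / real q = a + \<eta>" and ev: "real (Suc h) / real q = b + \<eta>"
    by (auto simp: a_def b_def \<eta>_def add_divide_distrib)
  have u_if: "u c = (if c \<in> S then 1 - a else real (Suc g) / real q)" for c unfolding eu by (simp add: u_def)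
  have exc_u: "card {j\<in>J. sz i (nb i c) j > u c} \<le> r" for c
    unfolding u_if by (rule card_exceptions_indep[OF q r I(4,3,1)]) (use lev S(1) Sa in auto)
  have v_if: "v c = (if c \<in> S' then 1 - b else real (Suc h) / real q)" for c unfolding ev by (simp add: v_def)
  have exc_v: "card {j\<in>J. sz k (nb k c) j > v c} \<le> r" for c
    unfolding v_if by (rule card_exceptions_indep[OF q r I(4,3,2)]) (use lev S'(1) Sb in auto)
  have nonneg: "0 \<le> u c" "0 \<le> v c" for c
    using half \<open>a \<le> 1\<close> \<open>b \<le> 1\<close> \<eta> by (auto simp: u_def v_def)
  define x where "x = (\<Sum>c\<in>C. \<Sum>d\<in>C. P i k c d * of_bool (c \<notin> S))"
  define y where "y = (\<Sum>c\<in>C. \<Sum>d\<in>C. P i k c d * of_bool (d \<notin> S'))"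
  \<comment> \<open>The dependence between the two exceptional events is unknown; only that
    \<open>z\<close> is at most \<open>x\<close> and at most \<open>y\<close> is available. Which of
    them is used is decided by comparing \<open>a\<close> with \<open>b\<close>.\<close>
  define z where "z = (\<Sum>c\<in>C. \<Sum>d\<in>C. P i k c d * (of_bool (c \<notin> S) * of_bool (d \<notin> S')))"
  have x: "x \<le> 1 - a" using sz_complement[OF I(1,2) sub(1)] Sa[of k] by (simp add: x_def)
  have "y = (\<Sum>d\<in>C. \<Sum>c\<in>C. P k i d c * of_bool (d \<notin> S'))"
    unfolding y_def by (subst sum.swap) (simp add: P_sym[of k i])
  then have y: "y \<le> 1 - b" using sz_complement[OF I(2,1) sub(2)] Sb[of i] by simp
  have "z \<le> x" "z \<le> y" unfolding x_def y_def z_def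
    by (intro sum_mono mult_left_mono P_nonneg; simp)+
  have E: "(\<Sum>c\<in>C. \<Sum>d\<in>C. P i k c d * (u c * v d))
     = (1-a)*(1-b) + (1-b)*(2*a-1+\<eta>)*x + (1-a)*(2*b-1+\<eta>)*y + (2*a-1+\<eta>)*(2*b-1+\<eta>)*z"
  proof -
    have "(\<Sum>c\<in>C. \<Sum>d\<in>C. P i k c d * (u c * v d)) = (\<Sum>c\<in>C. \<Sum>d\<in>C.
        (1-a)*(1-b) * P i k c d + (1-b)*(2*a-1+\<eta>) * (P i k c d * of_bool (c \<notin> S))
        + (1-a)*(2*b-1+\<eta>) * (P i k c d * of_bool (d \<notin> S'))
        + (2*a-1+\<eta>)*(2*b-1+\<eta>) * (P i k c d * (of_bool (c \<notin> S) * of_bool (d \<notin> S'))))"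
      unfolding u_def v_def by (intro sum.cong refl) algebra
    also have "\<dots> = (1-a)*(1-b) * (\<Sum>c\<in>C. \<Sum>d\<in>C. P i k c d) + (1-b)*(2*a-1+\<eta>)*x
       + (1-a)*(2*b-1+\<eta>)*y + (2*a-1+\<eta>)*(2*b-1+\<eta>)*z"
      unfolding x_def y_def z_def by (simp only: sum.distrib sum_distrib_left)
    finally show ?thesis using P_sum I by simp
  qed
  have "(\<Sum>c\<in>C. \<Sum>d\<in>C. P i k c d * (u c * v d)) \<le> 1/4 + 3 * \<eta>"
  proof (cases "b \<le> a")
    case True
    have "(1-b)*(2*a-1+\<eta>)*x \<le> (1-b)*(2*a-1+\<eta>)*(1-a)" "(1-a)*(2*b-1+\<eta>)*y \<le> (1-a)*(2*b-1+\<eta>)*(1-b)"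
      "(2*a-1+\<eta>)*(2*b-1+\<eta>)*z \<le> (2*a-1+\<eta>)*(2*b-1+\<eta>)*(1-a)"
      using x y \<open>z \<le> x\<close> \<open>a \<le> 1\<close> \<open>b \<le> 1\<close> half \<eta> by (intro mult_left_mono; auto)+
    then show ?thesis unfolding E using two_sided_bound[of b a \<eta>] True half \<open>a \<le> 1\<close> \<eta> by linarith
  next
    case False
    have "(1-b)*(2*a-1+\<eta>)*x \<le> (1-b)*(2*a-1+\<eta>)*(1-a)" "(1-a)*(2*b-1+\<eta>)*y \<le> (1-a)*(2*b-1+\<eta>)*(1-b)"
      "(2*a-1+\<eta>)*(2*b-1+\<eta>)*z \<le> (2*a-1+\<eta>)*(2*b-1+\<eta>)*(1-b)"
      using x y \<open>z \<le> y\<close> \<open>a \<le> 1\<close> \<open>b \<le> 1\<close> half \<eta> by (intro mult_left_mono; auto)+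
    moreover have "(1-a)*(1-b) + (1-b)*(2*a-1+\<eta>)*(1-a) + (1-a)*(2*b-1+\<eta>)*(1-b) + (2*a-1+\<eta>)*(2*b-1+\<eta>)*(1-b)
      = (1-b)*(1-a) + (1-a)*(2*b-1+\<eta>)*(1-b) + (1-b)*(2*a-1+\<eta>)*(1-a) + (2*b-1+\<eta>)*(2*a-1+\<eta>)*(1-b)"
      by algebra
    ultimately show ?thesis unfolding E using two_sided_bound[of a b \<eta>] False half \<open>b \<le> 1\<close> \<eta> by linarith
  qed
  then have "real (card J) * (\<Sum>c\<in>C. \<Sum>d\<in>C. P i k c d * (u c * v d)) \<le> real (card J) * (1/4 + \<epsilon>/2)"
    using \<eta> by (intro mult_left_mono) auto
  moreover have "(\<Sum>j\<in>J. tri i k j) \<le> real (card J) * (\<Sum>c\<in>C. \<Sum>d\<in>C. P i k c d * (u c * v d)) + 2 * real r"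
    by (rule sum_tri_le) (use I exc_u exc_v nonneg in auto)
  ultimately show False using big J \<epsilon> by (simp add: algebra_simps)
qed

section \<open>Combining the levels on a homogeneous set of cells\<close>

lemma coloured_array_subset:
  assumes "I' \<subseteq> I"
  shows "coloured_array I' C L P"
proof
  show "L i b a" if "L i a b" for i a b using that by (rule L_sym)
  show "\<not> L i a c" if "L i a b" "L i b c" for i a b c using that by (rule triangle_free)
  show "P i j a b = P j i b a" for i j a b by (rule P_sym)
  show "(\<Sum>a\<in>C. \<Sum>b\<in>C. P i j a b) = 1" if "i \<in> I'" "j \<in> I'" for i j
    by (rule P_sum) (use that assms in auto)
qed (rule finite_C P_nonneg)+

text \<open>The two sizes play opposite roles: \<open>low\<close> bounds the levels towards any
  \<open>r\<close> cells from above, while \<open>high\<close>, with the same values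
  \<open>g\<close> and \<open>h\<close>, supplies independent sets reaching these levels towards all
  other cells of a set of \<open>c * Suc r\<close> cells.\<close>

lemma tri_small_of_homogeneous:
  assumes q: "0 < q" and \<epsilon>: "0 < \<epsilon>" "6 \<le> \<epsilon> * real q" and c: "4 / \<epsilon> + 1 < real c"
    and B: "B \<subseteq> I" "finite B" "c * Suc r \<le> card B" and r: "0 < r"
    and low: "\<And>T. T \<in> [B]\<^bsup>Suc r\<^esup> \<Longrightarrow> lev q (Min T) (T - {Min T}) = g \<and> lev q (Max T) (T - {Max T}) = h"
    and high: "\<And>T. T \<in> [B]\<^bsup>(c * Suc r)\<^esup> \<Longrightarrow> lev q (Min T) (T - {Min T}) = g \<and> lev q (Max T) (T - {Max T}) = h"
  shows "\<exists>i\<in>I. \<exists>j\<in>I. \<exists>k\<in>I. i < j \<and> j < k \<and>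
    (tri i j k < 1/4 + \<epsilon> \<or> tri j k i < 1/4 + \<epsilon> \<or> tri i k j < 1/4 + \<epsilon>)"
proof -
  obtain T where T: "T \<subseteq> B" "card T = c * Suc r" using obtain_subset_with_card_n[OF B(3)] by auto
  have fT: "finite T" using T B finite_subset by auto
  have "1 < real c" using c \<epsilon> by (smt (verit) divide_pos_pos)
  then have c1: "2 \<le> c" by simp
  then have "2 * Suc r \<le> card T" using T by (metis mult_le_mono1)
  then have cT: "4 \<le> card T" using r by simp
  \<comment> \<open>Dropping two cells leaves at least \<open>(c - 1) * Suc r\<close> because
    \<open>2 \<le> Suc r\<close>, and \<open>c - 1\<close> exceeds
    \<open>4 / \<epsilon>\<close>.\<close>
  have K: "4 * real r < \<epsilon> * real (card T - 2)"
  proof -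
    have "4 * real (Suc r) < \<epsilon> * (real c - 1) * real (Suc r)"
      using c \<epsilon> by (intro mult_strict_right_mono) (auto simp: field_simps)
    also have "\<dots> \<le> \<epsilon> * real (card T - 2)"
      unfolding T mult.assoc using \<epsilon> r c1 by (intro mult_left_mono) (auto simp: algebra_simps of_nat_diff)
    finally have "4 * real (Suc r) < \<epsilon> * real (card T - 2)" .
    moreover have "4 * real r \<le> 4 * real (Suc r)" by simp
    ultimately show ?thesis by (rule le_less_trans[rotated])
  qed
  have in_I: "T \<subseteq> I" using T B by auto
  have up: "lev q i J \<le> g" if "i \<in> T" "J \<subseteq> T" "card J = r" "\<And>j. j \<in> J \<Longrightarrow> i < j" for i J
  proof -
    have fJ: "finite J" using that fT finite_subset by auto
    have "Min (insert i J) = i" using that fJ by (intro Min_eqI) (auto intro: less_imp_le)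
    moreover have "i \<notin> J" using that by auto
    moreover have "insert i J \<in> [B]\<^bsup>Suc r\<^esup>" using that T fJ \<open>i \<notin> J\<close> by (auto simp: nsets_def)
    ultimately show ?thesis using low[of "insert i J"] by simp
  qed
  have down: "lev q i J \<le> h" if "i \<in> T" "J \<subseteq> T" "card J = r" "\<And>j. j \<in> J \<Longrightarrow> j < i" for i J
  proof -
    have fJ: "finite J" using that fT finite_subset by auto
    have "Max (insert i J) = i" using that fJ by (intro Max_eqI) (auto intro: less_imp_le)
    moreover have "i \<notin> J" using that by auto
    moreover have "insert i J \<in> [B]\<^bsup>Suc r\<^esup>" using that T fJ \<open>i \<notin> J\<close> by (auto simp: nsets_def)
    ultimately show ?thesis using low[of "insert i J"] by simp
  qed
  have ne: "T - {i} \<noteq> {}" for i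
  proof
    assume "T - {i} = {}"
    then show False using card_mono[of "{i}" T] cT by auto
  qed
  have small: "\<exists>k\<in>T - {i,j}. tri i j k < 1/4 + \<epsilon>"
    if ij: "i \<in> T" "j \<in> T" "i \<noteq> j" and g': "2 * g' \<le> q"
      and lev: "\<And>J. J \<subseteq> T - {i,j} \<Longrightarrow> card J = r \<Longrightarrow> lev q i J \<le> g' \<and> lev q j J \<le> g'" for i j g'
  proof -
    have "card (T - {i,j}) = card T - 2" using ij fT by (simp add: card_Diff_subset)
    note K' = K[folded this]
    show ?thesis
      by (rule tri_small_of_small_levels[OF q \<epsilon> r _ _ _ _ K' lev g']) (use ij in_I fT in auto)
  qed
  consider "2 * g \<le> q" | "2 * h \<le> q" | "q \<le> 2 * g" "q \<le> 2 * h" by linarith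
  then show ?thesis
  proof cases
    case 1
    \<comment> \<open>For the two smallest indices every third cell is later than both, so only the
      upward level \<open>g\<close> matters.\<close>
    define i j where "i = Min T" and "j = Min (T - {i})"
    have i: "i \<in> T" "\<And>x. x \<in> T \<Longrightarrow> i \<le> x" unfolding i_def using fT cT by (auto intro!: Min_in)
    have j: "j \<in> T - {i}" "\<And>x. x \<in> T - {i} \<Longrightarrow> j \<le> x"
      unfolding j_def by (rule Min_in[OF _ ne], use fT in simp) (rule Min_le, use fT in auto)
    have "i < j" using i j by (auto simp: order.strict_iff_order)
    have lt: "i < k" "j < k" if "k \<in> T - {i,j}" for k
      using that i(2)[of k] j(2)[of k] by (auto simp: order.strict_iff_order)
    have "lev q i J \<le> g \<and> lev q j J \<le> g" if "J \<subseteq> T - {i,j}" "card J = r" for J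
      using that lt i j by (intro conjI up) auto
    then obtain k where k: "k \<in> T - {i,j}" "tri i j k < 1/4 + \<epsilon>"
      using small[of i j g] i j \<open>i < j\<close> 1 by auto
    then have "i \<in> I" "j \<in> I" "k \<in> I" using i j in_I by auto
    then show ?thesis using lt[OF k(1)] k(2) \<open>i < j\<close> by blast
  next
    case 2
    \<comment> \<open>Mirror image: every third cell is earlier than the two largest, so only
      \<open>h\<close> matters.\<close>
    define i j where "i = Max T" and "j = Max (T - {i})"
    have i: "i \<in> T" "\<And>x. x \<in> T \<Longrightarrow> x \<le> i" unfolding i_def using fT cT by (auto intro!: Max_in)
    have j: "j \<in> T - {i}" "\<And>x. x \<in> T - {i} \<Longrightarrow> x \<le> j"
      unfolding j_def by (rule Max_in[OF _ ne], use fT in simp) (rule Max_ge, use fT in auto)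
    have "j < i" using i j by (auto simp: order.strict_iff_order)
    have lt: "k < i" "k < j" if "k \<in> T - {j,i}" for k
      using that i(2)[of k] j(2)[of k] by (auto simp: order.strict_iff_order)
    have "lev q j J \<le> h \<and> lev q i J \<le> h" if "J \<subseteq> T - {j,i}" "card J = r" for J
      using that lt i j by (intro conjI down) auto
    then obtain k where k: "k \<in> T - {j,i}" "tri j i k < 1/4 + \<epsilon>"
      using small[of j i h] i j \<open>j < i\<close> 2 by auto
    then have "i \<in> I" "j \<in> I" "k \<in> I" using i j in_I by auto
    then show ?thesis using lt[OF k(1)] k(2) \<open>j < i\<close> by blast
  next
    case 3
    \<comment> \<open>With the extreme indices as the pair, the third cell lies between: it is later
      than \<open>i\<close> and earlier than \<open>k\<close>, so both levels enter.\<close>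
    define i where "i = Min T"
    define k where "k = Max T"
    define J where "J = T - {i} - {k}"
    have i: "i \<in> T" "\<And>x. x \<in> T \<Longrightarrow> i \<le> x" unfolding i_def using fT cT by (auto intro!: Min_in)
    have k: "k \<in> T" "\<And>x. x \<in> T \<Longrightarrow> x \<le> k" unfolding k_def using fT cT by (auto intro!: Max_in)
    have "i \<noteq> k"
    proof
      assume "i = k"
      then have "T \<subseteq> {i}" using i k by (auto intro: antisym)
      then have "card T \<le> 1" using card_mono[of "{i}" T] by simp
      with cT show False by simp
    qed
    have lt: "i < j \<and> j < k" if "j \<in> J" for j
      using that i(2)[of j] k(2)[of j] unfolding J_def by (auto simp: order.strict_iff_order)
    have cJ: "card J = card T - 2" using i k fT \<open>i \<noteq> k\<close> by (simp add: J_def)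
    note K' = K[folded cJ]
    have lev: "lev q i J' \<le> g \<and> lev q k J' \<le> h" if "J' \<subseteq> J" "card J' = r" for J'
      using that lt i k by (intro conjI up down) (auto simp: J_def)
    have eq: "insert k J = T - {i}" "insert i J = T - {k}" using i k \<open>i \<noteq> k\<close> by (auto simp: J_def)
    have "T \<in> [B]\<^bsup>(c * Suc r)\<^esup>" using T fT by (auto simp: nsets_def)
    from high[OF this] have "g \<le> lev q i (insert k J)" "h \<le> lev q k (insert i J)"
      unfolding eq i_def[symmetric] k_def[symmetric] by auto
    then have "\<exists>j\<in>J. tri i k j < 1/4 + \<epsilon>"
      by (intro tri_small_of_large_levels[OF q \<epsilon> r _ _ _ _ K' lev _ _ 3])
         (use i k in_I fT in \<open>auto simp: J_def\<close>)
    then obtain j where j: "j \<in> J" "tri i k j < 1/4 + \<epsilon>" by blast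
    have "i \<in> I" "j \<in> I" "k \<in> I" using i j k in_I by (auto simp: J_def)
    then show ?thesis using lt[OF j(1)] j(2) by blast
  qed
qed

end

text \<open>A set of cells is coloured by the level of its first cell towards the others and that of
  its last cell towards the others. The essential point of the statement is that \<open>m\<close> is
  chosen before \<open>C\<close>.\<close>

theorem coloured_array_small_triple:
  fixes \<epsilon> :: real
  assumes \<epsilon>: "0 < \<epsilon>"
  shows "\<exists>m. \<forall>I (C::'c set) L P. coloured_array I C L P \<longrightarrow> finite I \<longrightarrow> m \<le> card I \<longrightarrow>
    (\<exists>i\<in>I. \<exists>j\<in>I. \<exists>k\<in>I. i < j \<and> j < k \<and>
      (coloured_array.tri C L P i j k < 1/4 + \<epsilon> \<or> coloured_array.tri C L P j k i < 1/4 + \<epsilon>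
       \<or> coloured_array.tri C L P i k j < 1/4 + \<epsilon>))"
proof -
  obtain q :: nat where "6 / \<epsilon> < real q" using reals_Archimedean2 by blast
  moreover from this have q: "0 < q" using \<epsilon> by (cases q) (auto simp: field_simps)
  ultimately have q6: "6 \<le> \<epsilon> * real q" using \<epsilon> by (simp add: field_simps)
  obtain c :: nat where c: "4 / \<epsilon> + 1 < real c" using reals_Archimedean2 by blast
  then have "1 < real c" using \<epsilon> by (smt (verit) divide_pos_pos)
  then have c2: "2 \<le> c" by simp
  \<comment> \<open>The sizes start at 2, so that at least one cell remains besides the extreme one,
    and grow by the factor \<open>c\<close>. The \<open>2*q + 2\<close> sizes up to index
    \<open>n\<close> give \<open>2*q + 1\<close> steps, enough to force a stall.\<close>
  define t where "t s = 2 * c ^ s" for s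
  define n where "n = Suc (2 * q)"
  obtain m where m: "\<And>A::nat set. \<And>col. card A \<ge> m \<Longrightarrow> finite A \<Longrightarrow> (\<forall>T. col T < (q+1) * (q+1)) \<Longrightarrow>
     (\<exists>B\<subseteq>A. card B = t n \<and> (\<forall>r\<in>set (map t [0..<Suc n]). \<exists>c. \<forall>T\<in>[B]\<^bsup>r\<^esup>. col T = c))"
    using ramsey_homogeneous_levels[where ?'a = nat, of "(q+1)*(q+1)" "t n" "map t [0..<Suc n]"] by blast
  show ?thesis
  proof (rule exI[of _ m], intro allI impI)
    fix I :: "nat set" and C :: "'c set" and L P
    assume ca: "coloured_array I C L P" and I: "finite I" "m \<le> card I"
    interpret coloured_array I C L P by fact
    define f where "f T = lev q (Min T) (T - {Min T})" for T
    define g where "g T = lev q (Max T) (T - {Max T})" for T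
    \<comment> \<open>The pair of levels is encoded in base \<open>q + 1\<close> and recovered below
      by \<open>div\<close> and \<open>mod\<close>.\<close>
    define col where "col T = f T * (q+1) + g T" for T
    have fg: "f T \<le> q" "g T \<le> q" for T by (auto simp: f_def g_def lev_le)
    have "col T < (q+1)*(q+1)" for T
    proof -
      have "f T * (q+1) \<le> q * (q+1)" using fg by (intro mult_le_mono1)
      then show ?thesis unfolding col_def using fg[of T] by simp
    qed
    then have "\<exists>B\<subseteq>I. card B = t n \<and> (\<forall>r\<in>set (map t [0..<Suc n]). \<exists>c. \<forall>T\<in>[B]\<^bsup>r\<^esup>. col T = c)"
      by (intro m[OF I(2,1)]) blast
    then obtain B where B: "B \<subseteq> I" "card B = t n"
        "\<forall>r\<in>set (map t [0..<Suc n]). \<exists>c. \<forall>T\<in>[B]\<^bsup>r\<^esup>. col T = c" by blast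
    have "\<exists>c. \<forall>T\<in>[B]\<^bsup>(t s)\<^esup>. col T = c" if "s \<le> n" for s
    proof -
      have "t s \<in> set (map t [0..<Suc n])" using that by (simp del: upt_Suc add: less_Suc_eq_le)
      with B(3) show ?thesis by blast
    qed
    then obtain d where d: "\<And>s T. s \<le> n \<Longrightarrow> T \<in> [B]\<^bsup>(t s)\<^esup> \<Longrightarrow> col T = d s" by metis
    define F where "F s = d s div (q+1)" for s
    define G where "G s = d s mod (q+1)" for s
    have FG: "f T = F s" "g T = G s" if "s \<le> n" "T \<in> [B]\<^bsup>(t s)\<^esup>" for s T
    proof -
      have "d s = f T * (q+1) + g T" using d[OF that] by (simp add: col_def)
      moreover have "g T < q + 1" using fg[of T] by simp
      ultimately show "f T = F s" "g T = G s" unfolding F_def G_def by (auto simp del: mult_Suc_right)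
    qed
    have fB: "finite B" using B I finite_subset by auto
    have t_mono: "t s \<le> t s'" if "s \<le> s'" for s s' unfolding t_def using that c2 by (simp add: power_increasing)
    have t_pos: "0 < t s" for s using c2 by (simp add: t_def)
    have ex: "\<exists>T. T \<in> [B]\<^bsup>(t s)\<^esup>" if "s \<le> n" for s
    proof -
      have "t s \<le> card B" using t_mono[OF that] B by simp
      then obtain T where "T \<subseteq> B" "card T = t s" "finite T" by (rule obtain_subset_with_card_n)
      then show ?thesis by (auto simp: nsets_def)
    qed
    have dec: "F (Suc s) \<le> F s \<and> G (Suc s) \<le> G s" if s: "s \<le> 2 * q" for s
    proof -
      obtain T where T: "T \<in> [B]\<^bsup>(t (Suc s))\<^esup>" using ex[of "Suc s"] s by (auto simp: n_def)
      then have T': "finite T" "T \<noteq> {}" "card T = t (Suc s)" "T \<subseteq> B"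
        using t_pos[of "Suc s"] by (auto simp: nsets_def)
      have ts: "t s \<le> card T" unfolding T' by (rule t_mono) simp
      have MM: "Min T \<in> T" "Max T \<in> T" using T' by auto
      have "2 \<le> t s" using c2 by (simp add: t_def)
      \<comment> \<open>A subset with the same minimum and maximum keeps both extreme cells and
        serves fewer cells, so neither level can fall on passing to it.\<close>
      have "card {Min T, Max T} \<le> 2" by (simp add: card_insert_if)
      then have "card {Min T, Max T} \<le> t s" using \<open>2 \<le> t s\<close> by simp
      then obtain T0 where T0: "{Min T, Max T} \<subseteq> T0" "T0 \<subseteq> T" "card T0 = t s"
        using exists_subset_between[of "{Min T, Max T}" "t s" T] ts MM T' by auto
      then have T0': "T0 \<in> [B]\<^bsup>(t s)\<^esup>" "finite T0" using T' finite_subset[of T0 T] by (auto simp: nsets_def)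
      have "Min T0 = Min T" "Max T0 = Max T" using T0 T' T0' by (auto intro!: Min_eqI Max_eqI)
      then have "f T \<le> f T0" "g T \<le> g T0" unfolding f_def g_def using T0 by (auto intro!: lev_antimono)
      then show ?thesis using FG[OF _ T] FG[OF _ T0'(1)] s by (auto simp: n_def)
    qed
    obtain T0 where "T0 \<in> [B]\<^bsup>(t 0)\<^esup>" using ex[of 0] by auto
    then have "F 0 \<le> q" "G 0 \<le> q" using FG[of 0 T0] fg[of T0] by auto
    then obtain s where s: "s \<le> 2*q" "F (Suc s) = F s" "G (Suc s) = G s"
      using two_monotone_sequences_stall[of q F G] dec by blast
    obtain r where r: "t s = Suc r" "0 < r"
    proof -
      have "2 \<le> t s" using c2 by (simp add: t_def)
      then show ?thesis using that[of "t s - 1"] by auto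
    qed
    have tS: "t (Suc s) = c * Suc r" unfolding r(1)[symmetric] by (simp add: t_def)
    show "\<exists>i\<in>I. \<exists>j\<in>I. \<exists>k\<in>I. i < j \<and> j < k \<and>
      (tri i j k < 1/4 + \<epsilon> \<or> tri j k i < 1/4 + \<epsilon> \<or> tri i k j < 1/4 + \<epsilon>)"
    proof (rule tri_small_of_homogeneous[OF q \<epsilon> q6 c B(1) fB _ r(2), of "F s" "G s"])
      show "c * Suc r \<le> card B" using t_mono[of "Suc s" n] s B tS by (simp add: n_def)
      show "lev q (Min T) (T - {Min T}) = F s \<and> lev q (Max T) (T - {Max T}) = G s" if "T \<in> [B]\<^bsup>Suc r\<^esup>" for T
        using FG[of s T] that s r unfolding f_def g_def n_def by auto
      show "lev q (Min T) (T - {Min T}) = F s \<and> lev q (Max T) (T - {Max T}) = G s" if "T \<in> [B]\<^bsup>(c * Suc r)\<^esup>" for T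
        using FG[of "Suc s" T] that s tS unfolding f_def g_def n_def by auto
    qed
  qed
qed

section \<open>Regularity\<close>

definition fibre :: "'b set \<Rightarrow> ('b \<Rightarrow> 'l) \<Rightarrow> 'b \<Rightarrow> 'b set" where
  "fibre \<Omega> \<phi> \<omega> = {\<omega>' \<in> \<Omega>. \<phi> \<omega>' = \<phi> \<omega>}"

text \<open>The conditional expectation of \<open>r\<close> given the label, kept as a function on
  points.\<close>

definition fibre_avg :: "'b set \<Rightarrow> ('b \<Rightarrow> 'l) \<Rightarrow> ('b \<Rightarrow> real) \<Rightarrow> 'b \<Rightarrow> real" where
  "fibre_avg \<Omega> \<phi> r \<omega> = (\<Sum>\<omega>'\<in>fibre \<Omega> \<phi> \<omega>. r \<omega>') / real (card (fibre \<Omega> \<phi> \<omega>))"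

lemma fibre_avg_eq: "\<phi> \<omega>' = \<phi> \<omega> \<Longrightarrow> fibre_avg \<Omega> \<phi> r \<omega>' = fibre_avg \<Omega> \<phi> r \<omega>"
  by (simp add: fibre_avg_def fibre_def)

lemma fibre_subset: "fibre \<Omega> \<phi> \<omega> \<subseteq> \<Omega>"
  by (auto simp: fibre_def)

text \<open>A set closed under fibres is a disjoint union of fibres, so fibrewise inequalities add
  up.\<close>

lemma sum_over_fibres:
  fixes g h :: "'b \<Rightarrow> real"
  assumes fin: "finite \<Omega>" and A: "A \<subseteq> \<Omega>" "\<And>\<omega>. \<omega> \<in> A \<Longrightarrow> fibre \<Omega> \<phi> \<omega> \<subseteq> A"
    and le: "\<And>\<omega>. \<omega> \<in> A \<Longrightarrow> sum g (fibre \<Omega> \<phi> \<omega>) \<le> sum h (fibre \<Omega> \<phi> \<omega>)"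
  shows "sum g A \<le> sum h A"
proof -
  have fA: "finite A" using A(1) fin by (rule finite_subset)
  have "(\<Sum>\<omega>\<in>{\<omega>\<in>A. \<phi> \<omega> = l}. g \<omega>) \<le> (\<Sum>\<omega>\<in>{\<omega>\<in>A. \<phi> \<omega> = l}. h \<omega>)" if l: "l \<in> \<phi> ` A" for l
  proof -
    obtain \<omega> where \<omega>: "\<omega> \<in> A" "l = \<phi> \<omega>" using l by auto
    have "{\<omega>'\<in>A. \<phi> \<omega>' = l} = fibre \<Omega> \<phi> \<omega>" using \<omega> A(1) A(2)[OF \<omega>(1)] by (auto simp: fibre_def)
    then show ?thesis using le[OF \<omega>(1)] by simp
  qed
  then have "(\<Sum>l\<in>\<phi>`A. \<Sum>\<omega>\<in>{\<omega>\<in>A. \<phi> \<omega> = l}. g \<omega>) \<le> (\<Sum>l\<in>\<phi>`A. \<Sum>\<omega>\<in>{\<omega>\<in>A. \<phi> \<omega> = l}. h \<omega>)"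
    by (rule sum_mono)
  then show ?thesis
    using sum.image_gen[OF fA, of g \<phi>] sum.image_gen[OF fA, of h \<phi>] by linarith
qed

lemma sum_fibre_avg_fibre:
  assumes "finite \<Omega>"
  shows "sum (fibre_avg \<Omega> \<phi> r) (fibre \<Omega> \<phi> \<omega>) = sum r (fibre \<Omega> \<phi> \<omega>)"
proof (cases "fibre \<Omega> \<phi> \<omega> = {}")
  case False
  have "sum (fibre_avg \<Omega> \<phi> r) (fibre \<Omega> \<phi> \<omega>) = (\<Sum>_\<in>fibre \<Omega> \<phi> \<omega>. fibre_avg \<Omega> \<phi> r \<omega>)"
    by (intro sum.cong refl fibre_avg_eq) (simp add: fibre_def)
  moreover have "finite (fibre \<Omega> \<phi> \<omega>)" using assms fibre_subset finite_subset by metis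
  ultimately show ?thesis using False by (simp add: fibre_avg_def)
qed simp

lemma sum_fibre_avg:
  assumes "finite \<Omega>" "A \<subseteq> \<Omega>" "\<And>\<omega>. \<omega> \<in> A \<Longrightarrow> fibre \<Omega> \<phi> \<omega> \<subseteq> A"
  shows "sum (fibre_avg \<Omega> \<phi> r) A = sum r A"
  by (rule antisym; rule sum_over_fibres[OF assms(1-3)]) (auto simp: sum_fibre_avg_fibre[OF assms(1)])

text \<open>A factor that is constant on fibres can be pulled out of the conditional
  expectation.\<close>

lemma sum_fibre_avg_mult:
  assumes fin: "finite \<Omega>" and g: "\<And>\<omega> \<omega>'. \<omega> \<in> \<Omega> \<Longrightarrow> \<omega>' \<in> \<Omega> \<Longrightarrow> \<phi> \<omega> = \<phi> \<omega>' \<Longrightarrow> g \<omega> = g \<omega>'"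
  shows "(\<Sum>\<omega>\<in>\<Omega>. fibre_avg \<Omega> \<phi> r \<omega> * g \<omega>) = (\<Sum>\<omega>\<in>\<Omega>. r \<omega> * g \<omega>)"
proof -
  have "fibre_avg \<Omega> \<phi> r \<omega> * g \<omega> = fibre_avg \<Omega> \<phi> (\<lambda>\<omega>. r \<omega> * g \<omega>) \<omega>" if "\<omega> \<in> \<Omega>" for \<omega>
  proof -
    have "(\<Sum>\<omega>'\<in>fibre \<Omega> \<phi> \<omega>. r \<omega>' * g \<omega>') = (\<Sum>\<omega>'\<in>fibre \<Omega> \<phi> \<omega>. r \<omega>' * g \<omega>)"
      by (intro sum.cong refl arg_cong2[where f="(*)"] g) (use that in \<open>simp_all add: fibre_def\<close>)
    then show ?thesis by (simp add: fibre_avg_def flip: sum_distrib_right)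
  qed
  then have "(\<Sum>\<omega>\<in>\<Omega>. fibre_avg \<Omega> \<phi> r \<omega> * g \<omega>) = sum (fibre_avg \<Omega> \<phi> (\<lambda>\<omega>. r \<omega> * g \<omega>)) \<Omega>" by simp
  also have "\<dots> = (\<Sum>\<omega>\<in>\<Omega>. r \<omega> * g \<omega>)" by (rule sum_fibre_avg[OF fin]) (auto simp: fibre_def)
  finally show ?thesis .
qed

text \<open>The coarse average is constant on the fibres of either labelling, so its products with
  the fine average, with \<open>r\<close> and with itself all have the same sum. Hence it is
  orthogonal to the difference of the averages.\<close>

lemma fibre_avg_pythagoras:
  assumes fin: "finite \<Omega>" and ref: "\<And>\<omega> \<omega>'. \<omega> \<in> \<Omega> \<Longrightarrow> \<omega>' \<in> \<Omega> \<Longrightarrow> \<psi> \<omega> = \<psi> \<omega>' \<Longrightarrow> \<phi> \<omega> = \<phi> \<omega>'"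
  shows "(\<Sum>\<omega>\<in>\<Omega>. (fibre_avg \<Omega> \<psi> r \<omega> - fibre_avg \<Omega> \<phi> r \<omega>)\<^sup>2)
     = (\<Sum>\<omega>\<in>\<Omega>. (fibre_avg \<Omega> \<psi> r \<omega>)\<^sup>2) - (\<Sum>\<omega>\<in>\<Omega>. (fibre_avg \<Omega> \<phi> r \<omega>)\<^sup>2)"
proof -
  let ?f = "fibre_avg \<Omega> \<phi> r" and ?g = "fibre_avg \<Omega> \<psi> r"
  have "(\<Sum>\<omega>\<in>\<Omega>. ?g \<omega> * ?f \<omega>) = (\<Sum>\<omega>\<in>\<Omega>. r \<omega> * ?f \<omega>)"
    by (rule sum_fibre_avg_mult[OF fin], rule fibre_avg_eq, rule ref)
  also have "\<dots> = (\<Sum>\<omega>\<in>\<Omega>. ?f \<omega> * ?f \<omega>)"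
    by (rule sum_fibre_avg_mult[OF fin, symmetric], rule fibre_avg_eq)
  finally have *: "(\<Sum>\<omega>\<in>\<Omega>. ?g \<omega> * ?f \<omega>) = (\<Sum>\<omega>\<in>\<Omega>. ?f \<omega> * ?f \<omega>)" .
  have "(\<Sum>\<omega>\<in>\<Omega>. (?g \<omega> - ?f \<omega>)\<^sup>2) = (\<Sum>\<omega>\<in>\<Omega>. (?g \<omega>)\<^sup>2) - 2 * (\<Sum>\<omega>\<in>\<Omega>. ?g \<omega> * ?f \<omega>) + (\<Sum>\<omega>\<in>\<Omega>. (?f \<omega>)\<^sup>2)"
    by (simp add: power2_diff sum.distrib sum_subtractf sum_distrib_left algebra_simps)
  then show ?thesis unfolding * by (simp add: power2_eq_square)
qed

text \<open>Markov's inequality for fibre averages; the condition defining the set depends only on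
  the fibre, so the set is a union of fibres.\<close>

lemma card_dense_fibres:
  fixes g :: "'b \<Rightarrow> real"
  assumes fin: "finite \<Omega>" and g: "\<And>\<omega>. 0 \<le> g \<omega>"
  shows "\<delta> * real (card {\<omega>\<in>\<Omega>. \<delta> * real (card (fibre \<Omega> \<phi> \<omega>)) < sum g (fibre \<Omega> \<phi> \<omega>)}) \<le> sum g \<Omega>"
    (is "\<delta> * real (card ?S) \<le> _")
proof -
  have "(\<Sum>\<omega>\<in>?S. \<delta>) \<le> sum g ?S"
    by (rule sum_over_fibres[OF fin, of _ \<phi>]) (auto simp: mult.commute fibre_def)
  also have "\<dots> \<le> sum g \<Omega>" using fin g by (intro sum_mono2) auto
  finally show ?thesis by (simp add: mult.commute)
qed

lemma sum_sparse_fibres: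
  fixes g :: "'b \<Rightarrow> real"
  assumes fin: "finite \<Omega>" and \<delta>: "0 \<le> \<delta>"
  shows "sum g {\<omega>\<in>\<Omega>. sum g (fibre \<Omega> \<phi> \<omega>) \<le> \<delta> * real (card (fibre \<Omega> \<phi> \<omega>))} \<le> \<delta> * real (card \<Omega>)"
    (is "sum g ?S \<le> _")
proof -
  have "sum g ?S \<le> (\<Sum>\<omega>\<in>?S. \<delta>)"
    by (rule sum_over_fibres[OF fin, of _ \<phi>]) (auto simp: mult.commute fibre_def)
  also have "\<dots> = \<delta> * real (card ?S)" by simp
  also have "\<dots> \<le> \<delta> * real (card \<Omega>)" using fin \<delta> by (intro mult_left_mono of_nat_mono card_mono) auto
  finally show ?thesis .
qed

lemma fibre_avg_nonneg: "(\<And>\<omega>. 0 \<le> r \<omega>) \<Longrightarrow> 0 \<le> fibre_avg \<Omega> \<phi> r \<omega>"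
  unfolding fibre_avg_def by (intro divide_nonneg_nonneg sum_nonneg) auto

lemma fibre_avg_le_1: 
  assumes "\<And>\<omega>. r \<omega> \<le> 1" shows "fibre_avg \<Omega> \<phi> r \<omega> \<le> 1"
proof -
  have "(\<Sum>\<omega>'\<in>fibre \<Omega> \<phi> \<omega>. r \<omega>') \<le> real (card (fibre \<Omega> \<phi> \<omega>))"
    using sum_bounded_above[of "fibre \<Omega> \<phi> \<omega>" r 1] assms by simp
  then show ?thesis unfolding fibre_avg_def by (simp add: divide_le_eq)
qed

lemma square_sum_le:
  fixes h :: "'b \<Rightarrow> real"
  shows "(\<Sum>\<omega>\<in>A. h \<omega>)\<^sup>2 \<le> real (card A) * (\<Sum>\<omega>\<in>A. (h \<omega>)\<^sup>2)"
proof (cases "finite A")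
  case True
  have "0 \<le> (\<Sum>x\<in>A. \<Sum>y\<in>A. (h x - h y)\<^sup>2)" by (intro sum_nonneg) auto
  also have "\<dots> = (\<Sum>x\<in>A. \<Sum>y\<in>A. (h x)\<^sup>2) + (\<Sum>x\<in>A. \<Sum>y\<in>A. (h y)\<^sup>2) - 2 * (\<Sum>x\<in>A. \<Sum>y\<in>A. h x * h y)"
    by (simp add: power2_diff sum.distrib sum_subtractf sum_distrib_left mult.assoc)
  also have "(\<Sum>x\<in>A. \<Sum>y\<in>A. h x * h y) = (\<Sum>\<omega>\<in>A. h \<omega>)\<^sup>2"
    by (simp add: power2_eq_square sum_product)
  also have "(\<Sum>x\<in>A. \<Sum>y\<in>A. (h x)\<^sup>2) = real (card A) * (\<Sum>\<omega>\<in>A. (h \<omega>)\<^sup>2)"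
    by (simp add: sum_distrib_left)
  finally show ?thesis by simp
qed simp

section \<open>Regular pairs, energy and the regularity lemma\<close>

definition edge_count :: "('v \<Rightarrow> 'v \<Rightarrow> bool) \<Rightarrow> 'v set \<Rightarrow> 'v set \<Rightarrow> real" where
  "edge_count R X Y = (\<Sum>x\<in>X. \<Sum>y\<in>Y. of_bool (R x y))"

definition density :: "('v \<Rightarrow> 'v \<Rightarrow> bool) \<Rightarrow> 'v set \<Rightarrow> 'v set \<Rightarrow> real" where
  "density R A B = edge_count R A B / (real (card A) * real (card B))"

text \<open>Regularity in the sense of the cut norm: the error is relative to the whole cells, so
  small \<open>X\<close> and \<open>Y\<close> need no exclusion and errors can be summed over
  arbitrary vertices.\<close>

definition regular_pair :: "real \<Rightarrow> 'v set \<Rightarrow> 'v set \<Rightarrow> ('v \<Rightarrow> 'v \<Rightarrow> bool) \<Rightarrow> bool" where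
  "regular_pair \<epsilon> A B R \<longleftrightarrow> (\<forall>X\<subseteq>A. \<forall>Y\<subseteq>B.
     \<bar>edge_count R X Y - density R A B * (real (card X) * real (card Y))\<bar>
       \<le> \<epsilon> * (real (card A) * real (card B)))"

abbreviation pair_label :: "('v \<Rightarrow> 'l) \<Rightarrow> 'v \<times> 'v \<Rightarrow> 'l \<times> 'l" where
  "pair_label \<pi> \<equiv> map_prod \<pi> \<pi>"

text \<open>Irregularity is recorded by points instead of pairs of cells, so that cells are automatically weighted
  by their sizes and no equitable partition is needed.\<close>

definition irregular_points :: "real \<Rightarrow> 'v set \<Rightarrow> ('v \<Rightarrow> 'l) \<Rightarrow> 'r set \<Rightarrow> ('r \<Rightarrow> 'v \<Rightarrow> 'v \<Rightarrow> bool) \<Rightarrow> ('v \<times> 'v) set" where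
  "irregular_points \<epsilon> V \<pi> \<R> R = {(x,y) \<in> V \<times> V. \<exists>r\<in>\<R>. \<not> regular_pair \<epsilon> (fibre V \<pi> x) (fibre V \<pi> y) (R r)}"

definition energy :: "'v set \<Rightarrow> ('v \<Rightarrow> 'l) \<Rightarrow> 'r set \<Rightarrow> ('r \<Rightarrow> 'v \<Rightarrow> 'v \<Rightarrow> bool) \<Rightarrow> real" where
  "energy V \<pi> \<R> R = (\<Sum>r\<in>\<R>. \<Sum>p\<in>V\<times>V. (fibre_avg (V\<times>V) (pair_label \<pi>) (\<lambda>(x,y). of_bool (R r x y)) p)\<^sup>2)"

lemma fibre_pair_label: "p \<in> V \<times> V \<Longrightarrow> fibre (V \<times> V) (pair_label \<pi>) p = fibre V \<pi> (fst p) \<times> fibre V \<pi> (snd p)"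
  by (cases p) (auto simp: fibre_def)

lemma edge_count_pairs: "edge_count R X Y = (\<Sum>p\<in>X\<times>Y. case p of (x,y) \<Rightarrow> of_bool (R x y))"
  unfolding edge_count_def by (simp add: sum.cartesian_product)

lemma energy_le:
  assumes "finite V" "finite \<R>"
  shows "energy V \<pi> \<R> R \<le> real (card \<R>) * (real (card V))\<^sup>2"
proof -
  have "energy V \<pi> \<R> R \<le> (\<Sum>r\<in>\<R>. \<Sum>p\<in>V\<times>V. 1)"
    unfolding energy_def
    by (intro sum_mono power_le_one fibre_avg_nonneg fibre_avg_le_1) (auto split: prod.splits)
  then show ?thesis by (simp add: card_cartesian_product power2_eq_square)
qed

lemma energy_nonneg: "0 \<le> energy V \<pi> \<R> R"
  unfolding energy_def by (intro sum_nonneg) auto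

text \<open>Refining produces tuples and sets as labels; recoding them by naturals keeps the label
  type fixed, so that refinement can be iterated.\<close>

lemma injective_relabelling:
  fixes \<pi> :: "'v \<Rightarrow> 'l"
  assumes "finite V"
  obtains \<pi>' :: "'v \<Rightarrow> nat" where "\<And>x y. x \<in> V \<Longrightarrow> y \<in> V \<Longrightarrow> \<pi>' x = \<pi>' y \<longleftrightarrow> \<pi> x = \<pi> y" "card (\<pi>' ` V) = card (\<pi> ` V)"
proof -
  obtain h :: "'l \<Rightarrow> nat" where h: "inj_on h (\<pi> ` V)"
    using finite_imp_inj_to_nat_seg[of "\<pi> ` V"] assms by blast
  show ?thesis
  proof (rule that[of "h \<circ> \<pi>"])
    show "card ((h \<circ> \<pi>) ` V) = card (\<pi> ` V)" using card_image[OF h] by (simp add: image_comp)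
  qed (use h in \<open>auto simp: inj_on_def\<close>)
qed

text \<open>On \<open>X \<times> Y\<close>, a union of refined cells, the fine average has the true
  edge count as its sum, while the coarse average is the constant density. Irregularity makes the
  sum of the difference large, and Cauchy-Schwarz turns this into a gain of squares.\<close>

lemma energy_increment_cell:
  fixes \<epsilon> :: real
  assumes "finite V" "x0 \<in> V" "y0 \<in> V" and \<epsilon>: "0 < \<epsilon>"
    and A: "A = fibre V \<pi> x0" and B: "B = fibre V \<pi> y0"
    and X: "X \<subseteq> A" "\<And>x. x \<in> X \<Longrightarrow> fibre V \<pi>' x \<subseteq> X" and Y: "Y \<subseteq> B" "\<And>y. y \<in> Y \<Longrightarrow> fibre V \<pi>' y \<subseteq> Y"
    and irr: "\<epsilon> * (real (card A) * real (card B)) <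
      \<bar>edge_count R X Y - density R A B * (real (card X) * real (card Y))\<bar>"
  shows "\<epsilon>\<^sup>2 * real (card (A \<times> B)) \<le> (\<Sum>p\<in>A\<times>B. (fibre_avg (V\<times>V) (pair_label \<pi>') (\<lambda>(x,y). of_bool (R x y)) p
      - fibre_avg (V\<times>V) (pair_label \<pi>) (\<lambda>(x,y). of_bool (R x y)) p)\<^sup>2)" (is "_ \<le> (\<Sum>p\<in>_. (?g p - ?f p)\<^sup>2)")
proof -
  let ?r = "\<lambda>(x,y). of_bool (R x y) :: real"
  have sub: "A \<subseteq> V" "B \<subseteq> V" unfolding A B by (auto simp: fibre_def)
  have fin: "finite A" "finite B" using sub assms(1) finite_subset by blast+
  have XY: "X \<times> Y \<subseteq> A \<times> B" using X Y by auto
  then have XYV: "X \<times> Y \<subseteq> V \<times> V" using sub by auto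
  have "sum ?g (X \<times> Y) = sum ?r (X \<times> Y)"
  proof (rule sum_fibre_avg)
    fix p assume p: "p \<in> X \<times> Y"
    then have "p \<in> V \<times> V" using XYV by blast
    then show "fibre (V \<times> V) (pair_label \<pi>') p \<subseteq> X \<times> Y"
      using p X(2)[of "fst p"] Y(2)[of "snd p"] by (subst fibre_pair_label) auto
  qed (use assms(1) XYV in auto)
  then have g: "sum ?g (X \<times> Y) = edge_count R X Y" by (simp add: edge_count_pairs)
  have f: "?f p = density R A B" if "p \<in> A \<times> B" for p
  proof -
    have "fibre (V \<times> V) (pair_label \<pi>) p = A \<times> B"
      using that sub unfolding A B by (subst fibre_pair_label) (auto simp: fibre_def)
    then show ?thesis by (simp add: fibre_avg_def edge_count_pairs density_def card_cartesian_product)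
  qed
  have "sum ?f (X \<times> Y) = (\<Sum>p\<in>X\<times>Y. density R A B)"
    using XY f by (intro sum.cong refl) blast
  then have "sum ?f (X \<times> Y) = density R A B * (real (card X) * real (card Y))"
    by (simp add: card_cartesian_product)
  then have "\<epsilon> * real (card (A \<times> B)) < \<bar>\<Sum>p\<in>X\<times>Y. ?g p - ?f p\<bar>"
    using irr g by (simp add: sum_subtractf card_cartesian_product)
  moreover have "0 \<le> \<epsilon> * real (card (A \<times> B))" using \<epsilon> by simp
  ultimately have "(\<epsilon> * real (card (A \<times> B)))\<^sup>2 \<le> \<bar>\<Sum>p\<in>X\<times>Y. ?g p - ?f p\<bar>\<^sup>2"
    by (intro power_mono) auto
  also have "\<dots> \<le> real (card (X \<times> Y)) * (\<Sum>p\<in>X\<times>Y. (?g p - ?f p)\<^sup>2)"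
    using square_sum_le by simp
  also have "\<dots> \<le> real (card (A \<times> B)) * (\<Sum>p\<in>A\<times>B. (?g p - ?f p)\<^sup>2)"
    using XY fin by (intro mult_mono sum_mono2 sum_nonneg of_nat_mono card_mono) auto
  finally have *: "real (card (A \<times> B)) * (\<epsilon>\<^sup>2 * real (card (A \<times> B))) \<le> real (card (A \<times> B)) * (\<Sum>p\<in>A\<times>B. (?g p - ?f p)\<^sup>2)"
    by (simp add: power2_eq_square algebra_simps)
  have "x0 \<in> A" "y0 \<in> B" using assms(2,3) by (auto simp: A B fibre_def)
  then have "A \<times> B \<noteq> {}" by auto
  then have "0 < real (card (A \<times> B))" using fin by (metis card_gt_0_iff finite_cartesian_product of_nat_0_less_iff)
  then show ?thesis using * by simp
qed

text \<open>Each irregular pair of points contributes \<open>\<epsilon>\<^sup>2\<close>, and there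
  are more than \<open>\<epsilon> * (card V)\<^sup>2\<close> of them.\<close>

lemma energy_increment:
  fixes \<pi> :: "'v \<Rightarrow> nat" and R :: "'r \<Rightarrow> 'v \<Rightarrow> 'v \<Rightarrow> bool"
  assumes V: "finite V" and \<R>: "finite \<R>" and \<epsilon>: "0 < \<epsilon>"
    and k: "card (\<pi> ` V) \<le> k"
    and bad: "\<epsilon> * (real (card V))\<^sup>2 < real (card (irregular_points \<epsilon> V \<pi> \<R> R))"
  obtains \<pi>' :: "'v \<Rightarrow> nat" where
    "card (\<pi>' ` V) \<le> k * 2 ^ (2 * k)"
    "\<And>x y. x \<in> V \<Longrightarrow> y \<in> V \<Longrightarrow> \<pi>' x = \<pi>' y \<Longrightarrow> \<pi> x = \<pi> y"
    "energy V \<pi> \<R> R + \<epsilon> ^ 3 * (real (card V))\<^sup>2 \<le> energy V \<pi>' \<R> R"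
proof -
  define part where "part a = {x\<in>V. \<pi> x = a}" for a
  have part: "fibre V \<pi> x = part (\<pi> x)" for x by (simp add: fibre_def part_def)
  define irr where "irr a b r X Y \<longleftrightarrow> r \<in> \<R> \<and> X \<subseteq> part a \<and> Y \<subseteq> part b \<and>
     \<epsilon> * (real (card (part a)) * real (card (part b))) <
      \<bar>edge_count (R r) X Y - density (R r) (part a) (part b) * (real (card X) * real (card Y))\<bar>" for a b r X Y
  define Bd where "Bd = irregular_points \<epsilon> V \<pi> \<R> R"
  have ex: "\<exists>r X Y. irr (\<pi> x) (\<pi> y) r X Y" if "(x,y) \<in> Bd" for x y
    using that unfolding Bd_def irregular_points_def regular_pair_def irr_def part by (auto simp: not_le)
  \<comment> \<open>One witness is chosen per pair of labels, not per pair of points. Thus every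
    cell is cut by at most \<open>2 * k\<close> sets, which gives the factor
    \<open>2 ^ (2 * k)\<close>.\<close>
  define w where "w a b = (SOME w. irr a b (fst w) (fst (snd w)) (snd (snd w)))" for a b
  define r X Y where "r a b = fst (w a b)" and "X a b = fst (snd (w a b))" and "Y a b = snd (snd (w a b))" for a b
  have rXY: "irr a b (r a b) (X a b) (Y a b)" if "\<exists>r X Y. irr a b r X Y" for a b
  proof -
    have "\<exists>w. irr a b (fst w) (fst (snd w)) (snd (snd w))" using that by auto
    from someI_ex[OF this] show ?thesis unfolding r_def X_def Y_def w_def .
  qed
  \<comment> \<open>common refinement of \<open>\<pi>\<close> by all witnesses of irregularity\<close>
  define \<pi>0 where "\<pi>0 x = (\<pi> x, {b\<in>\<pi>`V. x \<in> X (\<pi> x) b}, {a\<in>\<pi>`V. x \<in> Y a (\<pi> x)})" for x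
  obtain \<pi>' :: "'v \<Rightarrow> nat" where \<pi>': "\<And>x y. x \<in> V \<Longrightarrow> y \<in> V \<Longrightarrow> \<pi>' x = \<pi>' y \<longleftrightarrow> \<pi>0 x = \<pi>0 y"
    "card (\<pi>' ` V) = card (\<pi>0 ` V)"
    using injective_relabelling[OF V, of \<pi>0] by blast
  have "\<pi>0 ` V \<subseteq> (\<pi> ` V) \<times> (Pow (\<pi>`V) \<times> Pow (\<pi>`V))" by (auto simp: \<pi>0_def)
  then have "card (\<pi>0 ` V) \<le> card ((\<pi> ` V) \<times> (Pow (\<pi>`V) \<times> Pow (\<pi>`V)))" using V by (intro card_mono) auto
  also have "\<dots> = card (\<pi>`V) * 2 ^ (2 * card (\<pi>`V))"
    using V by (simp add: card_cartesian_product card_Pow power_add mult_2)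
  also have "\<dots> \<le> k * 2 ^ (2 * k)" using k by (intro mult_le_mono power_increasing) auto
  finally have card: "card (\<pi>' ` V) \<le> k * 2 ^ (2 * k)" using \<pi>'(2) by simp
  have ref: "\<pi> x = \<pi> y" if "x \<in> V" "y \<in> V" "\<pi>' x = \<pi>' y" for x y
    using \<pi>'(1)[OF that(1,2)] that(3) by (simp add: \<pi>0_def)
  let ?G = "\<lambda>q p. fibre_avg (V\<times>V) (pair_label \<pi>') (\<lambda>(x,y). of_bool (R q x y)) p"
  let ?F = "\<lambda>q p. fibre_avg (V\<times>V) (pair_label \<pi>) (\<lambda>(x,y). of_bool (R q x y)) p"
  have pyth: "(\<Sum>p\<in>V\<times>V. (?G q p - ?F q p)\<^sup>2) = (\<Sum>p\<in>V\<times>V. (?G q p)\<^sup>2) - (\<Sum>p\<in>V\<times>V. (?F q p)\<^sup>2)" for q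
  proof (rule fibre_avg_pythagoras)
    fix p p' assume "p \<in> V \<times> V" "p' \<in> V \<times> V" "pair_label \<pi>' p = pair_label \<pi>' p'"
    then show "pair_label \<pi> p = pair_label \<pi> p'"
      using ref[of "fst p" "fst p'"] ref[of "snd p" "snd p'"] by (cases p; cases p') simp
  qed (use V in simp)
  have diff: "energy V \<pi>' \<R> R - energy V \<pi> \<R> R = (\<Sum>q\<in>\<R>. \<Sum>p\<in>V\<times>V. (?G q p - ?F q p)\<^sup>2)"
    unfolding energy_def pyth by (simp add: sum_subtractf)
  have BdV: "Bd \<subseteq> V \<times> V" by (auto simp: Bd_def irregular_points_def)
  \<comment> \<open>\<open>Bd\<close> is a union of products of cells, so the gains of single cell
    pairs add up. The violating relation varies with the pair; summing over all relations absorbs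
    this.\<close>
  have "(\<Sum>p\<in>Bd. \<epsilon>\<^sup>2) \<le> (\<Sum>p\<in>Bd. \<Sum>q\<in>\<R>. (?G q p - ?F q p)\<^sup>2)"
  proof (rule sum_over_fibres[of "V \<times> V" _ "pair_label \<pi>"])
    fix p assume p: "p \<in> Bd"
    obtain x y where xy: "p = (x,y)" by (cases p)
    then have xyV: "x \<in> V" "y \<in> V" using p BdV by auto
    have fib: "fibre (V\<times>V) (pair_label \<pi>) p = part (\<pi> x) \<times> part (\<pi> y)"
      using xyV by (subst fibre_pair_label) (auto simp: xy part)
    show "fibre (V\<times>V) (pair_label \<pi>) p \<subseteq> Bd"
      using p unfolding fib unfolding xy Bd_def irregular_points_def by (auto simp: part part_def)
    have irr: "irr (\<pi> x) (\<pi> y) (r (\<pi> x) (\<pi> y)) (X (\<pi> x) (\<pi> y)) (Y (\<pi> x) (\<pi> y))"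
      using ex rXY p xy by blast
    have satX: "fibre V \<pi>' u \<subseteq> X (\<pi> x) (\<pi> y)" if "u \<in> X (\<pi> x) (\<pi> y)" for u
    proof
      fix v assume v: "v \<in> fibre V \<pi>' u"
      have "u \<in> part (\<pi> x)" using that irr by (auto simp: irr_def)
      then have u: "u \<in> V" "\<pi> u = \<pi> x" by (auto simp: part_def)
      have "\<pi>0 v = \<pi>0 u" using v u \<pi>'(1)[of v u] by (simp add: fibre_def)
      moreover have "\<pi> y \<in> {b\<in>\<pi>`V. u \<in> X (\<pi> u) b}" using that u xyV by auto
      ultimately show "v \<in> X (\<pi> x) (\<pi> y)" using u unfolding \<pi>0_def by auto
    qed
    have satY: "fibre V \<pi>' u \<subseteq> Y (\<pi> x) (\<pi> y)" if "u \<in> Y (\<pi> x) (\<pi> y)" for u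
    proof
      fix v assume v: "v \<in> fibre V \<pi>' u"
      have "u \<in> part (\<pi> y)" using that irr by (auto simp: irr_def)
      then have u: "u \<in> V" "\<pi> u = \<pi> y" by (auto simp: part_def)
      have "\<pi>0 v = \<pi>0 u" using v u \<pi>'(1)[of v u] by (simp add: fibre_def)
      moreover have "\<pi> x \<in> {a\<in>\<pi>`V. u \<in> Y a (\<pi> u)}" using that u xyV by auto
      ultimately show "v \<in> Y (\<pi> x) (\<pi> y)" using u unfolding \<pi>0_def by auto
    qed
    have "\<epsilon>\<^sup>2 * real (card (part (\<pi> x) \<times> part (\<pi> y)))
       \<le> (\<Sum>p\<in>part (\<pi> x) \<times> part (\<pi> y). (?G (r (\<pi> x) (\<pi> y)) p - ?F (r (\<pi> x) (\<pi> y)) p)\<^sup>2)"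
      by (rule energy_increment_cell[OF V xyV \<epsilon> part[symmetric] part[symmetric] _ satX _ satY])
         (use irr in \<open>auto simp: irr_def\<close>)
    also have "\<dots> \<le> (\<Sum>p\<in>part (\<pi> x) \<times> part (\<pi> y). \<Sum>q\<in>\<R>. (?G q p - ?F q p)\<^sup>2)"
      by (intro sum_mono member_le_sum) (use irr \<R> in \<open>auto simp: irr_def\<close>)
    finally show "(\<Sum>p\<in>fibre (V\<times>V) (pair_label \<pi>) p. \<epsilon>\<^sup>2)
        \<le> (\<Sum>p\<in>fibre (V\<times>V) (pair_label \<pi>) p. \<Sum>q\<in>\<R>. (?G q p - ?F q p)\<^sup>2)"
      unfolding fib by (simp add: mult.commute)
  qed (use V BdV in auto)
  also have "\<dots> \<le> (\<Sum>p\<in>V\<times>V. \<Sum>q\<in>\<R>. (?G q p - ?F q p)\<^sup>2)"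
    by (intro sum_mono2) (use V BdV in \<open>auto intro!: sum_nonneg\<close>)
  also have "\<dots> = energy V \<pi>' \<R> R - energy V \<pi> \<R> R" unfolding diff by (rule sum.swap)
  finally have "\<epsilon>\<^sup>2 * real (card Bd) \<le> energy V \<pi>' \<R> R - energy V \<pi> \<R> R" by (simp add: mult.commute)
  moreover have "\<epsilon>\<^sup>2 * (\<epsilon> * (real (card V))\<^sup>2) \<le> \<epsilon>\<^sup>2 * real (card Bd)"
    using bad unfolding Bd_def by (intro mult_left_mono) auto
  ultimately have "energy V \<pi> \<R> R + \<epsilon> ^ 3 * (real (card V))\<^sup>2 \<le> energy V \<pi>' \<R> R"
    by (simp add: power3_eq_cube power2_eq_square mult.assoc)
  then show ?thesis using that card ref by blast
qed

definition regular_partition ::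
    "real \<Rightarrow> 'v set \<Rightarrow> 'r set \<Rightarrow> ('r \<Rightarrow> 'v \<Rightarrow> 'v \<Rightarrow> bool) \<Rightarrow> ('v \<Rightarrow> 'l) \<Rightarrow> nat \<Rightarrow> ('v \<Rightarrow> nat) \<Rightarrow> bool" where
  "regular_partition \<epsilon> V \<R> R \<pi>\<^sub>0 T \<pi> \<longleftrightarrow> card (\<pi> ` V) \<le> T \<and> (\<forall>x\<in>V. \<forall>y\<in>V. \<pi> x = \<pi> y \<longrightarrow> \<pi>\<^sub>0 x = \<pi>\<^sub>0 y) \<and>
     real (card (irregular_points \<epsilon> V \<pi> \<R> R)) \<le> \<epsilon> * (real (card V))\<^sup>2"

text \<open>The energy is at most \<open>q * (card V)\<^sup>2\<close> and rises by
  \<open>\<epsilon> ^ 3 * (card V)\<^sup>2\<close> per refinement, which bounds the number of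
  refinements independently of \<open>V\<close>.\<close>

theorem regularity_lemma:
  fixes \<epsilon> :: real
  assumes \<epsilon>: "0 < \<epsilon>"
  shows "\<exists>T. \<forall>(V::'v set) (\<R>::'r set) R (\<pi>\<^sub>0::'v \<Rightarrow> 'l). finite V \<longrightarrow> finite \<R> \<longrightarrow> card \<R> \<le> q \<longrightarrow> card (\<pi>\<^sub>0 ` V) \<le> k \<longrightarrow>
    (\<exists>\<pi>. regular_partition \<epsilon> V \<R> R \<pi>\<^sub>0 T \<pi>)"
proof -
  \<comment> \<open>The added \<open>k\<close> makes the sequence monotone, so a partition found at
    any earlier stage also respects the final bound \<open>t S\<close>.\<close>
  define t where "t = rec_nat k (\<lambda>_ k. k * 2 ^ (2 * k) + k)"
  have t0: "t 0 = k" and tS: "t (Suc s) = t s * 2 ^ (2 * t s) + t s" for s by (simp_all add: t_def)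
  obtain S :: nat where S: "real q / \<epsilon> ^ 3 < real S" using reals_Archimedean2 by blast
  have mono: "t s \<le> t s'" if "s \<le> s'" for s s' by (rule lift_Suc_mono_le[OF _ that]) (simp add: tS)
  show ?thesis
  proof (rule exI[of _ "t S"], intro allI impI, rule ccontr)
    fix V :: "'v set" and \<R> :: "'r set" and R and \<pi>\<^sub>0 :: "'v \<Rightarrow> 'l"
    assume fin: "finite V" "finite \<R>" and q: "card \<R> \<le> q" and k: "card (\<pi>\<^sub>0 ` V) \<le> k"
    assume no: "\<not> (\<exists>\<pi>. regular_partition \<epsilon> V \<R> R \<pi>\<^sub>0 (t S) \<pi>)"
    have "\<exists>\<pi> :: 'v \<Rightarrow> nat. card (\<pi> ` V) \<le> t s \<and> (\<forall>x\<in>V. \<forall>y\<in>V. \<pi> x = \<pi> y \<longrightarrow> \<pi>\<^sub>0 x = \<pi>\<^sub>0 y) \<and>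
        real s * (\<epsilon> ^ 3 * (real (card V))\<^sup>2) \<le> energy V \<pi> \<R> R" if "s \<le> S" for s
      using that
    proof (induction s)
      case 0
      obtain \<pi> :: "'v \<Rightarrow> nat" where "\<And>x y. x \<in> V \<Longrightarrow> y \<in> V \<Longrightarrow> \<pi> x = \<pi> y \<longleftrightarrow> \<pi>\<^sub>0 x = \<pi>\<^sub>0 y"
        "card (\<pi> ` V) = card (\<pi>\<^sub>0 ` V)"
        using injective_relabelling[OF fin(1), of \<pi>\<^sub>0] by blast
      then show ?case using k by (intro exI[of _ \<pi>]) (auto simp: t0 energy_nonneg)
    next
      case (Suc s)
      then obtain \<pi> :: "'v \<Rightarrow> nat" where \<pi>: "card (\<pi> ` V) \<le> t s" "\<forall>x\<in>V. \<forall>y\<in>V. \<pi> x = \<pi> y \<longrightarrow> \<pi>\<^sub>0 x = \<pi>\<^sub>0 y"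
        "real s * (\<epsilon> ^ 3 * (real (card V))\<^sup>2) \<le> energy V \<pi> \<R> R" by auto
      have "card (\<pi> ` V) \<le> t S" using \<pi>(1) mono[of s S] Suc.prems by linarith
      with no \<pi>(2) have bad: "\<epsilon> * (real (card V))\<^sup>2 < real (card (irregular_points \<epsilon> V \<pi> \<R> R))"
        unfolding regular_partition_def by (metis not_le)
      obtain \<pi>' :: "'v \<Rightarrow> nat" where \<pi>': "card (\<pi>' ` V) \<le> t s * 2 ^ (2 * t s)"
        "\<And>x y. x \<in> V \<Longrightarrow> y \<in> V \<Longrightarrow> \<pi>' x = \<pi>' y \<Longrightarrow> \<pi> x = \<pi> y"
        "energy V \<pi> \<R> R + \<epsilon> ^ 3 * (real (card V))\<^sup>2 \<le> energy V \<pi>' \<R> R"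
        using energy_increment[OF fin \<epsilon> \<pi>(1) bad] by blast
      have "card (\<pi>' ` V) \<le> t (Suc s)" using \<pi>'(1) by (simp add: tS)
      moreover have "\<forall>x\<in>V. \<forall>y\<in>V. \<pi>' x = \<pi>' y \<longrightarrow> \<pi>\<^sub>0 x = \<pi>\<^sub>0 y" using \<pi>(2) \<pi>'(2) by blast
      moreover have "real (Suc s) * (\<epsilon> ^ 3 * (real (card V))\<^sup>2) \<le> energy V \<pi>' \<R> R"
        using \<pi>(3) \<pi>'(3) by (simp add: distrib_right)
      ultimately show ?case by blast
    qed
    from this[of S] obtain \<pi> :: "'v \<Rightarrow> nat" where
      "real S * (\<epsilon> ^ 3 * (real (card V))\<^sup>2) \<le> energy V \<pi> \<R> R" by auto
    also have "\<dots> \<le> real q * (real (card V))\<^sup>2"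
      using energy_le[OF fin, of \<pi> R] q by (smt (verit) mult_right_mono of_nat_mono zero_le_power2)
    finally have le: "real S * \<epsilon> ^ 3 * (real (card V))\<^sup>2 \<le> real q * (real (card V))\<^sup>2" by (simp add: mult.assoc)
    \<comment> \<open>On the empty set every labelling is regular; a non-empty \<open>V\<close> is
      needed to cancel \<open>(card V)\<^sup>2\<close>.\<close>
    have "V \<noteq> {}"
    proof
      assume "V = {}"
      then show False using no by (simp add: regular_partition_def irregular_points_def)
    qed
    then have "0 < (real (card V))\<^sup>2" using fin by (simp add: card_gt_0_iff)
    with le have "real S * \<epsilon> ^ 3 \<le> real q" by simp
    then show False using S \<epsilon> by (simp add: field_simps)
  qed
qed

section \<open>Graphs with few triangles\<close>

definition triangle_count :: "('v \<Rightarrow> 'v \<Rightarrow> bool) \<Rightarrow> 'v set \<Rightarrow> real" where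
  "triangle_count G V = (\<Sum>x\<in>V. \<Sum>y\<in>V. \<Sum>z\<in>V. of_bool (G x y \<and> G y z \<and> G x z))"

lemma edge_count_nonneg: "0 \<le> edge_count R X Y"
  unfolding edge_count_def by (intro sum_nonneg) auto

lemma edge_count_le: "edge_count R X Y \<le> real (card X) * real (card Y)"
proof -
  have "edge_count R X Y \<le> (\<Sum>x\<in>X. \<Sum>y\<in>Y. 1)" unfolding edge_count_def by (intro sum_mono) auto
  then show ?thesis by simp
qed

lemma edge_count_sym:
  assumes "\<And>x y. R x y \<Longrightarrow> R y x" shows "edge_count R X Y = edge_count R Y X"
proof -
  have "edge_count R X Y = (\<Sum>y\<in>Y. \<Sum>x\<in>X. of_bool (R x y))" unfolding edge_count_def by (rule sum.swap)
  also have "\<dots> = edge_count R Y X" unfolding edge_count_def using assms by (intro sum.cong refl) auto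
  finally show ?thesis .
qed

lemma regular_pairD:
  assumes "regular_pair \<epsilon> A B R" "X \<subseteq> A" "Y \<subseteq> B"
  shows "edge_count R X Y \<le> density R A B * (real (card X) * real (card Y)) + \<epsilon> * (real (card A) * real (card B))"
    and "edge_count R X Y \<ge> density R A B * (real (card X) * real (card Y)) - \<epsilon> * (real (card A) * real (card B))"
  using assms unfolding regular_pair_def by (smt (verit))+

lemma density_nonneg: "0 \<le> density R A B"
  unfolding density_def using edge_count_nonneg by (intro divide_nonneg_nonneg) auto

lemma density_le_1: "density R A B \<le> 1"
  unfolding density_def using edge_count_le[of R A B] by (auto simp: divide_le_eq mult_less_0_iff)

lemma density_mult: "finite A \<Longrightarrow> finite B \<Longrightarrow> density R A B * (real (card A) * real (card B)) = edge_count R A B"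
  by (cases "A = {} \<or> B = {}") (auto simp: density_def edge_count_def)

lemma sum_of_bool_card: "finite A \<Longrightarrow> (\<Sum>x\<in>A. of_bool (P x)) = real (card {x\<in>A. P x})"
  by (simp add: of_bool_def sum.If_cases Int_def)

lemma regular_triple_triangles:
  fixes G :: "'v \<Rightarrow> 'v \<Rightarrow> bool"
  assumes fin: "finite A" "finite B" "finite C" and sym: "\<And>x y. G x y \<Longrightarrow> G y x"
    and reg: "regular_pair \<epsilon> A B G" "regular_pair \<epsilon> A C G"
    and d: "\<delta> \<le> density G A B" "\<delta> \<le> density G A C" "\<delta> \<le> density G B C" and \<delta>: "0 \<le> \<delta>" and \<epsilon>: "0 \<le> \<epsilon>"
  shows "(\<delta> ^ 3 - 2 * \<epsilon>) * (real (card A) * real (card B) * real (card C))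
    \<le> (\<Sum>x\<in>A. \<Sum>y\<in>B. \<Sum>z\<in>C. of_bool (G x y \<and> G y z \<and> G x z))"
proof -
  define a b c where "a = real (card A)" and "b = real (card B)" and "c = real (card C)"
  have abc: "0 \<le> a" "0 \<le> b" "0 \<le> c" by (auto simp: a_def b_def c_def)
  let ?d = "density G A B"
  define NA NB NC where "NA z = {x\<in>A. G x z}" and "NB z = {y\<in>B. G y z}" and "NC y = {z\<in>C. G y z}" for y z
  \<comment> \<open>Paths from \<open>A\<close> through \<open>C\<close> to \<open>B\<close>,
    counted from the end in \<open>B\<close> by regularity and then regrouped by their middle
    vertex.\<close>
  have cherries: "(\<delta> * \<delta> - \<epsilon>) * (a*b*c) \<le> (\<Sum>z\<in>C. real (card (NA z)) * real (card (NB z)))"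
  proof -
    have "(\<delta> * \<delta> - \<epsilon>) * (a*b*c) \<le> density G A C * a * (density G B C * (b * c)) - \<epsilon> * (a*b*c)"
    proof -
      have "\<delta> * \<delta> * (a*b*c) \<le> density G A C * density G B C * (a*b*c)"
        using d \<delta> abc by (intro mult_right_mono mult_mono) auto
      then show ?thesis by (simp add: algebra_simps)
    qed
    also have "\<dots> = density G A C * a * edge_count G B C - \<epsilon> * (a*b*c)"
      using density_mult[OF fin(2,3), of G] by (simp add: b_def c_def)
    also have "\<dots> = (\<Sum>y\<in>B. density G A C * (a * real (card (NC y))) - \<epsilon> * (a * c))"
      by (simp add: edge_count_def NC_def Collect_conj_eq fin sum_subtractf sum_distrib_left b_def mult.assoc mult.left_commute)
    also have "\<dots> \<le> (\<Sum>y\<in>B. edge_count G A (NC y))"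
      unfolding a_def c_def by (intro sum_mono regular_pairD(2) reg) (auto simp: NC_def)
    also have "\<dots> = (\<Sum>y\<in>B. \<Sum>z\<in>C. \<Sum>x\<in>A. of_bool (G y z) * of_bool (G x z))"
    proof (rule sum.cong[OF refl])
      fix y
      have "edge_count G A (NC y) = (\<Sum>z\<in>NC y. \<Sum>x\<in>A. of_bool (G x z))"
        unfolding edge_count_def by (rule sum.swap)
      also have "\<dots> = (\<Sum>z\<in>C. \<Sum>x\<in>A. of_bool (G y z) * of_bool (G x z))"
        by (rule sum.mono_neutral_cong_left) (use fin in \<open>auto simp: NC_def\<close>)
      finally show "edge_count G A (NC y) = (\<Sum>z\<in>C. \<Sum>x\<in>A. of_bool (G y z) * of_bool (G x z))" .
    qed
    also have "\<dots> = (\<Sum>z\<in>C. \<Sum>y\<in>B. \<Sum>x\<in>A. of_bool (G y z) * of_bool (G x z))" by (rule sum.swap)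
    also have "\<dots> = (\<Sum>z\<in>C. (\<Sum>y\<in>B. of_bool (G y z)) * (\<Sum>x\<in>A. of_bool (G x z)))"
      by (simp add: sum_product)
    also have "\<dots> = (\<Sum>z\<in>C. real (card (NA z)) * real (card (NB z)))"
      by (simp add: Collect_conj_eq fin NA_def NB_def mult.commute)
    finally show ?thesis .
  qed
  have d1: "?d \<le> 1" "0 \<le> ?d" by (rule density_le_1, rule density_nonneg)
  have "(\<delta> ^ 3 - 2 * \<epsilon>) * (a*b*c) \<le> (?d * (\<delta> * \<delta> - \<epsilon>) - \<epsilon>) * (a*b*c)"
  proof (rule mult_right_mono)
    have "\<delta> * (\<delta> * \<delta>) \<le> ?d * (\<delta> * \<delta>)" using d \<delta> by (intro mult_right_mono) auto
    moreover have "?d * \<epsilon> \<le> 1 * \<epsilon>" using d1 \<epsilon> by (intro mult_right_mono) auto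
    ultimately show "\<delta> ^ 3 - 2 * \<epsilon> \<le> ?d * (\<delta> * \<delta> - \<epsilon>) - \<epsilon>" by (simp add: power3_eq_cube right_diff_distrib)
  qed (use abc in auto)
  also have "\<dots> = ?d * ((\<delta> * \<delta> - \<epsilon>) * (a*b*c)) - \<epsilon> * (a*b*c)" by (simp add: algebra_simps)
  also have "\<dots> \<le> ?d * (\<Sum>z\<in>C. real (card (NA z)) * real (card (NB z))) - \<epsilon> * (a*b*c)"
    using cherries d1 by (intro diff_right_mono mult_left_mono) auto
  also have "\<dots> = (\<Sum>z\<in>C. ?d * (real (card (NA z)) * real (card (NB z))) - \<epsilon> * (a * b))"
    by (simp add: sum_subtractf sum_distrib_left c_def mult.assoc mult.left_commute)
  also have "\<dots> \<le> (\<Sum>z\<in>C. edge_count G (NA z) (NB z))"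
    unfolding a_def b_def by (intro sum_mono regular_pairD(2) reg) (auto simp: NA_def NB_def)
  also have "\<dots> = (\<Sum>z\<in>C. \<Sum>x\<in>A. \<Sum>y\<in>B. of_bool (G x y \<and> G y z \<and> G x z))"
  proof (rule sum.cong[OF refl])
    fix z
    have "edge_count G (NA z) (NB z) = (\<Sum>x\<in>NA z. \<Sum>y\<in>B. of_bool (G x y \<and> G y z))"
      unfolding edge_count_def
      by (intro sum.cong[OF refl] sum.mono_neutral_cong_left) (use fin in \<open>auto simp: NB_def\<close>)
    also have "\<dots> = (\<Sum>x\<in>A. \<Sum>y\<in>B. of_bool (G x y \<and> G y z \<and> G x z))"
      by (rule sum.mono_neutral_cong_left) (use fin in \<open>auto simp: NA_def\<close>)
    finally show "edge_count G (NA z) (NB z) = (\<Sum>x\<in>A. \<Sum>y\<in>B. of_bool (G x y \<and> G y z \<and> G x z))" .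
  qed
  also have "\<dots> = (\<Sum>x\<in>A. \<Sum>z\<in>C. \<Sum>y\<in>B. of_bool (G x y \<and> G y z \<and> G x z))"
    by (rule sum.swap)
  also have "\<dots> = (\<Sum>x\<in>A. \<Sum>y\<in>B. \<Sum>z\<in>C. of_bool (G x y \<and> G y z \<and> G x z))"
    by (rule sum.cong[OF refl], rule sum.swap)
  finally show ?thesis by (simp add: a_def b_def c_def)
qed

section \<open>The reduced graph of a graph with few triangles\<close>

lemma card_small_fibres:
  fixes s :: real
  assumes "finite V" "0 \<le> s"
  shows "real (card {x\<in>V. real (card (fibre V \<pi> x)) < s}) \<le> real (card (\<pi> ` V)) * s"
proof -
  define S where "S = {x\<in>V. real (card (fibre V \<pi> x)) < s}"
  have fS: "finite S" using assms by (simp add: S_def)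
  have "real (card S) = (\<Sum>l\<in>\<pi>`S. \<Sum>x\<in>{x\<in>S. \<pi> x = l}. 1)"
    using sum.image_gen[OF fS, of "\<lambda>_. 1::real" \<pi>] by simp
  also have "\<dots> \<le> (\<Sum>l\<in>\<pi>`S. s)"
  proof (rule sum_mono)
    fix l assume "l \<in> \<pi> ` S"
    then obtain x where x: "x \<in> S" "l = \<pi> x" by auto
    have "card {x\<in>S. \<pi> x = l} \<le> card (fibre V \<pi> x)"
      using assms by (intro card_mono) (auto simp: fibre_def x S_def)
    then show "(\<Sum>x\<in>{x\<in>S. \<pi> x = l}. 1) \<le> s" using x(1) by (simp add: S_def)
  qed
  also have "\<dots> \<le> real (card (\<pi> ` V)) * s"
    using assms by (simp, intro mult_right_mono of_nat_mono card_mono) (auto simp: S_def)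
  finally show ?thesis by (simp add: S_def)
qed

lemma card_sparse_edges:
  assumes V: "finite V" and \<delta>: "0 \<le> \<delta>"
  shows "real (card {(x,y) \<in> V \<times> V. density R (fibre V \<pi> x) (fibre V \<pi> y) < \<delta> \<and> R x y}) \<le> \<delta> * (real (card V))\<^sup>2"
proof -
  let ?g = "\<lambda>p. of_bool (case_prod R p) :: real" and ?F = "fibre (V \<times> V) (pair_label \<pi>)"
  let ?S = "{p \<in> V \<times> V. sum ?g (?F p) \<le> \<delta> * real (card (?F p))}"
  have fin: "finite (V \<times> V)" "finite (fibre V \<pi> x)" for x using V by (auto simp: fibre_def)
  have "(x,y) \<in> ?S" if "x \<in> V" "y \<in> V" "density R (fibre V \<pi> x) (fibre V \<pi> y) < \<delta>" for x y
  proof -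
    have fib: "?F (x,y) = fibre V \<pi> x \<times> fibre V \<pi> y" using that by (subst fibre_pair_label) auto
    have "sum ?g (?F (x,y)) = edge_count R (fibre V \<pi> x) (fibre V \<pi> y)"
      unfolding fib edge_count_pairs by (intro sum.cong refl) auto
    also have "\<dots> = density R (fibre V \<pi> x) (fibre V \<pi> y) * real (card (?F (x,y)))"
      unfolding fib using fin by (simp add: density_mult card_cartesian_product)
    also have "\<dots> \<le> \<delta> * real (card (?F (x,y)))" using that by (intro mult_right_mono) auto
    finally show ?thesis using that by simp
  qed
  then have "card {(x,y) \<in> V \<times> V. density R (fibre V \<pi> x) (fibre V \<pi> y) < \<delta> \<and> R x y} \<le> card {p\<in>?S. case_prod R p}"
    using fin by (intro card_mono) auto
  also have "real (card {p\<in>?S. case_prod R p}) = sum ?g ?S" using fin by (intro sum_of_bool_card[symmetric]) auto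
  also have "\<dots> \<le> \<delta> * real (card (V \<times> V))" using fin(1) \<delta> by (rule sum_sparse_fibres)
  finally show ?thesis by (simp add: card_cartesian_product power2_eq_square)
qed

text \<open>\<open>a = b = d\<close> in the third clause excludes loops, so hardly any edges lie
  inside a colour class. The bound on colours is imposed on all points, also outside
  \<open>V\<close>.\<close>

definition triangle_free_colouring ::
    "real \<Rightarrow> 'v set \<Rightarrow> ('v \<Rightarrow> 'v \<Rightarrow> bool) \<Rightarrow> nat \<Rightarrow> ('v \<Rightarrow> nat) \<Rightarrow> (nat \<Rightarrow> nat \<Rightarrow> bool) \<Rightarrow> bool" where
  "triangle_free_colouring \<delta> V G K c L \<longleftrightarrow>
     (\<forall>x. c x < K) \<and> (\<forall>a b. L a b \<longrightarrow> L b a) \<and> (\<forall>a b d. L a b \<longrightarrow> L b d \<longrightarrow> \<not> L a d) \<and>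
     real (card {(x,y) \<in> V \<times> V. G x y \<and> \<not> L (c x) (c y)}) \<le> \<delta> * (real (card V))\<^sup>2"

lemma triangle_free_colouringD:
  assumes "triangle_free_colouring \<delta> V G K c L"
  shows "c x < K" "L a b \<Longrightarrow> L b a" "L a b \<Longrightarrow> L b d \<Longrightarrow> \<not> L a d"
    "real (card {(x,y) \<in> V \<times> V. G x y \<and> \<not> L (c x) (c y)}) \<le> \<delta> * (real (card V))\<^sup>2"
proof -
  note D = assms[unfolded triangle_free_colouring_def]
  show "c x < K" by (rule D[THEN conjunct1, rule_format])
  show "L b a" if "L a b" by (rule D[THEN conjunct2, THEN conjunct1, rule_format, OF that])
  show "\<not> L a d" if "L a b" "L b d"
    by (rule D[THEN conjunct2, THEN conjunct2, THEN conjunct1, rule_format, OF that])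
qed (rule assms[unfolded triangle_free_colouring_def, THEN conjunct2, THEN conjunct2, THEN conjunct2])

text \<open>The cleaning step of the triangle removal lemma: \<open>L\<close> keeps the pairs of
  large cells that are regular and dense. A triangle in \<open>L\<close> would already produce more
  than \<open>\<tau> * (card V) ^ 3\<close> triangles in \<open>G\<close>.\<close>

theorem few_triangles_structure:
  fixes \<delta> :: real
  assumes \<delta>: "0 < \<delta>"
  shows "\<exists>K \<tau>. 0 < \<tau> \<and> (\<forall>(V::'v set) G. finite V \<longrightarrow> (\<forall>x y. G x y \<longrightarrow> G y x) \<longrightarrow> triangle_count G V \<le> \<tau> * real (card V) ^ 3 \<longrightarrow>
    (\<exists>c L. triangle_free_colouring \<delta> V G K c L))"
proof -
  \<comment> \<open>Irregular pairs in both orders lose \<open>2 * \<epsilon>\<close>, small cells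
    on either side and sparse pairs lose \<open>3 * \<delta>1\<close>; the total is at most
    \<open>4 * \<delta>1\<close>.\<close>
  define \<delta>1 where "\<delta>1 = min \<delta> 1 / 4"
  have \<delta>1: "0 < \<delta>1" "\<delta>1 \<le> 1" "4 * \<delta>1 \<le> \<delta>" using \<delta> by (auto simp: \<delta>1_def)
  define \<epsilon> where "\<epsilon> = \<delta>1 ^ 3 / 4"
  have "\<delta>1 ^ 3 \<le> \<delta>1 ^ 1" using \<delta>1 by (intro power_decreasing) auto
  then have \<epsilon>: "0 < \<epsilon>" "4 * \<epsilon> \<le> \<delta>1" using \<delta>1 by (auto simp: \<epsilon>_def)
  from regularity_lemma[OF \<epsilon>(1), where ?'v='v and ?'r=unit and ?'l=bool, of 1 1]
  obtain T where T: "\<forall>(V::'v set) (\<R>::unit set) R (\<pi>\<^sub>0::'v \<Rightarrow> bool).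
      finite V \<longrightarrow> finite \<R> \<longrightarrow> card \<R> \<le> 1 \<longrightarrow> card (\<pi>\<^sub>0 ` V) \<le> 1 \<longrightarrow>
      (\<exists>\<pi>. regular_partition \<epsilon> V \<R> R \<pi>\<^sub>0 T \<pi>)" by (rule exE)
  define K where "K = Suc T"
  have K: "0 < real K" "real T \<le> real K" by (auto simp: K_def)
  \<comment> \<open>The choice of \<epsilon> leaves
    \<open>\<delta>1 ^ 3 - 2 * \<epsilon> = \<delta>1 ^ 3 / 2\<close>, and the cells of
    \<open>L\<close> have at least \<open>\<delta>1 * n / K\<close> vertices, \<open>n\<close> being
    the order of the graph; \<tau> is half of what this forces.\<close>
  define \<tau> where "\<tau> = \<delta>1 ^ 3 / 4 * (\<delta>1 / K) ^ 3"
  have \<tau>: "0 < \<tau>" using \<delta>1 K by (auto simp: \<tau>_def)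
  show ?thesis
  proof (rule exI[of _ K], rule exI[of _ \<tau>], intro conjI \<tau> allI impI)
    fix V :: "'v set" and G
    assume V: "finite V" and sym: "\<forall>x y. G x y \<longrightarrow> G y x" and few: "triangle_count G V \<le> \<tau> * real (card V) ^ 3"
    have "card ((\<lambda>_. True) ` V) \<le> 1" by (simp add: image_constant_conv)
    with T[rule_format, of V "{()}" "\<lambda>_. True" "\<lambda>_. G"] V
    obtain \<pi> :: "'v \<Rightarrow> nat" where \<pi>: "card (\<pi> ` V) \<le> T"
       "real (card (irregular_points \<epsilon> V \<pi> {()} (\<lambda>_. G))) \<le> \<epsilon> * (real (card V))\<^sup>2" by (auto simp: regular_partition_def)
    obtain h :: "nat \<Rightarrow> nat" where h: "inj_on h (\<pi> ` V)" "h ` (\<pi> ` V) \<subseteq> {..<K}"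
      using card_le_inj[of "\<pi> ` V" "{..<K}"] V \<pi>(1) by (auto simp: K_def)
    define c where "c x = (if x \<in> V then h (\<pi> x) else 0)" for x
    have cK: "c x < K" for x using h(2) by (force simp: c_def K_def)
    have c_eq: "c x = c y \<longleftrightarrow> \<pi> x = \<pi> y" if "x \<in> V" "y \<in> V" for x y
      using that h(1) by (auto simp: c_def inj_on_def)
    let ?n = "real (card V)"
    let ?f = "fibre V \<pi>"
    define Ir where "Ir = irregular_points \<epsilon> V \<pi> {()} (\<lambda>_. G)"
    define big where "big x \<longleftrightarrow> \<delta>1 * ?n / real K \<le> real (card (?f x))" for x
    define good where "good x y \<longleftrightarrow> x \<in> V \<and> y \<in> V \<and> (x,y) \<notin> Ir \<and> (y,x) \<notin> Ir \<and> big x \<and> big y \<and> \<delta>1 \<le> density G (?f x) (?f y)" for x y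
    \<comment> \<open>Goodness depends on the cells only, and \<open>c\<close> is injective on
      cells, so \<open>L\<close> is well defined on colours.\<close>
    have good_cong: "good x y \<longleftrightarrow> good x' y'" if "x \<in> V" "y \<in> V" "x' \<in> V" "y' \<in> V" "\<pi> x = \<pi> x'" "\<pi> y = \<pi> y'" for x x' y y'
    proof -
      have "?f x = ?f x'" "?f y = ?f y'" using that by (auto simp: fibre_def)
      then show ?thesis using that by (simp add: good_def big_def Ir_def irregular_points_def)
    qed
    define L where "L a b \<longleftrightarrow> (\<exists>x y. good x y \<and> c x = a \<and> c y = b)" for a b
    have L_iff: "L (c x) (c y) \<longleftrightarrow> good x y" if "x \<in> V" "y \<in> V" for x y
    proof
      assume "L (c x) (c y)"
      then obtain x' y' where xy: "good x' y'" "c x' = c x" "c y' = c y" by (auto simp: L_def)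
      then have "x' \<in> V" "y' \<in> V" by (auto simp: good_def)
      then show "good x y" using xy good_cong[of x' y' x y] c_eq that by auto
    qed (auto simp: L_def)
    have dens_sym: "density G A B = density G B A" for A B
      using edge_count_sym[of G A B] sym by (simp add: density_def mult.commute)
    have good_sym: "good x y \<Longrightarrow> good y x" for x y by (auto simp: good_def dens_sym)
    have L_sym: "L a b \<longrightarrow> L b a" for a b using good_sym by (auto simp: L_def)
    have reg: "regular_pair \<epsilon> (?f x) (?f y) G" if "good x y" for x y
      using that by (auto simp: good_def Ir_def irregular_points_def)
    have L_tri: "\<not> L a d" if L: "L a b" "L b d" for a b d
    proof
      assume "L a d"
      obtain x y where xy: "good x y" "c x = a" "c y = b" using L by (auto simp: L_def)
      obtain y' z where yz: "good y' z" "c y' = b" "c z = d" using L by (auto simp: L_def)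
      have inV: "x \<in> V" "y \<in> V" "z \<in> V" "y' \<in> V" using xy yz by (auto simp: good_def)
      have "good y z" using L_iff[of y z] inV L xy yz by auto
      moreover have "good x z" using L_iff[of x z] inV \<open>L a d\<close> xy yz by auto
      ultimately have g: "good x y" "good x z" "good y z" using xy by auto
      have fin: "finite (?f u)" for u using V by (simp add: fibre_def)
      have n: "0 < ?n" using inV V by (auto simp: card_gt_0_iff)
      have "(\<delta>1 ^ 3 - 2 * \<epsilon>) * (real (card (?f x)) * real (card (?f y)) * real (card (?f z)))
        \<le> (\<Sum>x\<in>?f x. \<Sum>y\<in>?f y. \<Sum>z\<in>?f z. of_bool (G x y \<and> G y z \<and> G x z))"
        using g \<delta>1 \<epsilon> fin sym by (intro regular_triple_triangles reg) (auto simp: good_def)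
      also have "\<dots> \<le> triangle_count G V"
        unfolding triangle_count_def
        by (intro order_trans[OF sum_mono sum_mono2] order_trans[OF sum_mono sum_mono2] sum_mono2 sum_nonneg)
           (use V in \<open>auto simp: fibre_def\<close>)
      also have "\<dots> \<le> \<tau> * ?n ^ 3" by (rule few)
      also have "\<dots> = \<delta>1 ^ 3 / 4 * ((\<delta>1 * ?n / real K) * (\<delta>1 * ?n / real K) * (\<delta>1 * ?n / real K))"
        by (simp add: \<tau>_def power3_eq_cube)
      also have "\<dots> < (\<delta>1 ^ 3 - 2 * \<epsilon>) * ((\<delta>1 * ?n / real K) * (\<delta>1 * ?n / real K) * (\<delta>1 * ?n / real K))"
        using \<delta>1 n K by (intro mult_strict_right_mono) (auto simp: \<epsilon>_def)
      also have "\<dots> \<le> (\<delta>1 ^ 3 - 2 * \<epsilon>) * (real (card (?f x)) * real (card (?f y)) * real (card (?f z)))"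
        using g \<delta>1 by (intro mult_left_mono mult_mono) (auto simp: good_def big_def \<epsilon>_def)
      finally show False by simp
    qed
    have small: "real (card {x\<in>V. \<not> big x}) \<le> \<delta>1 * ?n"
    proof -
      have "real (card {x\<in>V. \<not> big x}) \<le> real (card (\<pi> ` V)) * (\<delta>1 * ?n / real K)"
        using card_small_fibres[OF V, of "\<delta>1 * ?n / real K" \<pi>] \<delta>1 by (simp add: big_def not_le)
      also have "\<dots> \<le> real K * (\<delta>1 * ?n / real K)"
        using \<pi>(1) K \<delta>1 by (intro mult_right_mono) auto
      finally show ?thesis using K by simp
    qed
    define Lo where "Lo = {(x,y) \<in> V \<times> V. density G (?f x) (?f y) < \<delta>1 \<and> G x y}"
    have Lo: "real (card Lo) \<le> \<delta>1 * ?n\<^sup>2" unfolding Lo_def using V \<delta>1 by (intro card_sparse_edges) auto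
    let ?sm = "{x\<in>V. \<not> big x}"
    have IrV: "Ir \<subseteq> V \<times> V" by (auto simp: Ir_def irregular_points_def)
    have fIr: "finite Ir" using IrV V finite_subset[of Ir "V \<times> V"] by auto
    have fLo: "finite Lo" by (rule finite_subset[of _ "V \<times> V"]) (use V in \<open>auto simp: Lo_def\<close>)
    have "{(x,y) \<in> V \<times> V. G x y \<and> \<not> L (c x) (c y)} \<subseteq> Ir \<union> Ir\<inverse> \<union> (?sm \<times> V) \<union> (V \<times> ?sm) \<union> Lo"
      using L_iff by (auto simp: good_def Lo_def not_le)
    then have "card {(x,y) \<in> V \<times> V. G x y \<and> \<not> L (c x) (c y)} \<le> card (Ir \<union> Ir\<inverse> \<union> (?sm \<times> V) \<union> (V \<times> ?sm) \<union> Lo)"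
      using V fIr fLo by (intro card_mono) auto
    also have "\<dots> \<le> card Ir + card (Ir\<inverse>) + card (?sm \<times> V) + card (V \<times> ?sm) + card Lo"
      by (meson add_mono card_Un_le le_refl order_trans)
    finally have "real (card {(x,y) \<in> V \<times> V. G x y \<and> \<not> L (c x) (c y)})
       \<le> real (card Ir + card Ir + card (?sm \<times> V) + card (V \<times> ?sm) + card Lo)"
      by (simp only: of_nat_le_iff card_inverse)
    also have "\<dots> = 2 * real (card Ir) + 2 * (real (card ?sm) * ?n) + real (card Lo)"
      by (simp add: card_cartesian_product)
    also have "\<dots> \<le> 2 * (\<epsilon> * ?n\<^sup>2) + 2 * (\<delta>1 * ?n * ?n) + \<delta>1 * ?n\<^sup>2"
      using Lo \<pi>(2) mult_right_mono[OF small, of ?n] by (simp add: Ir_def)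
    also have "\<dots> = (2 * \<epsilon> + 3 * \<delta>1) * ?n\<^sup>2" by (simp add: power2_eq_square algebra_simps)
    also have "\<dots> \<le> \<delta> * ?n\<^sup>2" using \<epsilon> \<delta>1 by (intro mult_right_mono) auto
    finally have final: "real (card {(x,y) \<in> V \<times> V. G x y \<and> \<not> L (c x) (c y)}) \<le> \<delta> * ?n\<^sup>2" .
    show "\<exists>c L. triangle_free_colouring \<delta> V G K c L"
      unfolding triangle_free_colouring_def
    proof (rule exI[of _ c], rule exI[of _ L], intro conjI allI impI)
      show "L b a" if "L a b" for a b using that L_sym by blast
      show "\<not> L a d" if "L a b" "L b d" for a b d using that by (rule L_tri)
    qed (fact cK final)+
  qed
qed

section \<open>Weighted density and selection of cells\<close>

text \<open>Each vertex occurs at most once in a monomial, so the polynomial is affine in every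
  single weight and its minimum over the cube is attained at a 0/1 point.\<close>

lemma multiaffine_lower_bound:
  fixes a :: "'v set \<Rightarrow> real"
  assumes V: "finite V" and S: "S \<subseteq> Pow V"
    and vertex: "\<And>U. U \<subseteq> V \<Longrightarrow> b \<le> (\<Sum>e\<in>{e\<in>S. e \<subseteq> U}. a e)"
    and w: "\<And>v. v \<in> V \<Longrightarrow> 0 \<le> w v \<and> w v \<le> 1"
  shows "b \<le> (\<Sum>e\<in>S. a e * (\<Prod>v\<in>e. w v))"
proof -
  have fS: "finite S" using V S finite_subset by blast
  \<comment> \<open>\<open>W\<close> collects the coordinates that may be fractional; the induction
    frees one at a time, writing \<open>w\<close> as a convex combination of its values at 0 and
    1.\<close>
  have "\<forall>w. (\<forall>v\<in>V. 0 \<le> w v \<and> w v \<le> 1) \<longrightarrow> (\<forall>v\<in>V - W. w v \<in> {0,1}) \<longrightarrow> b \<le> (\<Sum>e\<in>S. a e * (\<Prod>v\<in>e. w v))"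
    if "finite W" "W \<subseteq> V" for W
    using that
  proof (induction W)
    case empty
    show ?case
    proof (intro allI impI)
      fix w :: "'v \<Rightarrow> real" assume w: "\<forall>v\<in>V - {}. w v \<in> {0,1}"
      define U where "U = {v\<in>V. w v = 1}"
      have "(\<Prod>v\<in>e. w v) = of_bool (e \<subseteq> U)" if "e \<in> S" for e
      proof (cases "e \<subseteq> U")
        case True
        then show ?thesis by (simp add: U_def subset_iff)
      next
        case False
        then obtain v where "v \<in> e" "v \<notin> U" by blast
        moreover from this have "w v = 0" using w S that by (auto simp: U_def)
        moreover have "finite e" using S V that finite_subset by blast
        ultimately show ?thesis using False by auto
      qed
      then have "(\<Sum>e\<in>S. a e * (\<Prod>v\<in>e. w v)) = (\<Sum>e\<in>S. if e \<subseteq> U then a e else 0)" by (intro sum.cong) auto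
      also have "\<dots> = (\<Sum>e\<in>{e\<in>S. e \<subseteq> U}. a e)" using fS by (rule sum.inter_filter[symmetric])
      finally show "b \<le> (\<Sum>e\<in>S. a e * (\<Prod>v\<in>e. w v))" using vertex[of U] by (simp add: U_def)
    qed
  next
    case (insert u W)
    show ?case
    proof (intro allI impI)
      fix w :: "'v \<Rightarrow> real"
      assume w: "\<forall>v\<in>V. 0 \<le> w v \<and> w v \<le> 1" "\<forall>v\<in>V - insert u W. w v \<in> {0,1}"
      have ge: "b \<le> (\<Sum>e\<in>S. a e * (\<Prod>v\<in>e. (w(u := c)) v))" if "c \<in> {0,1}" for c
      proof -
        have "\<forall>v\<in>V. 0 \<le> (w(u := c)) v \<and> (w(u := c)) v \<le> 1" using w(1) that by auto
        moreover have "(w(u := c)) v \<in> {0,1}" if "v \<in> V - W" for v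
          using w(2) \<open>c \<in> {0,1}\<close> that by (cases "v = u") simp_all
        ultimately show ?thesis using insert.IH[THEN spec, of "w(u := c)"] insert.prems by blast
      qed
      have affine: "(\<Prod>v\<in>e. w v) = (1 - w u) * (\<Prod>v\<in>e. (w(u := 0)) v) + w u * (\<Prod>v\<in>e. (w(u := 1)) v)" if "e \<in> S" for e
      proof -
        have fe: "finite e" using S V that finite_subset by blast
        have "(\<Prod>v\<in>e - {u}. (w(u := c)) v) = (\<Prod>v\<in>e - {u}. w v)" for c by (intro prod.cong) auto
        then show ?thesis using fe
          by (cases "u \<in> e") (simp_all add: prod.remove[of e u] algebra_simps)
      qed
      have "b = (1 - w u) * b + w u * b" by (simp add: algebra_simps)
      also have "\<dots> \<le> (1 - w u) * (\<Sum>e\<in>S. a e * (\<Prod>v\<in>e. (w(u := 0)) v)) + w u * (\<Sum>e\<in>S. a e * (\<Prod>v\<in>e. (w(u := 1)) v))"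
        using ge w insert.prems by (intro add_mono mult_left_mono) auto
      also have "\<dots> = (\<Sum>e\<in>S. a e * (\<Prod>v\<in>e. w v))"
        unfolding sum_distrib_left sum.distrib[symmetric]
        by (intro sum.cong refl) (simp only: affine distrib_left mult.left_commute)
      finally show "b \<le> (\<Sum>e\<in>S. a e * (\<Prod>v\<in>e. w v))" .
    qed
  qed
  from this[of V] show ?thesis using V w by auto
qed

lemma sum_ordered_triples:
  fixes f :: "'v set \<Rightarrow> real"
  assumes V: "finite V"
  shows "(\<Sum>x\<in>V. \<Sum>y\<in>V. \<Sum>z\<in>V. of_bool (x \<noteq> y \<and> y \<noteq> z \<and> x \<noteq> z) * f {x,y,z}) = 6 * (\<Sum>e\<in>[V]\<^bsup>3\<^esup>. f e)"
proof -
  define T where "T = {(x,y,z) \<in> V \<times> V \<times> V. x \<noteq> y \<and> y \<noteq> z \<and> x \<noteq> z}"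
  have fT: "finite T" using V by (auto simp: T_def intro: finite_subset[of _ "V \<times> V \<times> V"])
  let ?s = "\<lambda>(x,y,z). {x,y,z}"
  have im: "?s ` T \<subseteq> [V]\<^bsup>3\<^esup>" by (auto simp: T_def nsets_def)
  have "(\<Sum>x\<in>V. \<Sum>y\<in>V. \<Sum>z\<in>V. of_bool (x \<noteq> y \<and> y \<noteq> z \<and> x \<noteq> z) * f {x,y,z})
     = (\<Sum>t\<in>V \<times> V \<times> V. if t \<in> T then f (?s t) else 0)"
    by (simp add: sum.cartesian_product) (intro sum.cong, auto simp: T_def)
  also have "\<dots> = (\<Sum>t\<in>{t \<in> V \<times> V \<times> V. t \<in> T}. f (?s t))"
    using V by (intro sum.inter_filter[symmetric]) auto
  also have "{t \<in> V \<times> V \<times> V. t \<in> T} = T" by (auto simp: T_def)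
  also have "(\<Sum>t\<in>T. f (?s t)) = (\<Sum>e\<in>[V]\<^bsup>3\<^esup>. \<Sum>t\<in>{t\<in>T. ?s t = e}. f (?s t))"
    using sum.group[OF fT finite_imp_finite_nsets[OF V] im, of "\<lambda>t. f (?s t)"] by simp
  also have "\<dots> = (\<Sum>e\<in>[V]\<^bsup>3\<^esup>. 6 * f e)"
  proof (rule sum.cong[OF refl])
    fix e assume "e \<in> [V]\<^bsup>3\<^esup>"
    then obtain a b c where e: "e = {a,b,c}" "a \<noteq> b" "b \<noteq> c" "a \<noteq> c" "a \<in> V" "b \<in> V" "c \<in> V"
      by (auto simp: nsets_def card_3_iff)
    have "{t\<in>T. ?s t = e} = {(a,b,c),(a,c,b),(b,a,c),(b,c,a),(c,a,b),(c,b,a)}" (is "_ = ?L")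
    proof
      show "?L \<subseteq> {t\<in>T. ?s t = e}" using e by (auto simp: T_def)
      show "{t\<in>T. ?s t = e} \<subseteq> ?L"
      proof
        fix t assume t: "t \<in> {t\<in>T. ?s t = e}"
        obtain x y z where xyz: "t = (x,y,z)" by (cases t)
        have "x \<in> {a,b,c}" "y \<in> {a,b,c}" "z \<in> {a,b,c}" "x \<noteq> y" "y \<noteq> z" "x \<noteq> z"
          using t e(1) by (auto simp: xyz T_def)
        then show "t \<in> ?L" unfolding xyz by auto
      qed
    qed
    moreover have "card ?L = 6" using e by simp
    moreover have "(\<Sum>t\<in>{t\<in>T. ?s t = e}. f (?s t)) = (\<Sum>t\<in>{t\<in>T. ?s t = e}. f e)" by (intro sum.cong) auto
    ultimately show "(\<Sum>t\<in>{t\<in>T. ?s t = e}. f (?s t)) = 6 * f e" by simp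
  qed
  finally show ?thesis by (simp add: sum_distrib_left)
qed

definition triple_density :: "('v \<Rightarrow> 'v \<Rightarrow> 'v \<Rightarrow> bool) \<Rightarrow> 'v set \<Rightarrow> 'v set \<Rightarrow> 'v set \<Rightarrow> real" where
  "triple_density e A B C = (\<Sum>x\<in>A. \<Sum>y\<in>B. \<Sum>z\<in>C. of_bool (e x y z)) / (real (card A) * real (card B) * real (card C))"

text \<open>The average includes triples with repeated indices. The loss \<open>3 / s\<close> comes
  from degenerate vertex triples, the other error is \<mu> rescaled to total weight
  \<open>s\<close>, with 6 for the orderings of an edge.\<close>

lemma average_triple_density:
  fixes A :: "'i \<Rightarrow> 'v set" and d \<mu> s :: real
  assumes H: "three_graph H" and dense: "mu_dense d \<mu> H" and d: "0 \<le> d" "d \<le> 1"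
    and I: "finite I" "I \<noteq> {}" and s: "0 < s"
    and A: "\<And>i. i \<in> I \<Longrightarrow> A i \<subseteq> verts H \<and> s \<le> real (card (A i))"
  shows "d - 3 / s - 6 * \<mu> * real (card (verts H)) ^ 3 / s ^ 3
    \<le> (\<Sum>i\<in>I. \<Sum>j\<in>I. \<Sum>k\<in>I. triple_density (\<lambda>x y z. {x,y,z} \<in> edges H) (A i) (A j) (A k)) / real (card I) ^ 3"
proof -
  define V where "V = verts H"
  define E where "E = edges H"
  have V: "finite V" and E: "E \<subseteq> [V]\<^bsup>3\<^esup>" using H by (auto simp: three_graph_def V_def E_def)
  define m where "m = real (card I)"
  have m: "0 < m" using I by (simp add: m_def card_gt_0_iff)
  \<comment> \<open>The cells may coincide, so a union of sets is replaced by this sum of normalised indicators, to which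
    the density hypothesis extends by multi-affinity.\<close>
  define w where "w x = s / m * (\<Sum>i\<in>I. of_bool (x \<in> A i) / real (card (A i)))" for x
  have w0: "0 \<le> w x" for x
  proof -
    have "0 \<le> (\<Sum>i\<in>I. of_bool (x \<in> A i) / real (card (A i)))" by (intro sum_nonneg) auto
    then show ?thesis using s m by (simp add: w_def)
  qed
  have w1: "w x \<le> 1" for x
  proof -
    have "(\<Sum>i\<in>I. of_bool (x \<in> A i) / real (card (A i))) \<le> (\<Sum>i\<in>I. 1 / s)"
    proof (rule sum_mono)
      fix i assume "i \<in> I"
      then have "s \<le> real (card (A i))" using A by auto
      then show "of_bool (x \<in> A i) / real (card (A i)) \<le> 1 / s" using s by (intro frac_le) auto
    qed
    then have "w x \<le> s / m * (\<Sum>i\<in>I. 1 / s)" unfolding w_def using s m by (intro mult_left_mono) auto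
    then show ?thesis using s m by (simp add: m_def)
  qed
  \<comment> \<open>Summation against \<open>w\<close> averages over the cells; three applications
    turn the weighted edge sum into the sum of all triple densities.\<close>
  have expand: "(\<Sum>x\<in>V. w x * f x) = s / m * (\<Sum>i\<in>I. (\<Sum>x\<in>A i. f x) / real (card (A i)))" for f :: "'v \<Rightarrow> real"
  proof -
    have "(\<Sum>x\<in>V. w x * f x) = s / m * (\<Sum>x\<in>V. \<Sum>i\<in>I. of_bool (x \<in> A i) / real (card (A i)) * f x)"
      unfolding w_def sum_distrib_left sum_distrib_right by (simp add: mult.assoc)
    also have "(\<Sum>x\<in>V. \<Sum>i\<in>I. of_bool (x \<in> A i) / real (card (A i)) * f x)
        = (\<Sum>i\<in>I. \<Sum>x\<in>V. of_bool (x \<in> A i) / real (card (A i)) * f x)" by (rule sum.swap)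
    also have "\<dots> = (\<Sum>i\<in>I. (\<Sum>x\<in>A i. f x) / real (card (A i)))"
    proof (rule sum.cong[OF refl])
      fix i assume "i \<in> I"
      then have Ai: "A i \<subseteq> V" using A by (auto simp: V_def)
      have "(\<Sum>x\<in>V. of_bool (x \<in> A i) / real (card (A i)) * f x) = (\<Sum>x\<in>A i. f x / real (card (A i)))"
        by (rule sum.mono_neutral_cong_right[OF V Ai]) auto
      then show "(\<Sum>x\<in>V. of_bool (x \<in> A i) / real (card (A i)) * f x) = (\<Sum>x\<in>A i. f x) / real (card (A i))"
        by (simp add: sum_divide_distrib)
    qed
    finally show ?thesis .
  qed
  have sum_w: "sum w V = s"
  proof -
    have "(\<Sum>i\<in>I. (\<Sum>x\<in>A i. 1) / real (card (A i))) = (\<Sum>i\<in>I. 1 :: real)"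
    proof (rule sum.cong[OF refl])
      fix i assume "i \<in> I"
      then have "0 < real (card (A i))" using A[of i] s by linarith
      then show "(\<Sum>x\<in>A i. 1 :: real) / real (card (A i)) = 1" by simp
    qed
    then have "sum w V = s / m * m" using expand[of "\<lambda>_. 1"] by (simp add: m_def)
    then show ?thesis using m by simp
  qed
  let ?n = "real (card V)"
  have "- \<mu> * ?n ^ 3 \<le> (\<Sum>e\<in>[V]\<^bsup>3\<^esup>. (of_bool (e \<in> E) - d) * (\<Prod>v\<in>e. w v))"
  proof (rule multiaffine_lower_bound[OF V])
    fix U assume U: "U \<subseteq> V"
    then have fU: "finite U" using V finite_subset by blast
    have eq: "{e \<in> [V]\<^bsup>3\<^esup>. e \<subseteq> U} = [U]\<^bsup>3\<^esup>" using U by (auto simp: nsets_def)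
    have "(\<Sum>e\<in>{e \<in> [V]\<^bsup>3\<^esup>. e \<subseteq> U}. of_bool (e \<in> E) - d) = real (card ([U]\<^bsup>3\<^esup> \<inter> E)) - d * real (card U choose 3)"
      unfolding eq using finite_imp_finite_nsets[OF fU] by (simp add: sum_subtractf mult.commute)
    moreover have "d * real (card U choose 3) - \<mu> * ?n ^ 3 \<le> real (card ([U]\<^bsup>3\<^esup> \<inter> E))"
      using dense U by (simp add: mu_dense_def V_def E_def)
    ultimately show "- \<mu> * ?n ^ 3 \<le> (\<Sum>e\<in>{e \<in> [V]\<^bsup>3\<^esup>. e \<subseteq> U}. of_bool (e \<in> E) - d)" by linarith
  qed (use w0 w1 in \<open>auto simp: nsets_def\<close>)
  then have lower: "6 * (- \<mu> * ?n ^ 3) \<le> 6 * (\<Sum>e\<in>[V]\<^bsup>3\<^esup>. (of_bool (e \<in> E) - d) * (\<Prod>v\<in>e. w v))" by simp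
  let ?D = "\<lambda>x y z. x \<noteq> y \<and> y \<noteq> z \<and> x \<noteq> z"
  have "6 * (\<Sum>e\<in>[V]\<^bsup>3\<^esup>. (of_bool (e \<in> E) - d) * (\<Prod>v\<in>e. w v))
     = (\<Sum>x\<in>V. \<Sum>y\<in>V. \<Sum>z\<in>V. of_bool (?D x y z) * ((of_bool ({x,y,z} \<in> E) - d) * (\<Prod>v\<in>{x,y,z}. w v)))"
    using sum_ordered_triples[OF V, of "\<lambda>e. (of_bool (e \<in> E) - d) * (\<Prod>v\<in>e. w v)"] by simp
  also have "\<dots> = (\<Sum>x\<in>V. \<Sum>y\<in>V. \<Sum>z\<in>V. of_bool ({x,y,z} \<in> E) * (w x * w y * w z) - d * (of_bool (?D x y z) * (w x * w y * w z)))"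
  proof (intro sum.cong refl)
    fix x y z
    have "\<not> {x,y,z} \<in> E" if "\<not> ?D x y z"
    proof
      assume "{x,y,z} \<in> E"
      then have "card {x,y,z} = 3" using E by (auto simp: nsets_def)
      then show False using that by (auto simp: card_insert_if split: if_splits)
    qed
    then show "of_bool (?D x y z) * ((of_bool ({x,y,z} \<in> E) - d) * (\<Prod>v\<in>{x,y,z}. w v))
       = of_bool ({x,y,z} \<in> E) * (w x * w y * w z) - d * (of_bool (?D x y z) * (w x * w y * w z))"
      by (cases "?D x y z") (simp_all add: algebra_simps)
  qed
  also have "\<dots> = (\<Sum>x\<in>V. \<Sum>y\<in>V. \<Sum>z\<in>V. of_bool ({x,y,z} \<in> E) * (w x * w y * w z))
      - d * (\<Sum>x\<in>V. \<Sum>y\<in>V. \<Sum>z\<in>V. of_bool (?D x y z) * (w x * w y * w z))"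
    by (simp only: sum_subtractf sum_distrib_left)
  finally have total: "6 * (\<Sum>e\<in>[V]\<^bsup>3\<^esup>. (of_bool (e \<in> E) - d) * (\<Prod>v\<in>e. w v))
    = (\<Sum>x\<in>V. \<Sum>y\<in>V. \<Sum>z\<in>V. of_bool ({x,y,z} \<in> E) * (w x * w y * w z))
      - d * (\<Sum>x\<in>V. \<Sum>y\<in>V. \<Sum>z\<in>V. of_bool (?D x y z) * (w x * w y * w z))" .
  have "(\<Sum>x\<in>V. \<Sum>y\<in>V. \<Sum>z\<in>V. of_bool ({x,y,z} \<in> E) * (w x * w y * w z))
     = (\<Sum>x\<in>V. w x * (\<Sum>y\<in>V. w y * (\<Sum>z\<in>V. w z * of_bool ({x,y,z} \<in> E))))"
    unfolding sum_distrib_left by (intro sum.cong refl) (simp add: mult_ac)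
  also have "\<dots> = (s/m)^3 * (\<Sum>i\<in>I. \<Sum>j\<in>I. \<Sum>k\<in>I. triple_density (\<lambda>x y z. {x,y,z} \<in> E) (A i) (A j) (A k))"
  proof -
    have lin: "(\<Sum>x\<in>B. c * (\<Sum>j\<in>I. h j x)) / a = c * (\<Sum>j\<in>I. (\<Sum>x\<in>B. h j x) / a)"
      for B :: "'v set" and h :: "'i \<Rightarrow> 'v \<Rightarrow> real" and a c :: real
    proof -
      have "(\<Sum>x\<in>B. c * (\<Sum>j\<in>I. h j x)) = c * (\<Sum>x\<in>B. \<Sum>j\<in>I. h j x)" by (rule sum_distrib_left[symmetric])
      also have "(\<Sum>x\<in>B. \<Sum>j\<in>I. h j x) = (\<Sum>j\<in>I. \<Sum>x\<in>B. h j x)" by (rule sum.swap)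
      finally show ?thesis by (simp only: sum_divide_distrib[symmetric] times_divide_eq_right)
    qed
    have td: "(\<Sum>x\<in>A i. (\<Sum>y\<in>A j. (\<Sum>z\<in>A k. of_bool ({x,y,z} \<in> E)) / real (card (A k))) / real (card (A j))) / real (card (A i))
      = triple_density (\<lambda>x y z. {x,y,z} \<in> E) (A i) (A j) (A k)" for i j k
      unfolding triple_density_def sum_divide_distrib[symmetric] divide_divide_eq_left by (simp only: mult_ac)
    show ?thesis
      unfolding expand lin td unfolding sum_distrib_left[symmetric] by (simp only: power3_eq_cube mult.assoc)
  qed
  finally have edges_part: "(\<Sum>x\<in>V. \<Sum>y\<in>V. \<Sum>z\<in>V. of_bool ({x,y,z} \<in> E) * (w x * w y * w z))
     = (s/m)^3 * (\<Sum>i\<in>I. \<Sum>j\<in>I. \<Sum>k\<in>I. triple_density (\<lambda>x y z. {x,y,z} \<in> E) (A i) (A j) (A k))" .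
  \<comment> \<open>Each of the three coincidences costs \<open>s\<close> times the sum of the
    squared weights, which is at most the total weight \<open>s\<close> because weights lie between
    0 and 1.\<close>
  have "s^3 - 3 * s^2 \<le> (\<Sum>x\<in>V. \<Sum>y\<in>V. \<Sum>z\<in>V. of_bool (?D x y z) * (w x * w y * w z))"
  proof -
    have sq: "(\<Sum>x\<in>V. w x * w x) \<le> s"
    proof -
      have "(\<Sum>x\<in>V. w x * w x) \<le> (\<Sum>x\<in>V. w x)" using w0 w1 by (intro sum_mono mult_left_le) auto
      then show ?thesis using sum_w by simp
    qed
    have "(\<Sum>x\<in>V. \<Sum>y\<in>V. \<Sum>z\<in>V. (w x * w y * w z) - of_bool (x = y) * (w x * w y * w z)
       - of_bool (y = z) * (w x * w y * w z) - of_bool (x = z) * (w x * w y * w z))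
       \<le> (\<Sum>x\<in>V. \<Sum>y\<in>V. \<Sum>z\<in>V. of_bool (?D x y z) * (w x * w y * w z))"
      using w0 by (intro sum_mono) (auto simp: of_bool_def)
    moreover have "(\<Sum>x\<in>V. \<Sum>y\<in>V. \<Sum>z\<in>V. w x * w y * w z) = s * s * s"
      by (simp add: sum_w flip: sum_distrib_left sum_distrib_right)
    moreover have "(\<Sum>x\<in>V. \<Sum>y\<in>V. \<Sum>z\<in>V. of_bool (x = y) * (w x * w y * w z)) = (\<Sum>x\<in>V. w x * w x) * s"
      using V by (simp add: sum_w flip: sum_distrib_left sum_distrib_right)
    moreover have "(\<Sum>x\<in>V. \<Sum>y\<in>V. \<Sum>z\<in>V. of_bool (y = z) * (w x * w y * w z)) = s * (\<Sum>x\<in>V. w x * w x)"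
    proof -
      have "(\<Sum>y\<in>V. \<Sum>z\<in>V. of_bool (y = z) * (w x * w y * w z)) = w x * (\<Sum>y\<in>V. w y * w y)" for x
        using V by (simp add: sum_distrib_left mult.assoc)
      then show ?thesis by (simp add: sum_w flip: sum_distrib_right)
    qed
    moreover have "(\<Sum>x\<in>V. \<Sum>y\<in>V. \<Sum>z\<in>V. of_bool (x = z) * (w x * w y * w z)) = s * (\<Sum>x\<in>V. w x * w x)"
    proof -
      have "(\<Sum>y\<in>V. \<Sum>z\<in>V. of_bool (x = z) * (w x * w y * w z)) = s * (w x * w x)" if "x \<in> V" for x
      proof -
        have "(\<Sum>y\<in>V. \<Sum>z\<in>V. of_bool (x = z) * (w x * w y * w z)) = (\<Sum>y\<in>V. w y * (w x * w x))"
        proof (rule sum.cong[OF refl])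
          fix y
          have "(\<Sum>z\<in>V. of_bool (x = z) * (w x * w y * w z)) = (\<Sum>z\<in>V. if z = x then w y * (w x * w x) else 0)"
            by (intro sum.cong) auto
          then show "(\<Sum>z\<in>V. of_bool (x = z) * (w x * w y * w z)) = w y * (w x * w x)" using V that by simp
        qed
        then show ?thesis by (simp add: sum_w flip: sum_distrib_right)
      qed
      then show ?thesis by (simp add: sum_distrib_left)
    qed
    moreover have "s * (\<Sum>x\<in>V. w x * w x) \<le> s * s" using sq s by (intro mult_left_mono) auto
    ultimately show ?thesis
      by (simp add: sum_subtractf power3_eq_cube power2_eq_square mult.commute)
  qed
  then have "d * (s^3 - 3 * s^2) \<le> d * (\<Sum>x\<in>V. \<Sum>y\<in>V. \<Sum>z\<in>V. of_bool (?D x y z) * (w x * w y * w z))"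
    using d by (intro mult_left_mono)
  with lower total edges_part
  have "d * (s^3 - 3 * s^2) - 6 * \<mu> * ?n^3 \<le> (s/m)^3 * (\<Sum>i\<in>I. \<Sum>j\<in>I. \<Sum>k\<in>I. triple_density (\<lambda>x y z. {x,y,z} \<in> E) (A i) (A j) (A k))"
    (is "_ \<le> (s/m)^3 * ?S") by linarith
  moreover have "d * (3 * s^2) \<le> 3 * s^2" using d by (intro mult_left_le_one_le) auto
  ultimately have "d * s^3 - 3 * s^2 - 6 * \<mu> * ?n^3 \<le> (s/m)^3 * ?S" by (simp add: right_diff_distrib)
  then have "(d * s^3 - 3 * s^2 - 6 * \<mu> * ?n^3) / s^3 \<le> (s/m)^3 * ?S / s^3"
    using s by (intro divide_right_mono) auto
  also have "(s/m)^3 * ?S / s^3 = ?S / m^3" using s by (simp add: power_divide)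
  also have "(d * s^3 - 3 * s^2 - 6 * \<mu> * ?n^3) / s^3 = d - 3 / s - 6 * \<mu> * ?n^3 / s^3"
    using s by (simp add: diff_divide_distrib power2_eq_square power3_eq_cube)
  finally show ?thesis by (simp add: V_def E_def m_def)
qed

section \<open>Selecting cells and counting over them\<close>

lemma exists_selection_avoiding:
  fixes V :: "'v set"
  assumes V: "finite V" and m: "3 \<le> m" and B: "B \<subseteq> V \<times> V \<times> V" and few: "real m ^ 3 * real (card B) < real (card V) ^ 3"
  obtains f :: "nat \<Rightarrow> 'v" where "\<And>i. i < m \<Longrightarrow> f i \<in> V"
    "\<And>i j k. i < m \<Longrightarrow> j < m \<Longrightarrow> k < m \<Longrightarrow> i \<noteq> j \<Longrightarrow> j \<noteq> k \<Longrightarrow> i \<noteq> k \<Longrightarrow> (f i, f j, f k) \<notin> B"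
proof -
  define F where "F = PiE {..<m} (\<lambda>_. V)"
  define bad where "bad i j k = {f\<in>F. (f i, f j, f k) \<in> B}" for i j k
  define J where "J = {(i,j,k) \<in> {..<m} \<times> {..<m} \<times> {..<m}. i \<noteq> j \<and> j \<noteq> k \<and> i \<noteq> k}"
  have fB: "finite B" by (rule finite_subset[OF B]) (use V in auto)
  have cF: "card F = card V ^ m" by (simp add: F_def card_PiE)
  have fF: "finite F" unfolding F_def using V by (intro finite_PiE) auto
  \<comment> \<open>A union bound for a uniformly random \<open>f\<close>: a bad \<open>f\<close> is
    determined by a triple of \<open>B\<close> and its values off \<open>i\<close>,
    \<open>j\<close>, \<open>k\<close>.\<close>
  have card_bad: "card (bad i j k) \<le> card B * card V ^ (m - 3)" if ijk: "(i,j,k) \<in> J" for i j k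
  proof -
    have ijk: "i < m" "j < m" "k < m" "i \<noteq> j" "j \<noteq> k" "i \<noteq> k" using ijk by (auto simp: J_def)
    define R where "R = {..<m} - {i,j,k}"
    have cR: "card R = m - 3" unfolding R_def using ijk by (subst card_Diff_subset) auto
    let ?g = "\<lambda>(f,x,y,z). f(i := x, j := y, k := z)"
    have "bad i j k \<subseteq> ?g ` (PiE R (\<lambda>_. V) \<times> B)"
    proof
      fix f assume f: "f \<in> bad i j k"
      have "restrict f R \<in> PiE R (\<lambda>_. V)" using f by (auto simp: bad_def F_def R_def)
      moreover have "f = ?g (restrict f R, f i, f j, f k)"
        using f ijk by (auto simp: bad_def F_def R_def fun_eq_iff PiE_def extensional_def)
      moreover have "(f i, f j, f k) \<in> B" using f by (simp add: bad_def)
      ultimately show "f \<in> ?g ` (PiE R (\<lambda>_. V) \<times> B)"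
        by (intro image_eqI[of _ _ "(restrict f R, f i, f j, f k)"]) (simp_all only: mem_Times_iff fst_conv snd_conv simp_thms)
    qed
    moreover have fin: "finite (PiE R (\<lambda>_. V) \<times> B)" using V fB by (auto simp: R_def intro: finite_PiE)
    ultimately have "card (bad i j k) \<le> card (PiE R (\<lambda>_. V) \<times> B)" by (rule surj_card_le[rotated])
    then show ?thesis using cR by (simp add: card_cartesian_product card_PiE R_def mult.commute)
  qed
  have fJ: "finite J" by (auto simp: J_def intro: finite_subset[of _ "{..<m} \<times> {..<m} \<times> {..<m}"])
  have "card J \<le> card ({..<m} \<times> {..<m} \<times> {..<m})" by (intro card_mono) (auto simp: J_def)
  then have cJ: "card J \<le> m ^ 3" by (simp add: card_cartesian_product power3_eq_cube)
  have n: "0 < card V" using few by (cases "card V = 0") (auto simp: mult_less_0_iff)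
  have "card (\<Union>(i,j,k)\<in>J. bad i j k) \<le> (\<Sum>(i,j,k)\<in>J. card (bad i j k))"
    using card_UN_le[OF fJ, of "\<lambda>(i,j,k). bad i j k"] by (simp add: case_prod_beta)
  also have "\<dots> \<le> (\<Sum>(i,j,k)\<in>J. card B * card V ^ (m - 3))"
    using card_bad by (intro sum_mono) auto
  also have "\<dots> = card J * (card B * card V ^ (m - 3))" by (simp add: case_prod_beta)
  also have "\<dots> \<le> m ^ 3 * (card B * card V ^ (m - 3))" using cJ by (rule mult_le_mono1)
  also have "\<dots> = (m ^ 3 * card B) * card V ^ (m - 3)" by simp
  also have "\<dots> < card V ^ 3 * card V ^ (m - 3)"
  proof -
    have "real (m ^ 3 * card B) < real (card V ^ 3)" using few by simp
    then have "m ^ 3 * card B < card V ^ 3" by (simp only: of_nat_less_iff)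
    then show ?thesis using n by (intro mult_strict_right_mono) auto
  qed
  also have "\<dots> = card F" unfolding cF using m by (simp flip: power_add)
  finally have "card (\<Union>(i,j,k)\<in>J. bad i j k) < card F" .
  moreover have "finite (\<Union>(i,j,k)\<in>J. bad i j k)" by (rule finite_subset[OF _ fF]) (auto simp: bad_def)
  ultimately have "\<not> F \<subseteq> (\<Union>(i,j,k)\<in>J. bad i j k)" by (meson card_mono leD)
  then obtain f where f: "f \<in> F" "f \<notin> (\<Union>(i,j,k)\<in>J. bad i j k)" by blast
  show ?thesis
    by (rule that[of f]) (use f in \<open>auto simp: F_def J_def bad_def\<close>)
qed

text \<open>Each of the two link conditions is replaced by a density through one use of regularity,
  for each pair of colours separately; this explains the error
  \<open>2 * K\<^sup>2 * \<epsilon>\<close>.\<close>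

lemma coloured_triples_upper_bound:
  fixes c :: "'v \<Rightarrow> 'v \<Rightarrow> nat" and N1 N2 :: "nat \<Rightarrow> nat set"
  assumes fin: "finite A" "finite B" "finite C" and cK: "\<And>x y. c x y < K" and \<epsilon>: "0 \<le> \<epsilon>"
    and N: "\<And>a. N1 a \<subseteq> {..<K}" "\<And>a. N2 a \<subseteq> {..<K}"
    and reg: "\<And>S. S \<subseteq> {..<K} \<Longrightarrow> regular_pair \<epsilon> A C (\<lambda>x z. c x z \<in> S)"
      "\<And>S. S \<subseteq> {..<K} \<Longrightarrow> regular_pair \<epsilon> B C (\<lambda>y z. c y z \<in> S)"
  shows "(\<Sum>x\<in>A. \<Sum>y\<in>B. \<Sum>z\<in>C. of_bool (c x z \<in> N1 (c x y) \<and> c y z \<in> N2 (c y x)))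
    \<le> real (card C) * (\<Sum>a<K. \<Sum>b<K. real (card {(x,y)\<in>A \<times> B. c x y = a \<and> c y x = b}) *
         (density (\<lambda>x z. c x z \<in> N1 a) A C * density (\<lambda>y z. c y z \<in> N2 b) B C))
       + 2 * (real K)\<^sup>2 * \<epsilon> * (real (card A) * real (card B) * real (card C))"
proof -
  define \<alpha> \<beta> \<gamma> where "\<alpha> = real (card A)" and "\<beta> = real (card B)" and "\<gamma> = real (card C)"
  define d1 d2 where "d1 a = density (\<lambda>x z. c x z \<in> N1 a) A C" and "d2 b = density (\<lambda>y z. c y z \<in> N2 b) B C" for a b
  have d1: "0 \<le> d1 a" "d1 a \<le> 1" for a by (simp_all add: d1_def density_nonneg density_le_1)
  define X where "X y a b = {x\<in>A. c x y = a \<and> c y x = b}" for y a b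
  define Y where "Y x a b = {y\<in>B. c x y = a \<and> c y x = b}" for x a b
  define Z where "Z y b = {z\<in>C. c y z \<in> N2 b}" for y b
  define P where "P a b = real (card {(x,y)\<in>A \<times> B. c x y = a \<and> c y x = b})" for a b
  \<comment> \<open>With \<open>y\<close> and both colours fixed, the first condition is a single
    relation between \<open>x\<close> and \<open>z\<close>, on sets cut out by the colours.\<close>
  have first: "(\<Sum>x\<in>X y a b. \<Sum>z\<in>C. of_bool (c x z \<in> N1 (c x y) \<and> c y z \<in> N2 (c y x)))
     \<le> d1 a * (real (card (X y a b)) * real (card (Z y b))) + \<epsilon> * (\<alpha> * \<gamma>)" for y a b
  proof -
    have "(\<Sum>x\<in>X y a b. \<Sum>z\<in>C. of_bool (c x z \<in> N1 (c x y) \<and> c y z \<in> N2 (c y x)))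
      = (\<Sum>x\<in>X y a b. \<Sum>z\<in>C. of_bool (c x z \<in> N1 a \<and> c y z \<in> N2 b) :: real)"
      by (intro sum.cong refl) (auto simp: X_def)
    also have "\<dots> = edge_count (\<lambda>x z. c x z \<in> N1 a) (X y a b) (Z y b)"
      unfolding edge_count_def
      by (intro sum.cong[OF refl] sum.mono_neutral_cong_right) (use fin in \<open>auto simp: Z_def\<close>)
    also have "\<dots> \<le> d1 a * (real (card (X y a b)) * real (card (Z y b))) + \<epsilon> * (\<alpha> * \<gamma>)"
      unfolding d1_def \<alpha>_def \<gamma>_def by (intro regular_pairD reg N) (auto simp: X_def Z_def)
    finally show ?thesis .
  qed
  \<comment> \<open>Regrouping by \<open>x\<close> turns the remaining sum into edge counts between
    \<open>Y x a b\<close> and the whole of \<open>C\<close>.\<close>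
  have second: "(\<Sum>y\<in>B. real (card (X y a b)) * real (card (Z y b))) \<le> d2 b * (P a b * \<gamma>) + \<epsilon> * (\<alpha> * \<beta> * \<gamma>)" for a b
  proof -
    have "(\<Sum>y\<in>B. real (card (X y a b)) * real (card (Z y b)))
       = (\<Sum>y\<in>B. \<Sum>x\<in>A. of_bool (c x y = a \<and> c y x = b) * real (card (Z y b)))"
      unfolding sum_distrib_right[symmetric] X_def sum_of_bool_card[OF fin(1)] by (rule refl)
    also have "\<dots> = (\<Sum>x\<in>A. \<Sum>y\<in>B. of_bool (c x y = a \<and> c y x = b) * real (card (Z y b)))" by (rule sum.swap)
    also have "\<dots> = (\<Sum>x\<in>A. edge_count (\<lambda>y z. c y z \<in> N2 b) (Y x a b) C)"
      unfolding edge_count_def sum_of_bool_card[OF fin(3)] Z_def[symmetric]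
      by (intro sum.cong[OF refl] sum.mono_neutral_cong_right) (use fin in \<open>auto simp: Y_def\<close>)
    also have "\<dots> \<le> (\<Sum>x\<in>A. d2 b * (real (card (Y x a b)) * \<gamma>) + \<epsilon> * (\<beta> * \<gamma>))"
      unfolding d2_def \<beta>_def \<gamma>_def by (intro sum_mono regular_pairD reg N) (auto simp: Y_def)
    also have "\<dots> = d2 b * ((\<Sum>x\<in>A. real (card (Y x a b))) * \<gamma>) + \<epsilon> * (\<alpha> * \<beta> * \<gamma>)"
      by (simp add: sum.distrib \<alpha>_def sum_distrib_left sum_distrib_right mult_ac)
    also have "(\<Sum>x\<in>A. real (card (Y x a b))) = P a b"
    proof -
      have "{(x,y)\<in>A \<times> B. c x y = a \<and> c y x = b} = Sigma A (\<lambda>x. Y x a b)" by (auto simp: Y_def)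
      moreover have "card (Sigma A (\<lambda>x. Y x a b)) = (\<Sum>x\<in>A. card (Y x a b))"
        using fin by (intro card_SigmaI) (auto simp: Y_def)
      ultimately show ?thesis by (simp add: P_def)
    qed
    finally show ?thesis .
  qed
  have split: "(\<Sum>x\<in>A. f x) = (\<Sum>a<K. \<Sum>b<K. \<Sum>x\<in>X y a b. f x)" for y and f :: "'v \<Rightarrow> real"
  proof -
    have "(\<Sum>a<K. \<Sum>b<K. \<Sum>x\<in>X y a b. f x) = (\<Sum>p\<in>{..<K}\<times>{..<K}. \<Sum>x\<in>{x\<in>A. (c x y, c y x) = p}. f x)"
      by (simp add: sum.cartesian_product X_def case_prod_beta prod_eq_iff)
    also have "\<dots> = (\<Sum>x\<in>A. f x)" using fin cK by (intro sum.group) auto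
    finally show ?thesis by simp
  qed
  have "(\<Sum>x\<in>A. \<Sum>y\<in>B. \<Sum>z\<in>C. of_bool (c x z \<in> N1 (c x y) \<and> c y z \<in> N2 (c y x)))
     = (\<Sum>y\<in>B. \<Sum>x\<in>A. \<Sum>z\<in>C. of_bool (c x z \<in> N1 (c x y) \<and> c y z \<in> N2 (c y x)) :: real)" by (rule sum.swap)
  also have "\<dots> = (\<Sum>y\<in>B. \<Sum>a<K. \<Sum>b<K. \<Sum>x\<in>X y a b. \<Sum>z\<in>C. of_bool (c x z \<in> N1 (c x y) \<and> c y z \<in> N2 (c y x)))"
    by (rule sum.cong[OF refl], rule split)
  also have "\<dots> \<le> (\<Sum>y\<in>B. \<Sum>a<K. \<Sum>b<K. d1 a * (real (card (X y a b)) * real (card (Z y b))) + \<epsilon> * (\<alpha> * \<gamma>))"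
    by (intro sum_mono first)
  also have "\<dots> = (\<Sum>a<K. \<Sum>b<K. \<Sum>y\<in>B. d1 a * (real (card (X y a b)) * real (card (Z y b))) + \<epsilon> * (\<alpha> * \<gamma>))"
    by (subst sum.swap, rule sum.cong[OF refl], rule sum.swap)
  also have "\<dots> = (\<Sum>a<K. \<Sum>b<K. d1 a * (\<Sum>y\<in>B. real (card (X y a b)) * real (card (Z y b))) + \<epsilon> * (\<alpha> * \<beta> * \<gamma>))"
    by (simp add: sum.distrib sum_distrib_left \<beta>_def mult_ac)
  also have "\<dots> \<le> (\<Sum>a<K. \<Sum>b<K. d1 a * (d2 b * (P a b * \<gamma>)) + 2 * (\<epsilon> * (\<alpha> * \<beta> * \<gamma>)))"
  proof (intro sum_mono)
    fix a b
    have "d1 a * (\<Sum>y\<in>B. real (card (X y a b)) * real (card (Z y b))) \<le> d1 a * (d2 b * (P a b * \<gamma>) + \<epsilon> * (\<alpha> * \<beta> * \<gamma>))"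
      by (intro mult_left_mono second d1)
    also have "\<dots> = d1 a * (d2 b * (P a b * \<gamma>)) + d1 a * (\<epsilon> * (\<alpha> * \<beta> * \<gamma>))" by (rule distrib_left)
    also have "d1 a * (\<epsilon> * (\<alpha> * \<beta> * \<gamma>)) \<le> 1 * (\<epsilon> * (\<alpha> * \<beta> * \<gamma>))"
      using d1 \<epsilon> by (intro mult_right_mono) (auto simp: \<alpha>_def \<beta>_def \<gamma>_def)
    finally show "d1 a * (\<Sum>y\<in>B. real (card (X y a b)) * real (card (Z y b))) + \<epsilon> * (\<alpha> * \<beta> * \<gamma>)
        \<le> d1 a * (d2 b * (P a b * \<gamma>)) + 2 * (\<epsilon> * (\<alpha> * \<beta> * \<gamma>))" by linarith
  qed
  also have "\<dots> = \<gamma> * (\<Sum>a<K. \<Sum>b<K. P a b * (d1 a * d2 b)) + 2 * (real K)\<^sup>2 * \<epsilon> * (\<alpha> * \<beta> * \<gamma>)"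
    by (simp add: sum.distrib sum_distrib_left power2_eq_square mult_ac)
  finally show ?thesis by (simp only: \<alpha>_def \<beta>_def \<gamma>_def d1_def d2_def P_def)
qed

section \<open>From hypergraphs to reduced structures\<close>

text \<open>Cells are indexed by representatives \<open>f i\<close>, so one cell may carry several
  indices. \<open>L_const\<close> allows the reduced graph of the representative to serve for its
  whole cell.\<close>

locale link_partition =
  fixes V :: "'v set" and c :: "'v \<Rightarrow> 'v \<Rightarrow> nat" and K :: nat and L :: "'v \<Rightarrow> nat \<Rightarrow> nat \<Rightarrow> bool"
    and \<pi> :: "'v \<Rightarrow> nat" and f :: "nat \<Rightarrow> 'v" and m :: nat and \<epsilon> \<delta> :: real and e :: "'v \<Rightarrow> 'v \<Rightarrow> 'v \<Rightarrow> bool"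
  assumes V: "finite V" and f: "\<And>i. i < m \<Longrightarrow> f i \<in> V"
    and c_less: "\<And>x y. c x y < K"
    and L_sym: "\<And>x a b. L x a b \<Longrightarrow> L x b a"
    and L_free: "\<And>x a b d. L x a b \<Longrightarrow> L x b d \<Longrightarrow> \<not> L x a d"
    and L_const: "\<And>x y a b. x \<in> V \<Longrightarrow> y \<in> V \<Longrightarrow> \<pi> x = \<pi> y \<Longrightarrow> a < K \<Longrightarrow> b < K \<Longrightarrow> L x a b \<Longrightarrow> L y a b"
    and eps: "0 \<le> \<epsilon>"
    and regular: "\<And>i j S. i < m \<Longrightarrow> j < m \<Longrightarrow> i \<noteq> j \<Longrightarrow> S \<subseteq> {..<K} \<Longrightarrow>
      regular_pair \<epsilon> (fibre V \<pi> (f i)) (fibre V \<pi> (f j)) (\<lambda>x z. c x z \<in> S)"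
    and few_errors: "\<And>i j k. i < m \<Longrightarrow> j < m \<Longrightarrow> k < m \<Longrightarrow> i \<noteq> j \<Longrightarrow> j \<noteq> k \<Longrightarrow> i \<noteq> k \<Longrightarrow>
      (\<Sum>x\<in>fibre V \<pi> (f i). \<Sum>y\<in>fibre V \<pi> (f j). \<Sum>z\<in>fibre V \<pi> (f k).
         of_bool (e x y z \<and> \<not> (L x (c x y) (c x z) \<and> L y (c y x) (c y z))))
      \<le> \<delta> * (real (card (fibre V \<pi> (f i))) * real (card (fibre V \<pi> (f j))) * real (card (fibre V \<pi> (f k))))"
begin

definition A :: "nat \<Rightarrow> 'v set" where
  "A i = fibre V \<pi> (f i)"

definition LL :: "nat \<Rightarrow> nat \<Rightarrow> nat \<Rightarrow> bool" where
  "LL i a b \<longleftrightarrow> L (f i) a b"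

definition P :: "nat \<Rightarrow> nat \<Rightarrow> nat \<Rightarrow> nat \<Rightarrow> real" where
  "P i j a b = real (card {(x,y) \<in> A i \<times> A j. c x y = a \<and> c y x = b}) / (real (card (A i)) * real (card (A j)))"

lemma finite_A: "finite (A i)"
  using V by (simp add: A_def fibre_def)

lemma card_A_pos: "i < m \<Longrightarrow> 0 < card (A i)"
  using f finite_A by (auto simp: card_gt_0_iff A_def fibre_def)

lemma sum_P:
  assumes "S \<subseteq> {..<K}"
  shows "(\<Sum>a\<in>S. \<Sum>b<K. P i j a b) = density (\<lambda>x z. c x z \<in> S) (A i) (A j)"
proof -
  have fS: "finite S" using assms finite_subset by blast
  have "(\<Sum>a\<in>S. \<Sum>b<K. real (card {(x,y) \<in> A i \<times> A j. c x y = a \<and> c y x = b})) = edge_count (\<lambda>x z. c x z \<in> S) (A i) (A j)"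
  proof -
    define Q where "Q = {p \<in> A i \<times> A j. c (fst p) (snd p) \<in> S}"
    have fQ: "finite Q" using finite_A by (auto simp: Q_def)
    have "(\<Sum>a\<in>S. \<Sum>b<K. real (card {(x,y) \<in> A i \<times> A j. c x y = a \<and> c y x = b}))
      = (\<Sum>q\<in>S \<times> {..<K}. \<Sum>p\<in>{p\<in>Q. (c (fst p) (snd p), c (snd p) (fst p)) = q}. 1)"
      by (auto simp: sum.cartesian_product Q_def intro!: sum.cong arg_cong[where f=card])
    also have "\<dots> = (\<Sum>p\<in>Q. 1)"
      using fQ fS c_less by (intro sum.group) (auto simp: Q_def)
    also have "\<dots> = edge_count (\<lambda>x z. c x z \<in> S) (A i) (A j)"
      unfolding edge_count_pairs Q_def using finite_A
      by (subst sum.inter_filter) (auto intro!: sum.cong)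
    finally show ?thesis .
  qed
  then show ?thesis by (simp add: P_def density_def flip: sum_divide_distrib)
qed

sublocale coloured_array "{..<m}" "{..<K}" LL P
proof
  show "P i j a b = P j i b a" for i j a b
  proof -
    have "{(x,y) \<in> A j \<times> A i. c x y = b \<and> c y x = a} = prod.swap ` {(x,y) \<in> A i \<times> A j. c x y = a \<and> c y x = b}"
      by (auto simp: image_iff)
    then have "card {(x,y) \<in> A j \<times> A i. c x y = b \<and> c y x = a} = card {(x,y) \<in> A i \<times> A j. c x y = a \<and> c y x = b}"
      by (simp add: card_image inj_on_def)
    then show ?thesis by (simp add: P_def mult.commute)
  qed
  show "(\<Sum>a<K. \<Sum>b<K. P i j a b) = 1" if ij: "i \<in> {..<m}" "j \<in> {..<m}" for i j
  proof -
    have "edge_count (\<lambda>x z. c x z \<in> {..<K}) (A i) (A j) = real (card (A i)) * real (card (A j))"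
      using c_less by (simp add: edge_count_def)
    then show ?thesis
      using sum_P[of "{..<K}" i j] card_A_pos ij by (simp add: density_def)
  qed
  show "LL i b a" if "LL i a b" for i a b using that unfolding LL_def by (rule L_sym)
  show "\<not> LL i a d" if "LL i a b" "LL i b d" for i a b d using that unfolding LL_def by (rule L_free)
  show "0 \<le> P i j a b" for i j a b by (simp add: P_def)
qed simp

lemma sz_eq: "S \<subseteq> {..<K} \<Longrightarrow> sz i S j = density (\<lambda>x z. c x z \<in> S) (A i) (A j)"
  unfolding sz_def by (rule sum_P)

text \<open>Apart from the errors, an edge requires adjacent colours in the links of
  \<open>x\<close> and of \<open>y\<close>. The condition from the link of \<open>z\<close> is
  dropped, which makes \<open>tri\<close> asymmetric and gives three different bounds for one triple
  of cells.\<close>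

lemma triple_density_le_tri:
  assumes ijk: "i < m" "j < m" "k < m" "i \<noteq> j" "j \<noteq> k" "i \<noteq> k"
  shows "triple_density e (A i) (A j) (A k) \<le> tri i j k + 2 * (real K)\<^sup>2 * \<epsilon> + \<delta>"
proof -
  have nb: "nb i a \<subseteq> {..<K}" for i a by (auto simp: nb_def)
  let ?W = "real (card (A i)) * real (card (A j)) * real (card (A k))"
  have W: "0 < ?W" using card_A_pos ijk by simp
  have L_nb: "b \<in> nb i a" if "i < m" "x \<in> A i" "L x a b" "a < K" "b < K" for i x a b
    using that f[of i] L_const[of x "f i" a b] by (auto simp: A_def fibre_def nb_def LL_def)
  have "(\<Sum>x\<in>A i. \<Sum>y\<in>A j. \<Sum>z\<in>A k. of_bool (e x y z))
    \<le> (\<Sum>x\<in>A i. \<Sum>y\<in>A j. \<Sum>z\<in>A k. of_bool (c x z \<in> nb i (c x y) \<and> c y z \<in> nb j (c y x))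
       + (of_bool (e x y z \<and> \<not> (L x (c x y) (c x z) \<and> L y (c y x) (c y z))) :: real))"
  proof (intro sum_mono)
    fix x y z assume "x \<in> A i" "y \<in> A j" "z \<in> A k"
    then have "c x z \<in> nb i (c x y) \<and> c y z \<in> nb j (c y x)" if "L x (c x y) (c x z) \<and> L y (c y x) (c y z)"
      using that L_nb ijk c_less by blast
    then show "of_bool (e x y z) \<le> of_bool (c x z \<in> nb i (c x y) \<and> c y z \<in> nb j (c y x))
       + (of_bool (e x y z \<and> \<not> (L x (c x y) (c x z) \<and> L y (c y x) (c y z))) :: real)" by auto
  qed
  also have "\<dots> = (\<Sum>x\<in>A i. \<Sum>y\<in>A j. \<Sum>z\<in>A k. of_bool (c x z \<in> nb i (c x y) \<and> c y z \<in> nb j (c y x)))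
     + (\<Sum>x\<in>A i. \<Sum>y\<in>A j. \<Sum>z\<in>A k. of_bool (e x y z \<and> \<not> (L x (c x y) (c x z) \<and> L y (c y x) (c y z))))"
    by (simp only: sum.distrib)
  also have "\<dots> \<le> (real (card (A k)) * (\<Sum>a<K. \<Sum>b<K. real (card {(x,y)\<in>A i \<times> A j. c x y = a \<and> c y x = b}) *
         (density (\<lambda>x z. c x z \<in> nb i a) (A i) (A k) * density (\<lambda>y z. c y z \<in> nb j b) (A j) (A k)))
       + 2 * (real K)\<^sup>2 * \<epsilon> * ?W) + \<delta> * ?W"
  proof (rule add_mono)
    show "(\<Sum>x\<in>A i. \<Sum>y\<in>A j. \<Sum>z\<in>A k. of_bool (e x y z \<and> \<not> (L x (c x y) (c x z) \<and> L y (c y x) (c y z)))) \<le> \<delta> * ?W"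
      unfolding A_def by (rule few_errors) (use ijk in auto)
  qed (intro coloured_triples_upper_bound finite_A c_less eps nb; use regular ijk in \<open>simp add: A_def\<close>)
  also have "real (card (A k)) * (\<Sum>a<K. \<Sum>b<K. real (card {(x,y)\<in>A i \<times> A j. c x y = a \<and> c y x = b}) *
         (density (\<lambda>x z. c x z \<in> nb i a) (A i) (A k) * density (\<lambda>y z. c y z \<in> nb j b) (A j) (A k))) = tri i j k * ?W"
    unfolding tri_def sz_eq[OF nb] P_def sum_distrib_left sum_distrib_right
    using card_A_pos[OF ijk(1)] card_A_pos[OF ijk(2)] by (intro sum.cong refl) (simp add: field_simps)
  also have "tri i j k * ?W + 2 * (real K)\<^sup>2 * \<epsilon> * ?W + \<delta> * ?W = (tri i j k + 2 * (real K)\<^sup>2 * \<epsilon> + \<delta>) * ?W"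
    by (simp only: distrib_right)
  finally show ?thesis unfolding triple_density_def using W by (subst pos_divide_le_eq) auto
qed

end

section \<open>Symmetry and Ramsey dichotomy for triple densities\<close>

lemma triple_density_swap:
  assumes "\<And>x y z. e x y z = e y x z" "\<And>x y z. e x y z = e x z y"
  shows "triple_density e A B C = triple_density e B A C" "triple_density e A B C = triple_density e A C B"
proof -
  have "(\<Sum>x\<in>A. \<Sum>y\<in>B. \<Sum>z\<in>C. of_bool (e x y z)) = (\<Sum>y\<in>B. \<Sum>x\<in>A. \<Sum>z\<in>C. of_bool (e x y z) :: real)" by (rule sum.swap)
  also have "\<dots> = (\<Sum>y\<in>B. \<Sum>x\<in>A. \<Sum>z\<in>C. of_bool (e y x z))" by (intro sum.cong refl arg_cong[where f=of_bool] assms(1))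
  finally show "triple_density e A B C = triple_density e B A C" by (simp add: triple_density_def mult_ac)
  have "(\<Sum>x\<in>A. \<Sum>y\<in>B. \<Sum>z\<in>C. of_bool (e x y z)) = (\<Sum>x\<in>A. \<Sum>z\<in>C. \<Sum>y\<in>B. of_bool (e x y z) :: real)"
    by (rule sum.cong[OF refl], rule sum.swap)
  also have "\<dots> = (\<Sum>x\<in>A. \<Sum>z\<in>C. \<Sum>y\<in>B. of_bool (e x z y))" by (intro sum.cong refl arg_cong[where f=of_bool] assms(2))
  finally show "triple_density e A B C = triple_density e A C B" by (simp add: triple_density_def mult_ac)
qed

lemma triple_density_le_1: "triple_density e A B C \<le> 1"
proof -
  have "(\<Sum>x\<in>A. \<Sum>y\<in>B. \<Sum>z\<in>C. of_bool (e x y z)) \<le> (\<Sum>x\<in>A. \<Sum>y\<in>B. \<Sum>z\<in>C. 1 :: real)" by (intro sum_mono) auto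
  then have "(\<Sum>x\<in>A. \<Sum>y\<in>B. \<Sum>z\<in>C. of_bool (e x y z)) \<le> real (card A) * real (card B) * real (card C)" by (simp add: mult_ac)
  moreover have "x / w \<le> 1" if "x \<le> w" "0 \<le> w" for x w :: real
    using that by (cases "w = 0") (simp_all add: divide_le_eq_1)
  ultimately show ?thesis unfolding triple_density_def by simp
qed

lemma card_dense_triples:
  fixes \<delta> :: real and \<pi> :: "'v \<Rightarrow> 'l"
  assumes V: "finite V"
  defines "F x \<equiv> fibre V \<pi> x"
  shows "\<delta> * real (card {(x,y,z) \<in> V \<times> V \<times> V. \<delta> * (real (card (F x)) * real (card (F y)) * real (card (F z)))
           < (\<Sum>x\<in>F x. \<Sum>y\<in>F y. \<Sum>z\<in>F z. of_bool (E x y z))})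
    \<le> (\<Sum>x\<in>V. \<Sum>y\<in>V. \<Sum>z\<in>V. of_bool (E x y z))"
proof -
  let ?E = "\<lambda>(x,y,z). of_bool (E x y z) :: real" and ?\<phi> = "map_prod \<pi> (map_prod \<pi> \<pi>)"
  let ?\<Omega> = "V \<times> V \<times> V"
  have sums: "(\<Sum>x\<in>A. \<Sum>y\<in>B. \<Sum>z\<in>C. of_bool (E x y z)) = sum ?E (A \<times> B \<times> C)" for A B C
    by (simp add: sum.cartesian_product case_prod_beta)
  have fib: "fibre ?\<Omega> ?\<phi> (x,y,z) = F x \<times> F y \<times> F z" for x y z by (auto simp: fibre_def F_def)
  have "{(x,y,z) \<in> ?\<Omega>. \<delta> * (real (card (F x)) * real (card (F y)) * real (card (F z))) < sum ?E (F x \<times> F y \<times> F z)}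
     = {p \<in> ?\<Omega>. \<delta> * real (card (fibre ?\<Omega> ?\<phi> p)) < sum ?E (fibre ?\<Omega> ?\<phi> p)}"
    by (rule Collect_cong) (auto simp: fib card_cartesian_product mult.assoc)
  moreover have "\<delta> * real (card {p \<in> ?\<Omega>. \<delta> * real (card (fibre ?\<Omega> ?\<phi> p)) < sum ?E (fibre ?\<Omega> ?\<phi> p)}) \<le> sum ?E ?\<Omega>"
    using V by (intro card_dense_fibres) auto
  ultimately show ?thesis unfolding sums by simp
qed

lemma sorted_triple_unique:
  fixes i j k i' j' k' :: nat
  assumes "i < j" "j < k" "i' < j'" "j' < k'" "{i,j,k} = {i',j',k'}"
  shows "i = i' \<and> j = j' \<and> k = k'"
proof -
  have "[i,j,k] = sorted_list_of_set {i,j,k}" using assms(1,2) by simp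
  also have "\<dots> = sorted_list_of_set {i',j',k'}" by (simp only: assms(5))
  also have "\<dots> = [i',j',k']" using assms(3,4) by simp
  finally show ?thesis by simp
qed

lemma symmetric_triple_cases:
  fixes P :: "'a::linorder \<Rightarrow> 'a \<Rightarrow> 'a \<Rightarrow> bool"
  assumes "\<And>i j k. P i j k \<Longrightarrow> P j i k" "\<And>i j k. P i j k \<Longrightarrow> P i k j"
    and "\<And>i j k. i < j \<Longrightarrow> j < k \<Longrightarrow> P i j k" and "i \<noteq> j" "j \<noteq> k" "i \<noteq> k"
  shows "P i j k"
  using assms by (metis neqE)

lemma ramsey_triples:
  "\<exists>N::nat. \<forall>D :: nat \<Rightarrow> nat \<Rightarrow> nat \<Rightarrow> real. \<exists>B\<subseteq>{..<N}. card B = M \<and>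
    ((\<forall>i\<in>B. \<forall>j\<in>B. \<forall>k\<in>B. i < j \<longrightarrow> j < k \<longrightarrow> \<theta> \<le> D i j k) \<or>
     (\<forall>i\<in>B. \<forall>j\<in>B. \<forall>k\<in>B. i < j \<longrightarrow> j < k \<longrightarrow> D i j k < (\<theta>::real)))"
proof -
  obtain N where N: "\<forall>A::nat set. \<forall>col. N \<le> card A \<longrightarrow> finite A \<longrightarrow> (\<forall>T. col T < (2::nat)) \<longrightarrow>
     (\<exists>B\<subseteq>A. card B = M \<and> (\<exists>c. \<forall>T\<in>[B]\<^bsup>3\<^esup>. col T = c))"
    using ramsey_homogeneous[where ?'a=nat, of 2 M 3] by (rule exE)
  show ?thesis
  proof (rule exI[of _ N], rule allI)
    fix D :: "nat \<Rightarrow> nat \<Rightarrow> nat \<Rightarrow> real"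
    define high where "high T \<longleftrightarrow> (\<exists>i j k. i < j \<and> j < k \<and> T = {i,j,k} \<and> \<theta> \<le> D i j k)" for T
    obtain B c where B: "B \<subseteq> {..<N}" "card B = M" "\<forall>T\<in>[B]\<^bsup>3\<^esup>. (if high T then 1 else 0 :: nat) = c"
    proof -
      have "\<exists>B\<subseteq>{..<N}. card B = M \<and> (\<exists>c. \<forall>T\<in>[B]\<^bsup>3\<^esup>. (if high T then 1 else 0 :: nat) = c)"
        by (rule N[rule_format]) auto
      then show thesis using that by blast
    qed
    have high_iff: "high {i,j,k} \<longleftrightarrow> \<theta> \<le> D i j k" if "i < j" "j < k" for i j k
    proof
      assume "high {i,j,k}"
      then obtain i' j' k' where h: "i' < j'" "j' < k'" "{i,j,k} = {i',j',k'}" "\<theta> \<le> D i' j' k'"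
        unfolding high_def by (elim exE conjE)
      then show "\<theta> \<le> D i j k" using sorted_triple_unique[OF that h(1-3)] by (elim conjE) simp
    next
      assume "\<theta> \<le> D i j k"
      then show "high {i,j,k}" unfolding high_def using that by (intro exI conjI refl) auto
    qed
    have mem: "{i,j,k} \<in> [B]\<^bsup>3\<^esup>" if "i \<in> B" "j \<in> B" "k \<in> B" "i < j" "j < k" for i j k
      using that by (auto simp: nsets_def)
    have "(\<forall>i\<in>B. \<forall>j\<in>B. \<forall>k\<in>B. i < j \<longrightarrow> j < k \<longrightarrow> \<theta> \<le> D i j k) \<or>
     (\<forall>i\<in>B. \<forall>j\<in>B. \<forall>k\<in>B. i < j \<longrightarrow> j < k \<longrightarrow> D i j k < \<theta>)"
    proof (cases "c = 1")
      case True
      have "\<theta> \<le> D i j k" if "i \<in> B" "j \<in> B" "k \<in> B" "i < j" "j < k" for i j k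
      proof -
        have "(if high {i,j,k} then 1 else 0 :: nat) = 1" using B(3) mem[OF that] True by blast
        then show ?thesis using high_iff[OF that(4,5)] by (simp split: if_splits)
      qed
      then show ?thesis by blast
    next
      case False
      have "D i j k < \<theta>" if "i \<in> B" "j \<in> B" "k \<in> B" "i < j" "j < k" for i j k
      proof -
        have "(if high {i,j,k} then 1 else 0 :: nat) = c" using B(3) mem[OF that] by blast
        then show ?thesis using high_iff[OF that(4,5)] False by (simp split: if_splits)
      qed
      then show ?thesis by blast
    qed
    then show "\<exists>B\<subseteq>{..<N}. card B = M \<and>
    ((\<forall>i\<in>B. \<forall>j\<in>B. \<forall>k\<in>B. i < j \<longrightarrow> j < k \<longrightarrow> \<theta> \<le> D i j k) \<or>
     (\<forall>i\<in>B. \<forall>j\<in>B. \<forall>k\<in>B. i < j \<longrightarrow> j < k \<longrightarrow> D i j k < \<theta>))" using B by blast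
  qed
qed

lemma sum_triples_le:
  fixes D :: "nat \<Rightarrow> nat \<Rightarrow> nat \<Rightarrow> real"
  assumes "finite I" "0 \<le> \<theta>"
    and "\<And>i j k. i \<in> I \<Longrightarrow> j \<in> I \<Longrightarrow> k \<in> I \<Longrightarrow> i \<noteq> j \<Longrightarrow> j \<noteq> k \<Longrightarrow> i \<noteq> k \<Longrightarrow> D i j k \<le> \<theta>"
    and "\<And>i j k. D i j k \<le> 1"
  shows "(\<Sum>i\<in>I. \<Sum>j\<in>I. \<Sum>k\<in>I. D i j k) \<le> \<theta> * real (card I) ^ 3 + 3 * real (card I) ^ 2"
proof -
  have "(\<Sum>i\<in>I. \<Sum>j\<in>I. \<Sum>k\<in>I. D i j k)
    \<le> (\<Sum>i\<in>I. \<Sum>j\<in>I. \<Sum>k\<in>I. \<theta> + of_bool (i = j) + of_bool (j = k) + of_bool (i = k))"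
  proof (intro sum_mono)
    fix i j k assume "i \<in> I" "j \<in> I" "k \<in> I"
    then show "D i j k \<le> \<theta> + of_bool (i = j) + of_bool (j = k) + of_bool (i = k)"
      using assms(2) assms(3)[of i j k] assms(4)[of i j k] by (cases "i = j \<or> j = k \<or> i = k") auto
  qed
  also have "\<dots> = (\<Sum>i\<in>I. \<Sum>j\<in>I. real (card I) * (\<theta> + of_bool (i = j)) + (\<Sum>k\<in>I. of_bool (j = k)) + (\<Sum>k\<in>I. of_bool (i = k)))"
    by (simp add: sum.distrib)
  also have "\<dots> = (\<Sum>i\<in>I. \<Sum>j\<in>I. real (card I) * (\<theta> + of_bool (i = j)) + 2)"
    using assms(1) by (intro sum.cong refl) (simp add: of_bool_def)
  also have "\<dots> = (\<Sum>i\<in>I. real (card I) * (real (card I) * \<theta> + (\<Sum>j\<in>I. of_bool (i = j))) + 2 * real (card I))"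
    by (simp add: sum.distrib sum_distrib_left algebra_simps)
  also have "\<dots> = (\<Sum>i\<in>I. real (card I) * (real (card I) * \<theta> + 1) + 2 * real (card I))"
    using assms(1) by (intro sum.cong refl) (simp add: of_bool_def)
  also have "\<dots> = \<theta> * real (card I) ^ 3 + 3 * real (card I) ^ 2"
    by (simp add: power3_eq_cube power2_eq_square algebra_simps)
  finally show ?thesis .
qed

text \<open>Suppose all links have few triangles. Ramsey's theorem yields \<open>M\<close> cells
  whose triple densities are all at least \<open>1/4 + \<epsilon>/2\<close>, contradicting the array
  statement, or all below it, contradicting the uniform density. The constants are chosen in the
  order \<open>M\<close>, \<open>m\<close>, \<open>\<nu>\<close>, \<open>\<delta>'\<close>, then
  \<open>K\<close> and \<open>\<tau>\<close>, then \<open>\<epsilon>'\<close>, \<open>T\<close>,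
  \<open>\<mu>\<close>, \<open>n\<^sub>0\<close>.\<close>

theorem dense_link_has_many_triangles:
  fixes \<epsilon> :: real
  assumes \<epsilon>: "0 < \<epsilon>" "\<epsilon> \<le> 3/4"
  shows "\<exists>\<tau>>0. \<exists>\<mu>>0. \<exists>n\<^sub>0. \<forall>H::'v hypergraph. three_graph H \<longrightarrow> mu_dense (1/4 + \<epsilon>) \<mu> H \<longrightarrow> n\<^sub>0 \<le> card (verts H) \<longrightarrow>
    (\<exists>x. \<tau> * real (card (verts H)) ^ 3 < triangle_count (\<lambda>y z. {x,y,z} \<in> edges H) (verts H))"
proof -
  have "0 < \<epsilon> / 4" using \<epsilon> by simp
  from coloured_array_small_triple[OF this, where ?'c=nat] obtain m0 where
    m0: "\<forall>I (C :: nat set) L P. coloured_array I C L P \<longrightarrow> finite I \<longrightarrow> m0 \<le> card I \<longrightarrow>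
      (\<exists>i\<in>I. \<exists>j\<in>I. \<exists>k\<in>I. i < j \<and> j < k \<and>
        (coloured_array.tri C L P i j k < 1/4 + \<epsilon>/4 \<or> coloured_array.tri C L P j k i < 1/4 + \<epsilon>/4
         \<or> coloured_array.tri C L P i k j < 1/4 + \<epsilon>/4))" by (rule exE)
  note m0 = m0[rule_format]
  \<comment> \<open>Index triples with a coincidence, at most \<open>3 * M\<^sup>2\<close> of
    \<open>M ^ 3\<close>, then contribute at most \<open>\<epsilon> / 8\<close> to the
    average.\<close>
  obtain M' :: nat where M': "24 / \<epsilon> < real M'" using reals_Archimedean2 by blast
  define M where "M = max M' (max m0 3)"
  have M: "24 / \<epsilon> \<le> real M" "m0 \<le> M" "3 \<le> M" using M' by (auto simp: M_def)
  from ramsey_triples[of M "1/4 + \<epsilon>/2"] obtain m where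
    m: "\<forall>D :: nat \<Rightarrow> nat \<Rightarrow> nat \<Rightarrow> real. \<exists>B\<subseteq>{..<m}. card B = M \<and>
      ((\<forall>i\<in>B. \<forall>j\<in>B. \<forall>k\<in>B. i < j \<longrightarrow> j < k \<longrightarrow> 1/4 + \<epsilon>/2 \<le> D i j k) \<or>
       (\<forall>i\<in>B. \<forall>j\<in>B. \<forall>k\<in>B. i < j \<longrightarrow> j < k \<longrightarrow> D i j k < 1/4 + \<epsilon>/2))" by (rule exE)
  note m = m[THEN spec]
  have mM: "M \<le> m"
  proof -
    obtain B where "B \<subseteq> {..<m}" "card B = M" using m[of "\<lambda>_ _ _. 0"] by blast
    then show ?thesis using card_mono[of "{..<m}" B] by simp
  qed
  then have m3: "3 \<le> m" using M by simp
  \<comment> \<open>There will be three sources of bad triples, each of proportion at most \<nu>,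
    and \<open>3 * \<nu> * m ^ 3 = 3/8 < 1\<close>.\<close>
  define \<nu> where "\<nu> = 1 / (8 * real m ^ 3)"
  have \<nu>: "0 < \<nu>" using m3 by (simp add: \<nu>_def)
  define \<delta> where "\<delta> = \<epsilon> / 8"
  \<comment> \<open>Errors in two links make proportion
    \<open>2 * \<delta>' = \<delta> * \<nu>\<close>, so by Markov's inequality a proportion of at
    most \<nu> of the triples lies in cells with error density above \<delta>.\<close>
  define \<delta>' where "\<delta>' = \<delta> * \<nu> / 2"
  have \<delta>: "0 < \<delta>" "0 < \<delta>'" using \<epsilon> \<nu> by (auto simp: \<delta>_def \<delta>'_def)
  from few_triangles_structure[OF \<delta>(2), where ?'v='v] obtain K \<tau> where \<tau>: "0 < \<tau>" and
    struct: "\<forall>(V::'v set) G. finite V \<longrightarrow> (\<forall>x y. G x y \<longrightarrow> G y x) \<longrightarrow> triangle_count G V \<le> \<tau> * real (card V) ^ 3 \<longrightarrow>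
      (\<exists>c L. triangle_free_colouring \<delta>' V G K c L)"
    by (elim exE conjE)
  define \<epsilon>' where "\<epsilon>' = min \<nu> (\<epsilon> / (16 * (real K + 1)\<^sup>2))"
  have \<epsilon>': "0 < \<epsilon>'" "\<epsilon>' \<le> \<nu>" using \<nu> \<epsilon> by (auto simp: \<epsilon>'_def)
  have K\<epsilon>': "2 * (real K)\<^sup>2 * \<epsilon>' \<le> \<epsilon> / 8"
  proof -
    have "(real K)\<^sup>2 \<le> (real K + 1)\<^sup>2" by (intro power_mono) auto
    then have "2 * (real K)\<^sup>2 * \<epsilon>' \<le> 2 * (real K + 1)\<^sup>2 * (\<epsilon> / (16 * (real K + 1)\<^sup>2))"
      using \<epsilon>' by (intro mult_mono) (auto simp: \<epsilon>'_def)
    also have "\<dots> = \<epsilon> / 8" using add_pos_nonneg[of 1 "real K"] by (simp add: field_simps)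
    finally show ?thesis .
  qed
  \<comment> \<open>There is one relation for each set of colours, hence \<open>2^K\<close>. The
    initial partition groups vertices by their graph on \<open>K\<close> colours, of which there are
    at most \<open>2 ^ (K * K)\<close>; this is the source of \<open>L_const\<close>.\<close>
  from regularity_lemma[OF \<epsilon>'(1), where ?'v='v and ?'r="nat set" and ?'l="(nat \<times> nat) set", of "2^K" "2 ^ (K * K)"]
  obtain T where reg: "\<forall>(V::'v set) (\<R>::nat set set) R (\<pi>\<^sub>0::'v \<Rightarrow> (nat \<times> nat) set).
      finite V \<longrightarrow> finite \<R> \<longrightarrow> card \<R> \<le> 2^K \<longrightarrow> card (\<pi>\<^sub>0 ` V) \<le> 2 ^ (K * K) \<longrightarrow>
      (\<exists>\<pi>. regular_partition \<epsilon>' V \<R> R \<pi>\<^sub>0 T \<pi>)" by (rule exE)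
  note reg = reg[rule_format]
  define T1 where "T1 = real T + 1"
  have T1: "0 < T1" by (simp add: T1_def)
  \<comment> \<open>Chosen so that \<open>6 * \<mu> * n ^ 3 / s ^ 3\<close> equals
    \<open>\<epsilon> / 8\<close> for cells of size at least
    \<open>s = \<nu> * n / T1\<close>.\<close>
  define \<mu> where "\<mu> = \<epsilon> / (48 * (T1 / \<nu>) ^ 3)"
  have \<mu>: "0 < \<mu>" using \<epsilon> T1 \<nu> by (simp add: \<mu>_def)
  obtain n\<^sub>0 :: nat where n\<^sub>0: "24 * T1 / (\<nu> * \<epsilon>) < real n\<^sub>0" using reals_Archimedean2 by blast
  have n\<^sub>0_pos: "0 < real n\<^sub>0"
  proof -
    have "0 < 24 * T1 / (\<nu> * \<epsilon>)" using T1 \<nu> \<epsilon> by simp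
    then show ?thesis using n\<^sub>0 by linarith
  qed
  have main: False if H: "three_graph H" and dense: "mu_dense (1/4 + \<epsilon>) \<mu> H" and big: "n\<^sub>0 \<le> card (verts H)"
    and few: "\<And>x. triangle_count (\<lambda>y z. {x,y,z} \<in> edges H) (verts H) \<le> \<tau> * real (card (verts H)) ^ 3" for H :: "'v hypergraph"
  proof -
    define V where "V = verts H"
    define n where "n = real (card V)"
    have V: "finite V" using H by (simp add: three_graph_def V_def)
    have n: "0 < n" "24 * T1 / (\<nu> * \<epsilon>) \<le> n" using n\<^sub>0 n\<^sub>0_pos big by (auto simp: n_def V_def)
    define e where "e x y z \<longleftrightarrow> {x,y,z} \<in> edges H" for x y z
    have e_sym: "e x y z = e y x z" "e x y z = e x z y" for x y z
      by (simp_all add: e_def insert_commute)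
    have "\<exists>c L. triangle_free_colouring \<delta>' V (e x) K c L" for x
    proof (rule struct[rule_format, OF V])
      show "e x z y" if "e x y z" for y z using that by (simp only: e_sym(2)[of x z y])
      show "triangle_count (e x) V \<le> \<tau> * real (card V) ^ 3"
        using few[of x] by (simp add: e_def[abs_def] V_def)
    qed
    then have "\<exists>p. \<forall>x. triangle_free_colouring \<delta>' V (e x) K (fst (p x)) (snd (p x))"
      by (intro choice allI) simp
    then obtain p where p: "\<And>x. triangle_free_colouring \<delta>' V (e x) K (fst (p x)) (snd (p x))" by blast
    define c L where "c x = fst (p x)" and "L x = snd (p x)" for x
    note colouring = triangle_free_colouringD[OF p, folded c_def L_def]
    note c = colouring(1) and L_sym = colouring(2) and L_free = colouring(3) and err = colouring(4)[folded n_def]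
    have err_sum: "(\<Sum>y\<in>V. \<Sum>z\<in>V. of_bool (e x y z \<and> \<not> L x (c x y) (c x z))) \<le> \<delta>' * n\<^sup>2" for x
    proof -
      have "(\<Sum>y\<in>V. \<Sum>z\<in>V. of_bool (e x y z \<and> \<not> L x (c x y) (c x z))) = (\<Sum>q\<in>V\<times>V. of_bool (e x (fst q) (snd q) \<and> \<not> L x (c x (fst q)) (c x (snd q))) :: real)"
        by (simp add: sum.cartesian_product case_prod_beta)
      also have "\<dots> = real (card {q\<in>V\<times>V. e x (fst q) (snd q) \<and> \<not> L x (c x (fst q)) (c x (snd q))})"
        using V by (intro sum_of_bool_card) auto
      also have "{q\<in>V\<times>V. e x (fst q) (snd q) \<and> \<not> L x (c x (fst q)) (c x (snd q))} = {(y,z) \<in> V \<times> V. e x y z \<and> \<not> L x (c x y) (c x z)}"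
        by auto
      finally show ?thesis using err[of x] by simp
    qed
    define E where "E x y z \<longleftrightarrow> e x y z \<and> \<not> (L x (c x y) (c x z) \<and> L y (c y x) (c y z))" for x y z
    have E_sum: "(\<Sum>x\<in>V. \<Sum>y\<in>V. \<Sum>z\<in>V. of_bool (E x y z)) \<le> 2 * \<delta>' * n ^ 3"
    proof -
      have "(\<Sum>x\<in>V. \<Sum>y\<in>V. \<Sum>z\<in>V. of_bool (E x y z)) \<le> (\<Sum>x\<in>V. \<Sum>y\<in>V. \<Sum>z\<in>V. of_bool (e x y z \<and> \<not> L x (c x y) (c x z))
           + (of_bool (e y x z \<and> \<not> L y (c y x) (c y z)) :: real))"
        using e_sym by (intro sum_mono) (auto simp: E_def)
      also have "\<dots> = (\<Sum>x\<in>V. \<Sum>y\<in>V. \<Sum>z\<in>V. of_bool (e x y z \<and> \<not> L x (c x y) (c x z)))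
         + (\<Sum>x\<in>V. \<Sum>y\<in>V. \<Sum>z\<in>V. of_bool (e y x z \<and> \<not> L y (c y x) (c y z)))" by (simp only: sum.distrib)
      also have "(\<Sum>x\<in>V. \<Sum>y\<in>V. \<Sum>z\<in>V. of_bool (e y x z \<and> \<not> L y (c y x) (c y z)))
         = (\<Sum>y\<in>V. \<Sum>x\<in>V. \<Sum>z\<in>V. of_bool (e y x z \<and> \<not> L y (c y x) (c y z)) :: real)" by (rule sum.swap)
      also have "(\<Sum>x\<in>V. \<Sum>y\<in>V. \<Sum>z\<in>V. of_bool (e x y z \<and> \<not> L x (c x y) (c x z)))
         + (\<Sum>y\<in>V. \<Sum>x\<in>V. \<Sum>z\<in>V. of_bool (e y x z \<and> \<not> L y (c y x) (c y z))) \<le> (\<Sum>x\<in>V. \<delta>' * n\<^sup>2) + (\<Sum>y\<in>V. \<delta>' * n\<^sup>2)"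
        by (intro add_mono sum_mono err_sum)
      also have "\<dots> = 2 * \<delta>' * n ^ 3" by (simp add: n_def power3_eq_cube power2_eq_square)
      finally show ?thesis .
    qed
    define \<pi>\<^sub>0 where "\<pi>\<^sub>0 x = {(a,b). a < K \<and> b < K \<and> L x a b}" for x
    have "card (\<pi>\<^sub>0 ` V) \<le> card (Pow ({..<K} \<times> {..<K}))" by (intro card_mono) (auto simp: \<pi>\<^sub>0_def)
    then have card_\<pi>\<^sub>0: "card (\<pi>\<^sub>0 ` V) \<le> 2 ^ (K * K)" by (simp add: card_Pow card_cartesian_product)
    define R where "R S x z \<longleftrightarrow> c x z \<in> S" for S x z
    obtain \<pi> :: "'v \<Rightarrow> nat" where \<pi>: "card (\<pi> ` V) \<le> T" "\<forall>x\<in>V. \<forall>y\<in>V. \<pi> x = \<pi> y \<longrightarrow> \<pi>\<^sub>0 x = \<pi>\<^sub>0 y"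
       "real (card (irregular_points \<epsilon>' V \<pi> (Pow {..<K}) R)) \<le> \<epsilon>' * n\<^sup>2"
      using reg[OF V _ _ card_\<pi>\<^sub>0, of "Pow {..<K}" R] unfolding n_def regular_partition_def by (auto simp: card_Pow)
    define Ir where "Ir = irregular_points \<epsilon>' V \<pi> (Pow {..<K}) R"
    let ?F = "fibre V \<pi>"
    define s where "s = \<nu> * n / T1"
    have s: "0 < s" using \<nu> n T1 by (simp add: s_def)
    define Sm where "Sm = {x\<in>V. real (card (?F x)) < s}"
    have Sm: "real (card Sm) \<le> \<nu> * n"
    proof -
      have "real (card Sm) \<le> real (card (\<pi> ` V)) * s"
        unfolding Sm_def using s by (intro card_small_fibres V) auto
      also have "\<dots> \<le> T1 * s" using \<pi>(1) s by (intro mult_right_mono) (auto simp: T1_def)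
      also have "\<dots> = \<nu> * n" using T1 by (simp add: s_def)
      finally show ?thesis .
    qed
    define De where "De = {(x,y,z) \<in> V \<times> V \<times> V. \<delta> * (real (card (?F x)) * real (card (?F y)) * real (card (?F z)))
           < (\<Sum>x\<in>?F x. \<Sum>y\<in>?F y. \<Sum>z\<in>?F z. of_bool (E x y z))}"
    have "\<delta> * real (card De) \<le> 2 * \<delta>' * n ^ 3"
      unfolding De_def using card_dense_triples[OF V, of \<delta> \<pi> E] E_sum by linarith
    then have De: "real (card De) \<le> \<nu> * n ^ 3" using \<delta> by (simp add: \<delta>'_def)
    \<comment> \<open>Only the first two entries are tested for irregularity and only the first for
      smallness. Since \<open>m \<ge> 3\<close>, any two indices extend to a triple, so all pairs
      and all single cells are covered.\<close>
    define Bd where "Bd = (\<lambda>((x,y),z). (x,y,z)) ` (Ir \<times> V) \<union> (Sm \<times> V \<times> V) \<union> De"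
    have IrV: "Ir \<subseteq> V \<times> V" by (auto simp: Ir_def irregular_points_def)
    have Bd_sub: "Bd \<subseteq> V \<times> V \<times> V" using IrV by (auto simp: Bd_def Sm_def De_def)
    have fIr: "finite Ir" by (rule finite_subset[OF IrV]) (use V in auto)
    have "card Bd \<le> card ((\<lambda>((x,y),z). (x,y,z)) ` (Ir \<times> V)) + card (Sm \<times> V \<times> V) + card De"
      unfolding Bd_def by (meson add_mono card_Un_le le_refl order_trans)
    also have "\<dots> \<le> card (Ir \<times> V) + card (Sm \<times> V \<times> V) + card De"
      using fIr V by (intro add_mono card_image_le) auto
    finally have "real (card Bd) \<le> real (card (Ir \<times> V) + card (Sm \<times> V \<times> V) + card De)" by (simp only: of_nat_le_iff)
    also have "\<dots> = real (card Ir) * n + real (card Sm) * (n * n) + real (card De)"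
      by (simp add: card_cartesian_product n_def)
    also have "\<dots> \<le> (\<epsilon>' * n\<^sup>2) * n + (\<nu> * n) * (n * n) + \<nu> * n ^ 3"
      using \<pi>(3) Sm De n by (intro add_mono mult_right_mono) (auto simp: Ir_def)
    also have "\<dots> = (\<epsilon>' + 2 * \<nu>) * n ^ 3" by (simp add: power2_eq_square power3_eq_cube algebra_simps)
    also have "\<dots> \<le> (3 * \<nu>) * n ^ 3" using \<epsilon>' n by (intro mult_right_mono) auto
    finally have "real m ^ 3 * real (card Bd) \<le> real m ^ 3 * ((3 * \<nu>) * n ^ 3)" by (intro mult_left_mono) auto
    also have "\<dots> = 3/8 * n ^ 3" using m3 by (simp add: \<nu>_def)
    also have "\<dots> < n ^ 3" using n by simp
    finally have few_bad: "real m ^ 3 * real (card Bd) < real (card V) ^ 3" by (simp add: n_def)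
    obtain f :: "nat \<Rightarrow> 'v" where f: "\<And>i. i < m \<Longrightarrow> f i \<in> V"
      and good: "\<And>i j k. i < m \<Longrightarrow> j < m \<Longrightarrow> k < m \<Longrightarrow> i \<noteq> j \<Longrightarrow> j \<noteq> k \<Longrightarrow> i \<noteq> k \<Longrightarrow> (f i, f j, f k) \<notin> Bd"
      using exists_selection_avoiding[OF V m3 Bd_sub few_bad] by blast
    have third: "\<exists>k<m. i \<noteq> k \<and> j \<noteq> k" for i j
    proof -
      have "card {i,j} < card {..<m}" using m3 by (simp add: card_insert_if)
      then have "\<not> {..<m} \<subseteq> {i,j}" using card_mono[of "{i,j}" "{..<m}"] by auto
      then show ?thesis by auto
    qed
    have pair_good: "(f i, f j) \<notin> Ir" "f i \<notin> Sm" if "i < m" "j < m" "i \<noteq> j" for i j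
    proof -
      obtain k where k: "k < m" "i \<noteq> k" "j \<noteq> k" using third by blast
      have bad: "(f i, f j, f k) \<notin> Bd" using good that k by blast
      have "(f i, f j, f k) \<in> (\<lambda>((x,y),z). (x,y,z)) ` (Ir \<times> V)" if "(f i, f j) \<in> Ir"
        using that f k by (intro image_eqI[of _ _ "((f i, f j), f k)"]) auto
      then show "(f i, f j) \<notin> Ir" using bad by (auto simp: Bd_def)
      show "f i \<notin> Sm" using bad f that k by (auto simp: Bd_def)
    qed
    interpret link_partition V c K L \<pi> f m \<epsilon>' \<delta> e
    proof
      show "L y a b" if "x \<in> V" "y \<in> V" "\<pi> x = \<pi> y" "a < K" "b < K" "L x a b" for x y a b
      proof -
        have "\<pi>\<^sub>0 x = \<pi>\<^sub>0 y" using \<pi>(2) that(1-3) by blast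
        moreover have "(a,b) \<in> \<pi>\<^sub>0 x" using that by (simp add: \<pi>\<^sub>0_def)
        ultimately show ?thesis by (simp add: \<pi>\<^sub>0_def)
      qed
      show "regular_pair \<epsilon>' (?F (f i)) (?F (f j)) (\<lambda>x z. c x z \<in> S)" if "i < m" "j < m" "i \<noteq> j" "S \<subseteq> {..<K}" for i j S
        using pair_good(1)[OF that(1-3)] f that unfolding Ir_def irregular_points_def R_def by auto
      show "(\<Sum>x\<in>?F (f i). \<Sum>y\<in>?F (f j). \<Sum>z\<in>?F (f k). of_bool (e x y z \<and> \<not> (L x (c x y) (c x z) \<and> L y (c y x) (c y z))))
        \<le> \<delta> * (real (card (?F (f i))) * real (card (?F (f j))) * real (card (?F (f k))))"
        if "i < m" "j < m" "k < m" "i \<noteq> j" "j \<noteq> k" "i \<noteq> k" for i j k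
        using good[OF that] f that unfolding Bd_def De_def E_def by auto
    qed (fact V f c L_sym L_free less_imp_le[OF \<epsilon>'(1)])+
    define D where "D i j k = triple_density e (A i) (A j) (A k)" for i j k
    have D_swap: "D i j k = D j i k" "D i j k = D i k j" for i j k
      unfolding D_def using triple_density_swap[of e, OF e_sym] by metis+
    obtain B where B: "B \<subseteq> {..<m}" "card B = M" and
      "(\<forall>i\<in>B. \<forall>j\<in>B. \<forall>k\<in>B. i < j \<longrightarrow> j < k \<longrightarrow> 1/4 + \<epsilon>/2 \<le> D i j k) \<or>
       (\<forall>i\<in>B. \<forall>j\<in>B. \<forall>k\<in>B. i < j \<longrightarrow> j < k \<longrightarrow> D i j k < 1/4 + \<epsilon>/2)"
      using m[of D] by blast
    then consider (high) "\<And>i j k. i \<in> B \<Longrightarrow> j \<in> B \<Longrightarrow> k \<in> B \<Longrightarrow> i < j \<Longrightarrow> j < k \<Longrightarrow> 1/4 + \<epsilon>/2 \<le> D i j k"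
      | (low) "\<And>i j k. i \<in> B \<Longrightarrow> j \<in> B \<Longrightarrow> k \<in> B \<Longrightarrow> i < j \<Longrightarrow> j < k \<Longrightarrow> D i j k < 1/4 + \<epsilon>/2" by blast
    then show False
    proof cases
      \<comment> \<open>Regularity and link errors add at most \<open>\<epsilon> / 8\<close> each to
        \<open>tri\<close>, so a value below \<open>1/4 + \<epsilon>/4\<close> contradicts the lower
        bound. By symmetry of \<open>D\<close> all three arrangements bound the same
        density.\<close>
      case high
      have sub: "coloured_array B {..<K} LL P"
        using B(1) by (rule coloured_array_subset)
      have fB: "finite B" using B(1) finite_subset by blast
      obtain i j k where ijk: "i \<in> B" "j \<in> B" "k \<in> B" "i < j" "j < k"
        and small: "tri i j k < 1/4 + \<epsilon>/4 \<or> tri j k i < 1/4 + \<epsilon>/4 \<or> tri i k j < 1/4 + \<epsilon>/4"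
      proof -
        have "m0 \<le> card B" using M(2) B(2) by simp
        from m0[OF sub fB this] show ?thesis using that by (elim bexE conjE)
      qed
      have lt: "i < m" "j < m" "k < m" "i \<noteq> j" "j \<noteq> k" "i \<noteq> k" using ijk B by auto
      have "D i j k \<le> tri i j k + 2 * (real K)\<^sup>2 * \<epsilon>' + \<delta>" "D j k i \<le> tri j k i + 2 * (real K)\<^sup>2 * \<epsilon>' + \<delta>"
        "D i k j \<le> tri i k j + 2 * (real K)\<^sup>2 * \<epsilon>' + \<delta>"
        unfolding D_def using lt by (intro triple_density_le_tri; simp)+
      moreover have "D j k i = D i j k" using D_swap(2)[of j k i] D_swap(1)[of j i k] by simp
      moreover have "D i k j = D i j k" by (rule D_swap(2)[symmetric])
      ultimately have "D i j k < 1/4 + \<epsilon>/2" using small K\<epsilon>' by (auto simp: \<delta>_def)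
      then show False using high[OF ijk] by simp
    next
      \<comment> \<open>The average is at least \<open>1/4 + 3/4 * \<epsilon>\<close> by uniform
        density but at most \<open>1/4 + 5/8 * \<epsilon>\<close> here.\<close>
      case low
      have low': "D i j k \<le> 1/4 + \<epsilon>/2" if ijk: "i \<in> B" "j \<in> B" "k \<in> B" "i \<noteq> j" "j \<noteq> k" "i \<noteq> k" for i j k
      proof -
        have "i \<in> B \<and> j \<in> B \<and> k \<in> B \<longrightarrow> D i j k < 1/4 + \<epsilon>/2"
          using ijk(4-6)
        proof (rule symmetric_triple_cases[of "\<lambda>i j k. i \<in> B \<and> j \<in> B \<and> k \<in> B \<longrightarrow> D i j k < 1/4 + \<epsilon>/2", rotated 3])
          show "j \<in> B \<and> i \<in> B \<and> k \<in> B \<longrightarrow> D j i k < 1/4 + \<epsilon>/2"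
            if "i \<in> B \<and> j \<in> B \<and> k \<in> B \<longrightarrow> D i j k < 1/4 + \<epsilon>/2" for i j k
            using that D_swap(1)[of i j k] by simp
          show "i \<in> B \<and> k \<in> B \<and> j \<in> B \<longrightarrow> D i k j < 1/4 + \<epsilon>/2"
            if "i \<in> B \<and> j \<in> B \<and> k \<in> B \<longrightarrow> D i j k < 1/4 + \<epsilon>/2" for i j k
            using that D_swap(2)[of i j k] by simp
        qed (use low in blast)
        then show ?thesis using ijk by simp
      qed
      have fB: "finite B" using B(1) finite_subset by blast
      have upper: "(\<Sum>i\<in>B. \<Sum>j\<in>B. \<Sum>k\<in>B. D i j k) \<le> (1/4 + \<epsilon>/2) * real M ^ 3 + 3 * real M ^ 2"
        unfolding B(2)[symmetric]
      proof (rule sum_triples_le[OF fB _ low'])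
        show "D i j k \<le> 1" for i j k unfolding D_def by (rule triple_density_le_1)
      qed (use \<epsilon> in auto)
      have cells: "A i \<subseteq> verts H \<and> s \<le> real (card (A i))" if "i \<in> B" for i
      proof -
        have "i < m" using that B by auto
        moreover obtain j where "j < m" "i \<noteq> j" using third by blast
        ultimately have "f i \<notin> Sm" "f i \<in> V" using pair_good f by blast+
        then have "s \<le> real (card (A i))" by (simp add: A_def Sm_def)
        moreover have "A i \<subseteq> verts H" by (simp add: A_def fibre_subset flip: V_def)
        ultimately show ?thesis by blast
      qed
      have "B \<noteq> {}" using B M by auto
      have "1/4 + \<epsilon> - 3 / s - 6 * \<mu> * real (card (verts H)) ^ 3 / s ^ 3
        \<le> (\<Sum>i\<in>B. \<Sum>j\<in>B. \<Sum>k\<in>B. triple_density (\<lambda>x y z. {x,y,z} \<in> edges H) (A i) (A j) (A k)) / real (card B) ^ 3"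
        by (rule average_triple_density[OF H dense _ _ fB \<open>B \<noteq> {}\<close> s cells]) (use \<epsilon> in auto)
      also have "\<dots> = (\<Sum>i\<in>B. \<Sum>j\<in>B. \<Sum>k\<in>B. D i j k) / real M ^ 3"
        unfolding D_def e_def B(2) by (rule refl)
      also have "\<dots> \<le> ((1/4 + \<epsilon>/2) * real M ^ 3 + 3 * real M ^ 2) / real M ^ 3"
        using upper by (intro divide_right_mono) auto
      also have "\<dots> = 1/4 + \<epsilon>/2 + 3 / real M"
        using M by (simp add: field_simps power3_eq_cube power2_eq_square)
      also have "3 / real M \<le> \<epsilon> / 8"
        using M \<epsilon> by (simp add: field_simps)
      finally have "1/4 + \<epsilon> - 3 / s - 6 * \<mu> * n ^ 3 / s ^ 3 \<le> 1/4 + \<epsilon>/2 + \<epsilon>/8" by (simp add: n_def V_def)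
      moreover have "3 / s \<le> \<epsilon> / 8"
      proof -
        have "24 * T1 \<le> n * (\<nu> * \<epsilon>)" using n(2) \<nu> \<epsilon> by (subst (asm) pos_divide_le_eq) auto
        then show ?thesis using \<nu> n T1 by (simp add: s_def field_simps)
      qed
      moreover have "6 * \<mu> * n ^ 3 / s ^ 3 = \<epsilon> / 8"
        using n \<nu> T1 by (simp add: s_def \<mu>_def power_divide power_mult_distrib)
      ultimately show False using \<epsilon> by linarith
    qed
  qed
  show ?thesis
    using \<tau> \<mu> main by (intro exI[of _ \<tau>] exI[of _ \<mu>] exI[of _ n\<^sub>0] conjI allI impI) (auto simp: not_less[symmetric])
qed

section \<open>Finding wheels\<close>

lemma contains_wheel_iff:
  "contains_copy H (wheel t) \<longleftrightarrow> (\<exists>f. inj_on f {0..<t} \<and> f ` {0..<t} \<subseteq> verts H \<and>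
     (\<forall>i\<in>{1..t - 1}. f ` {0, i, if i = t - 1 then 1 else i + 1} \<in> edges H))"
  by (simp only: contains_copy_def wheel_def fst_conv snd_conv Setcompr_eq_image ball_simps)

text \<open>Double counting of pairs of a vertex \<open>z\<close> and a \<open>k\<close>-subset of
  its neighbourhood. Disjointness of \<open>X\<close> and \<open>Y\<close> is left to the
  applications, where it follows from edges having three distinct vertices.\<close>

lemma kovari_sos_turan:
  fixes \<delta> :: real
  assumes V: "finite V" and k: "0 < k" and \<delta>: "0 < \<delta>"
    and n: "(2 * real k / \<delta>) ^ Suc k < real (card V)" and large: "2 * real k / \<delta> \<le> real (card V)"
    and dense: "\<delta> * (real (card V))\<^sup>2 \<le> edge_count G V V"
  obtains X Y where "X \<subseteq> V" "Y \<subseteq> V" "card X = k" "card Y = k" "\<And>x y. x \<in> X \<Longrightarrow> y \<in> Y \<Longrightarrow> G x y"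
proof -
  define n where "n = real (card V)"
  define N where "N z = {x\<in>V. G x z}" for z
  \<comment> \<open>Keeping only vertices of at least half the average degree allows the pointwise
    bound \<open>(d / k) ^ k\<close> for \<open>d choose k\<close> in place of a convexity
    argument.\<close>
  define Z where "Z = {z\<in>V. \<delta> * n / 2 \<le> real (card (N z))}"
  have finN: "finite (N z)" and N_le: "card (N z) \<le> card V" for z using V by (auto simp: N_def intro: card_mono)
  have Z: "finite Z" "Z \<subseteq> V" using V by (auto simp: Z_def)
  have n0: "0 < n" using large k \<delta> by (smt (verit) divide_pos_pos n_def of_nat_0_less_iff)
  have "\<delta> * n\<^sup>2 \<le> (\<Sum>z\<in>V. real (card (N z)))"
  proof -
    have "edge_count G V V = (\<Sum>z\<in>V. \<Sum>x\<in>V. of_bool (G x z))" unfolding edge_count_def by (rule sum.swap)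
    then show ?thesis using dense by (simp only: n_def N_def sum_of_bool_card[OF V])
  qed
  also have "\<dots> \<le> (\<Sum>z\<in>V. of_bool (z \<in> Z) * n + \<delta> * n / 2)"
  proof (rule sum_mono)
    fix z assume "z \<in> V"
    then show "real (card (N z)) \<le> of_bool (z \<in> Z) * n + \<delta> * n / 2"
      using N_le[of z] n0 \<delta> by (cases "z \<in> Z") (auto simp: Z_def n_def intro: add_increasing2)
  qed
  also have "\<dots> = real (card Z) * n + n * (\<delta> * n / 2)"
  proof -
    have "(\<Sum>z\<in>V. of_bool (z \<in> Z) * n) = (\<Sum>z\<in>V. of_bool (z \<in> Z)) * n" by (rule sum_distrib_right[symmetric])
    also have "(\<Sum>z\<in>V. of_bool (z \<in> Z) :: real) = real (card {z\<in>V. z \<in> Z})" by (rule sum_of_bool_card[OF V])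
    also have "{z\<in>V. z \<in> Z} = Z" using Z by auto
    finally show ?thesis by (simp add: sum.distrib n_def)
  qed
  finally have "(\<delta> * n / 2) * n \<le> real (card Z) * n" by (simp add: power2_eq_square algebra_simps)
  then have cZ: "\<delta> * n / 2 \<le> real (card Z)" using n0 by simp
  have kle: "real k \<le> \<delta> * n / 2" using large \<delta> by (simp add: n_def field_simps)
  have "\<exists>X\<in>[V]\<^bsup>k\<^esup>. k \<le> card {z\<in>Z. X \<subseteq> N z}"
  proof (rule ccontr)
    assume "\<not> ?thesis"
    then have few: "card {z\<in>Z. X \<subseteq> N z} \<le> k" if "X \<in> [V]\<^bsup>k\<^esup>" for X using that by force
    have fk: "finite ([V]\<^bsup>k\<^esup>)" using V by (rule finite_imp_finite_nsets)
    have "(\<delta> * n / 2) * (\<delta> * n / 2 / real k) ^ k \<le> real (card Z) * (\<delta> * n / 2 / real k) ^ k"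
      using cZ \<delta> n0 by (intro mult_right_mono) auto
    also have "\<dots> = (\<Sum>z\<in>Z. (\<delta> * n / 2 / real k) ^ k)" by simp
    also have "\<dots> \<le> (\<Sum>z\<in>Z. real (card {X\<in>[V]\<^bsup>k\<^esup>. X \<subseteq> N z}))"
    proof (rule sum_mono)
      fix z assume z: "z \<in> Z"
      then have big: "\<delta> * n / 2 \<le> real (card (N z))" by (simp add: Z_def)
      have "(\<delta> * n / 2 / real k) ^ k \<le> (real (card (N z)) / real k) ^ k"
        using big \<delta> n0 k by (intro power_mono divide_right_mono) auto
      also have "\<dots> \<le> real (card (N z) choose k)"
        using big kle by (intro binomial_ge_n_over_k_pow_k) auto
      also have "card (N z) choose k = card ([N z]\<^bsup>k\<^esup>)" by simp
      also have "[N z]\<^bsup>k\<^esup> = {X\<in>[V]\<^bsup>k\<^esup>. X \<subseteq> N z}" by (auto simp: nsets_def N_def)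
      finally show "(\<delta> * n / 2 / real k) ^ k \<le> real (card {X\<in>[V]\<^bsup>k\<^esup>. X \<subseteq> N z})" .
    qed
    also have "\<dots> = (\<Sum>z\<in>Z. \<Sum>X\<in>[V]\<^bsup>k\<^esup>. of_bool (X \<subseteq> N z))"
      by (simp only: sum_of_bool_card[OF fk])
    also have "\<dots> = (\<Sum>X\<in>[V]\<^bsup>k\<^esup>. \<Sum>z\<in>Z. of_bool (X \<subseteq> N z))" by (rule sum.swap)
    also have "\<dots> = (\<Sum>X\<in>[V]\<^bsup>k\<^esup>. real (card {z\<in>Z. X \<subseteq> N z}))" by (simp only: sum_of_bool_card[OF Z(1)])
    also have "\<dots> \<le> (\<Sum>X\<in>[V]\<^bsup>k\<^esup>. real k)" using few by (intro sum_mono) auto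
    also have "\<dots> = real (card V choose k) * real k" by simp
    also have "\<dots> \<le> n ^ k * real k"
    proof -
      have "k \<le> card V"
      proof -
        have "real k \<le> real (card Z)" using kle cZ by linarith
        then show ?thesis using card_mono[OF V Z(2)] by simp
      qed
      then have "card V choose k \<le> card V ^ k" by (rule binomial_le_pow)
      then have "real (card V choose k) \<le> n ^ k" unfolding n_def by (metis of_nat_le_iff of_nat_power)
      then show ?thesis by (intro mult_right_mono) auto
    qed
    finally have "(\<delta> * n / 2) * (\<delta> * n / 2 / real k) ^ k \<le> n ^ k * real k" .
    then have "n ^ k * ((\<delta> * n / 2) * (\<delta> / (2 * real k)) ^ k) \<le> n ^ k * real k"
      by (simp add: power_mult_distrib power_divide mult_ac)
    then have "(\<delta> * n / 2) * (\<delta> / (2 * real k)) ^ k \<le> real k" using n0 by simp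
    then have "n * (\<delta> / (2 * real k)) ^ Suc k \<le> 1" using k by (simp add: field_simps)
    then have "n \<le> (2 * real k / \<delta>) ^ Suc k"
      using \<delta> k by (simp add: power_divide field_simps)
    then show False using n by (simp add: n_def)
  qed
  then obtain X where X: "X \<in> [V]\<^bsup>k\<^esup>" "k \<le> card {z\<in>Z. X \<subseteq> N z}" by blast
  then obtain Y where Y: "Y \<subseteq> {z\<in>Z. X \<subseteq> N z}" "card Y = k" using obtain_subset_with_card_n by metis
  show ?thesis
    by (rule that[of X Y]) (use X Y Z in \<open>auto simp: nsets_def N_def\<close>)
qed

section \<open>Wheels from complete bipartite graphs in links\<close>

lemma three_graph_edge:
  assumes "three_graph H" "{x,y,z} \<in> edges H"
  shows "x \<in> verts H" "y \<in> verts H" "z \<in> verts H" "x \<noteq> y" "y \<noteq> z" "x \<noteq> z"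
proof -
  have "{x,y,z} \<subseteq> verts H" "card {x,y,z} = 3" using assms by (auto simp: three_graph_def nsets_def)
  then show "x \<in> verts H" "y \<in> verts H" "z \<in> verts H" "x \<noteq> y" "y \<noteq> z" "x \<noteq> z"
    by (auto simp: card_insert_if split: if_splits)
qed

lemma contains_wheelI:
  assumes H: "three_graph H" and inj: "inj_on r {1..<t}" and t: "3 \<le> t"
    and e: "\<And>i. 1 \<le> i \<Longrightarrow> i < t \<Longrightarrow> {v, r i, r (if i = t - 1 then 1 else i + 1)} \<in> edges H"
  shows "contains_copy H (wheel t)"
proof -
  define f where "f i = (if i = 0 then v else r i)" for i
  have r: "v \<in> verts H" "r i \<in> verts H" "v \<noteq> r i" if "1 \<le> i" "i < t" for i
    using three_graph_edge(1,2,4)[OF H e[OF that]] .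
  have "inj_on f {0..<t}"
  proof (rule inj_onI)
    fix i j assume "i \<in> {0..<t}" "j \<in> {0..<t}" "f i = f j"
    then show "i = j" using inj r(3)[of i] r(3)[of j]
      by (cases "i = 0"; cases "j = 0") (auto simp: f_def inj_on_def)
  qed
  moreover have "f ` {0..<t} \<subseteq> verts H" using r(1)[of 1] r(2) t by (auto simp: f_def)
  moreover have "f ` {0, i, if i = t - 1 then 1 else i + 1} \<in> edges H" if "i \<in> {1..t - 1}" for i
    using e[of i] that t by (auto simp: f_def insert_commute)
  ultimately show ?thesis unfolding contains_wheel_iff by blast
qed

lemma alternating_enumeration:
  assumes XY: "card X = k" "card Y = k" "X \<inter> Y = {}" and k: "0 < k"
  obtains r :: "nat \<Rightarrow> 'v" where "inj_on r {1..2 * k}"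
    "\<And>j. j \<in> {1..2 * k} \<Longrightarrow> odd j \<Longrightarrow> r j \<in> X" "\<And>j. j \<in> {1..2 * k} \<Longrightarrow> even j \<Longrightarrow> r j \<in> Y"
proof -
  have fin: "finite X" "finite Y" using XY k by (metis card_gt_0_iff)+
  obtain x where x: "bij_betw x {..<k} X"
    using ex_bij_betw_nat_finite[OF fin(1)] XY by (auto simp: atLeast0LessThan)
  obtain y where y: "bij_betw y {..<k} Y"
    using ex_bij_betw_nat_finite[OF fin(2)] XY by (auto simp: atLeast0LessThan)
  define r where "r j = (if odd j then x (j div 2) else y (j div 2 - 1))" for j
  have idx: "odd j \<Longrightarrow> j div 2 < k" "even j \<Longrightarrow> j div 2 - 1 < k" if "j \<in> {1..2 * k}" for j
    using that k by (simp, presburger)+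
  have X: "r j \<in> X" if "j \<in> {1..2 * k}" "odd j" for j
    using idx(1)[OF that] that(2) bij_betwE[OF x] by (simp add: r_def)
  have Y: "r j \<in> Y" if "j \<in> {1..2 * k}" "even j" for j
    using idx(2)[OF that] that(2) bij_betwE[OF y] by (simp add: r_def)
  have "inj_on r {1..2 * k}"
  proof (rule inj_onI)
    fix i j assume ij: "i \<in> {1..2 * k}" "j \<in> {1..2 * k}" "r i = r j"
    have parity: "even i \<longleftrightarrow> even j" using ij X[of i] X[of j] Y[of i] Y[of j] XY(3) by (metis disjoint_iff)
    show "i = j"
    proof (cases "even i")
      case True
      then have "y (i div 2 - 1) = y (j div 2 - 1)" using ij(3) parity by (simp add: r_def)
      then have "i div 2 - 1 = j div 2 - 1"
        using y idx(2)[OF ij(1)] idx(2)[OF ij(2)] True parity by (auto simp: bij_betw_def inj_on_def)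
      then show ?thesis using True parity ij by (auto elim!: evenE)
    next
      case False
      then have "x (i div 2) = x (j div 2)" using ij(3) parity by (simp add: r_def)
      then have "i div 2 = j div 2"
        using x idx(1)[OF ij(1)] idx(1)[OF ij(2)] False parity by (auto simp: bij_betw_def inj_on_def)
      then show ?thesis using False parity by (auto elim!: oddE)
    qed
  qed
  then show ?thesis using that X Y by blast
qed

text \<open>The rim is the alternating cycle through \<open>X\<close> and \<open>Y\<close>. For
  \<open>k = 1\<close> it degenerates to a single pair, in accordance with the wheel on three
  vertices.\<close>

lemma contains_odd_wheel:
  assumes H: "three_graph H" and k: "0 < k" and XY: "card X = k" "card Y = k"
    and e: "\<And>x y. x \<in> X \<Longrightarrow> y \<in> Y \<Longrightarrow> {v,x,y} \<in> edges H"
  shows "contains_copy H (wheel (2 * k + 1))"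
proof -
  have disj: "X \<inter> Y = {}" using three_graph_edge(5)[OF H e] by blast
  obtain r where r: "inj_on r {1..2 * k}" "\<And>j. j \<in> {1..2 * k} \<Longrightarrow> odd j \<Longrightarrow> r j \<in> X"
    "\<And>j. j \<in> {1..2 * k} \<Longrightarrow> even j \<Longrightarrow> r j \<in> Y"
    using alternating_enumeration[OF XY disj k] by blast
  show ?thesis
  proof (rule contains_wheelI[OF H])
    show "inj_on r {1..<2 * k + 1}" by (rule inj_on_subset[OF r(1)]) auto
    fix i assume i: "1 \<le> i" "i < 2 * k + 1"
    define j where "j = (if i = 2 * k + 1 - 1 then 1 else i + 1)"
    have ij: "i \<in> {1..2 * k}" "j \<in> {1..2 * k}" "even j \<longleftrightarrow> odd i" using i by (auto simp: j_def)
    have "{v, r i, r j} \<in> edges H"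
    proof (cases "even i")
      case True
      then show ?thesis using e[OF r(2)[of j] r(3)[of i]] ij by (simp add: insert_commute)
    next
      case False
      then show ?thesis using e[OF r(2)[of i] r(3)[of j]] ij by simp
    qed
    then show "{v, r i, r (if i = 2 * k + 1 - 1 then 1 else i + 1)} \<in> edges H" unfolding j_def .
  qed (use k in simp)
qed

text \<open>The alternating path through \<open>X\<close> and \<open>Y\<close> has an end in each;
  \<open>u\<close> is joined to both ends in the link of \<open>v\<close> and closes an odd rim.
  Hence \<open>s\<close> is \<open>r\<close> shifted by one place, with \<open>u\<close> in
  front.\<close>

lemma contains_even_wheel:
  assumes H: "three_graph H" and k: "0 < k" and XY: "card X = k" "card Y = k"
    and e: "\<And>x y. x \<in> X \<Longrightarrow> y \<in> Y \<Longrightarrow> {v,u,x} \<in> edges H \<and> {v,x,y} \<in> edges H \<and> {v,u,y} \<in> edges H"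
  shows "contains_copy H (wheel (2 * k + 2))"
proof -
  have disj: "X \<inter> Y = {}" using three_graph_edge(5)[OF H] e by blast
  obtain r where r: "inj_on r {1..2 * k}" "\<And>j. j \<in> {1..2 * k} \<Longrightarrow> odd j \<Longrightarrow> r j \<in> X"
    "\<And>j. j \<in> {1..2 * k} \<Longrightarrow> even j \<Longrightarrow> r j \<in> Y"
    using alternating_enumeration[OF XY disj k] by blast
  obtain a b where ab: "a \<in> X" "b \<in> Y" using XY k by (metis card.empty equals0I less_irrefl)
  have cone: "{v, u, r j} \<in> edges H" if "j \<in> {1..2 * k}" for j
    using e[OF r(2)[of j] ab(2)] e[OF ab(1) r(3)[of j]] that by (cases "even j") auto
  define s where "s j = (if j = 1 then u else r (j - 1))" for j
  show ?thesis
  proof (rule contains_wheelI[OF H])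
    show "inj_on s {1..<2 * k + 2}"
    proof (rule inj_onI)
      fix i j assume ij: "i \<in> {1..<2 * k + 2}" "j \<in> {1..<2 * k + 2}" "s i = s j"
      have prev: "l - 1 \<in> {1..2 * k}" if "l \<in> {1..<2 * k + 2}" "l \<noteq> 1" for l
        using that unfolding atLeastAtMost_iff atLeastLessThan_iff by linarith
      have ne: "u \<noteq> r (l - 1)" if "l \<in> {1..<2 * k + 2}" "l \<noteq> 1" for l
        using three_graph_edge(5)[OF H cone[OF prev[OF that]]] .
      have "i - 1 = j - 1" if "i \<noteq> 1" "j \<noteq> 1"
        by (rule inj_onD[OF r(1) _ prev[OF ij(1) that(1)] prev[OF ij(2) that(2)]]) (use ij that in \<open>simp add: s_def\<close>)
      then show "i = j" using ij ne[of i] ne[of j] by (cases "i = 1"; cases "j = 1") (auto simp: s_def)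
    qed
    fix i assume i: "1 \<le> i" "i < 2 * k + 2"
    consider "i = 1" | "i = 2 * k + 1" "i \<noteq> 1" | "2 \<le> i" "i < 2 * k + 1" using i by linarith
    then show "{v, s i, s (if i = 2 * k + 2 - 1 then 1 else i + 1)} \<in> edges H"
    proof cases
      case 1
      then show ?thesis using cone[of 1] k by (simp add: s_def)
    next
      case 2
      then show ?thesis using cone[of "2 * k"] k by (simp add: s_def insert_commute)
    next
      case 3
      then have j: "i - 1 \<in> {1..2 * k}" "i \<in> {1..2 * k}" "even (i - 1) \<longleftrightarrow> odd i" by auto
      have "{v, r (i - 1), r i} \<in> edges H"
      proof (cases "even i")
        case True
        then show ?thesis using e[OF r(2)[of "i - 1"] r(3)[of i]] j by simp
      next
        case False
        then show ?thesis using e[OF r(2)[of i] r(3)[of "i - 1"]] j by (simp add: insert_commute)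
      qed
      then show ?thesis using 3 by (simp add: s_def)
    qed
  qed (use k in simp)
qed

section \<open>Cyclic triangles of a quasirandom tournament\<close>

text \<open>The block structure is the doubling \<open>A \<mapsto> [[A, A], [- A\<^sup>T, A\<^sup>T]]\<close>, which preserves
  \<open>A + A\<^sup>T = 2 I\<close> and \<open>A A\<^sup>T = n I\<close>.\<close>

primrec skew_hadamard :: "nat \<Rightarrow> nat \<Rightarrow> nat \<Rightarrow> real" where
  "skew_hadamard 0 x y = 1"
| "skew_hadamard (Suc k) x y =
    (if x < 2^k then (if y < 2^k then skew_hadamard k x y else skew_hadamard k x (y - 2^k))
     else (if y < 2^k then - skew_hadamard k y (x - 2^k) else skew_hadamard k (y - 2^k) (x - 2^k)))"

lemma skew_hadamard_values: "skew_hadamard k x y = 1 \<or> skew_hadamard k x y = -1"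
proof (induction k arbitrary: x y)
  case (Suc k)
  show ?case using Suc[of x y] Suc[of x "y - 2^k"] Suc[of y "x - 2^k"] Suc[of "y - 2^k" "x - 2^k"] by auto
qed simp

lemma skew_hadamard_skew:
  "x < 2^k \<Longrightarrow> y < 2^k \<Longrightarrow> skew_hadamard k x y + skew_hadamard k y x = (if x = y then 2 else 0)"
proof (induction k arbitrary: x y)
  case (Suc k)
  have "x - 2^k < 2^k" "y - 2^k < 2^k" using Suc.prems by auto
  moreover have "x - 2^k = y - 2^k \<longleftrightarrow> x = y" if "\<not> x < 2^k" "\<not> y < 2^k" using that by auto
  ultimately show ?case
    using Suc.IH[of x y] Suc.IH[of "x - 2^k" "y - 2^k"] Suc.prems
    by (cases "x < 2^k"; cases "y < 2^k") auto
qed simp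

lemma sum_double: "(\<Sum>z<2 * N. f z) = (\<Sum>z<N. f z) + (\<Sum>z<(N::nat). f (z + N) :: real)"
proof -
  have "{..<2 * N} = {..<N} \<union> {N..<2 * N}" by auto
  then have "(\<Sum>z<2 * N. f z) = (\<Sum>z<N. f z) + (\<Sum>z\<in>{N..<2 * N}. f z)"
    by (simp add: sum.union_disjoint ivl_disj_int)
  also have "(\<Sum>z\<in>{N..<2 * N}. f z) = (\<Sum>z<N. f (z + N))"
    using sum.shift_bounds_nat_ivl[of f 0 N N] by (simp add: atLeast0LessThan mult_2)
  finally show ?thesis .
qed

text \<open>With \<open>A\<close> the matrix and \<open>A'\<close> its transpose,
  \<open>A' = 2 I - A\<close> commutes with \<open>A\<close>, so the row and column Gram matrices
  coincide.\<close>

lemma skew_hadamard_rows_imp_columns: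
  assumes rows: "\<And>x y. x < 2^k \<Longrightarrow> y < 2^k \<Longrightarrow> (\<Sum>z<2^k. skew_hadamard k x z * skew_hadamard k y z) = (if x = y then 2^k else 0)"
    and xy: "x < 2^k" "y < 2^k"
  shows "(\<Sum>z<2^k. skew_hadamard k z x * skew_hadamard k z y) = (if x = y then 2^k else 0)"
proof -
  let ?a = "skew_hadamard k"
  have col: "?a z u = (if z = u then 2 else 0) - ?a u z" if "z < 2^k" "u < 2^k" for z u
    using skew_hadamard_skew[OF that] by simp
  have "(\<Sum>z<2^k. ?a z x * ?a z y)
      = (\<Sum>z<2^k. ((if z = x then 2 else 0) - ?a x z) * ((if z = y then 2 else 0) - ?a y z))"
    using xy by (intro sum.cong refl arg_cong2[where f="(*)"] col) auto
  also have "\<dots> = (\<Sum>z<2^k. (if z = x then (if x = y then 4 else 0) else 0) - (if z = x then 2 * ?a y x else 0)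
      - (if z = y then 2 * ?a x y else 0) + ?a x z * ?a y z)"
    by (intro sum.cong refl) (auto simp: algebra_simps)
  also have "\<dots> = (if x = y then 4 else 0) - 2 * ?a y x - 2 * ?a x y + (if x = y then 2^k else 0)"
    using xy rows by (simp add: sum.distrib sum_subtractf)
  also have "\<dots> = (if x = y then 2^k else 0)" using skew_hadamard_skew[OF xy] by (auto simp: algebra_simps)
  finally show ?thesis .
qed

text \<open>The lower blocks are transposes, so their rows are columns of the smaller matrix;
  products of an upper with a lower row cancel between the two blocks.\<close>

lemma skew_hadamard_rows:
  "x < 2^k \<Longrightarrow> y < 2^k \<Longrightarrow> (\<Sum>z<2^k. skew_hadamard k x z * skew_hadamard k y z) = (if x = y then 2^k else 0)"
proof (induction k arbitrary: x y)
  case (Suc k)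
  let ?a = "skew_hadamard k"
  have cols: "(\<Sum>z<2^k. ?a z u * ?a z w) = (if u = w then 2^k else 0)" if "u < 2^k" "w < 2^k" for u w
    using Suc.IH that by (rule skew_hadamard_rows_imp_columns)
  have x': "x - 2^k < 2^k" "y - 2^k < 2^k" using Suc.prems by auto
  have x'_eq: "x - 2^k = y - 2^k \<longleftrightarrow> x = y" if "\<not> x < 2^k" "\<not> y < 2^k" using that by auto
  have "(\<Sum>z<2^Suc k. skew_hadamard (Suc k) x z * skew_hadamard (Suc k) y z)
    = (\<Sum>z<2^k. skew_hadamard (Suc k) x z * skew_hadamard (Suc k) y z)
      + (\<Sum>z<2^k. skew_hadamard (Suc k) x (z + 2^k) * skew_hadamard (Suc k) y (z + 2^k))"
    by (simp only: power_Suc sum_double)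
  also have "\<dots> = (if x = y then 2^Suc k else 0)"
    using Suc.IH[of x y] cols[OF x'] Suc.prems x' x'_eq
    by (cases "x < 2^k"; cases "y < 2^k") (auto simp: sum_negf)
  finally show ?case .
qed simp

lemmas skew_hadamard_columns = skew_hadamard_rows_imp_columns[OF skew_hadamard_rows]

text \<open>Parseval's identity for the indicator of \<open>U\<close>, from orthogonality of the
  columns. It supplies the quasirandomness.\<close>

lemma skew_hadamard_square_sum:
  assumes "U \<subseteq> {..<2^k}"
  shows "(\<Sum>v<2^k. (\<Sum>y\<in>U. skew_hadamard k v y)\<^sup>2) = 2^k * real (card U)"
proof -
  have fU: "finite U" using assms finite_subset by blast
  have "(\<Sum>v<2^k. (\<Sum>y\<in>U. skew_hadamard k v y)\<^sup>2)
    = (\<Sum>v<2^k. \<Sum>y\<in>U. \<Sum>y'\<in>U. skew_hadamard k v y * skew_hadamard k v y')"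
    by (simp add: power2_eq_square sum_product)
  also have "\<dots> = (\<Sum>y\<in>U. \<Sum>v<2^k. \<Sum>y'\<in>U. skew_hadamard k v y * skew_hadamard k v y')" by (rule sum.swap)
  also have "\<dots> = (\<Sum>y\<in>U. \<Sum>y'\<in>U. \<Sum>v<2^k. skew_hadamard k v y * skew_hadamard k v y')"
    by (rule sum.cong[OF refl], rule sum.swap)
  also have "\<dots> = (\<Sum>y\<in>U. \<Sum>y'\<in>U. if y = y' then 2^k else 0)"
    using assms by (intro sum.cong refl skew_hadamard_columns) auto
  also have "\<dots> = 2^k * real (card U)" using fU by simp
  finally show ?thesis .
qed

text \<open>Off the diagonal the matrix is skew, so its signs orient the complete graph; edges are
  the directed triangles. Ranging over all orderings of \<open>e\<close> is consistent, since
  reversing a directed triangle negates all three signs.\<close>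

definition cyclic_triangles :: "nat \<Rightarrow> nat hypergraph" where
  "cyclic_triangles k = ({..<2^k}, {e \<in> [{..<2^k}]\<^bsup>3\<^esup>. \<forall>x\<in>e. \<forall>y\<in>e. \<forall>z\<in>e. x \<noteq> y \<longrightarrow> y \<noteq> z \<longrightarrow> x \<noteq> z \<longrightarrow>
     skew_hadamard k x y = skew_hadamard k y z})"

lemma three_graph_cyclic_triangles: "three_graph (cyclic_triangles k)"
  by (auto simp: three_graph_def cyclic_triangles_def)

lemma cyclic_triangles_edge:
  assumes "x < 2^k" "y < 2^k" "z < 2^k" "x \<noteq> y" "y \<noteq> z" "x \<noteq> z"
  shows "{x,y,z} \<in> edges (cyclic_triangles k) \<longleftrightarrow>
    skew_hadamard k x y = skew_hadamard k y z \<and> skew_hadamard k y z = skew_hadamard k z x"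
proof -
  have "skew_hadamard k y x = - skew_hadamard k x y" "skew_hadamard k z y = - skew_hadamard k y z"
    "skew_hadamard k x z = - skew_hadamard k z x"
    using skew_hadamard_skew[of x k y] skew_hadamard_skew[of y k z] skew_hadamard_skew[of z k x] assms by auto
  then show ?thesis using assms by (auto simp: cyclic_triangles_def nsets_def)
qed

lemma cyclic_triangles_free_of_even_wheel:
  assumes t: "even t" "3 \<le> t"
  shows "free_of (wheel t) (cyclic_triangles k)"
  unfolding free_of_def
proof
  assume "contains_copy (cyclic_triangles k) (wheel t)"
  then obtain f where f: "\<And>i. i \<in> {1..t - 1} \<Longrightarrow> f ` {0, i, if i = t - 1 then 1 else i + 1} \<in> edges (cyclic_triangles k)"
    unfolding contains_wheel_iff by blast
  let ?a = "\<lambda>i. skew_hadamard k (f 0) (f i)"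
  have flip: "?a j = - ?a i" if "{f 0, f i, f j} \<in> edges (cyclic_triangles k)" for i j
  proof -
    have c: "{f 0, f i, f j} \<subseteq> {..<2^k}" "card {f 0, f i, f j} = 3"
      using that by (auto simp: cyclic_triangles_def nsets_def)
    then have d: "f 0 \<noteq> f i" "f i \<noteq> f j" "f 0 \<noteq> f j" by (auto simp: card_insert_if split: if_splits)
    have "skew_hadamard k (f 0) (f i) = skew_hadamard k (f j) (f 0)"
      using cyclic_triangles_edge[of "f 0" k "f i" "f j"] that c d by auto
    moreover have "skew_hadamard k (f j) (f 0) = - skew_hadamard k (f 0) (f j)"
      using skew_hadamard_skew[of "f j" k "f 0"] c d by auto
    ultimately show ?thesis by simp
  qed
  have "?a (Suc i) = (-1) ^ i * ?a 1" if "Suc i \<le> t - 1" for i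
    using that
  proof (induction i)
    case (Suc i)
    have "f ` {0, Suc i, if Suc i = t - 1 then 1 else Suc i + 1} \<in> edges (cyclic_triangles k)"
      using Suc.prems by (intro f) auto
    then have "{f 0, f (Suc i), f (Suc (Suc i))} \<in> edges (cyclic_triangles k)" using Suc.prems by simp
    from flip[OF this] show ?case using Suc by simp
  qed simp
  from this[of "t - 2"] have "?a (t - 1) = (-1) ^ (t - 2) * ?a 1" using t by (simp add: Suc_diff_Suc numeral_2_eq_2)
  then have "?a (t - 1) = ?a 1" using t by simp
  moreover have "f ` {0, t - 1, if t - 1 = t - 1 then 1 else t - 1 + 1} \<in> edges (cyclic_triangles k)"
    using t by (intro f) auto
  then have "?a 1 = - ?a (t - 1)" by (intro flip) simp
  ultimately show False using skew_hadamard_values[of k "f 0" "f 1"] by auto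
qed

text \<open>The deviation is quadratic in the number \<open>N\<close> of vertices, while a cubic
  error is allowed; \<open>N \<ge> 1 / \<mu>\<close> absorbs it.\<close>

lemma cyclic_triangles_dense:
  assumes \<mu>: "0 < \<mu>" and k: "1 / \<mu> \<le> 2^k"
  shows "mu_dense (1/4) \<mu> (cyclic_triangles k)"
  unfolding mu_dense_def
proof (intro allI impI)
  fix U assume "U \<subseteq> verts (cyclic_triangles k)"
  then have U: "U \<subseteq> {..<2^k}" by (simp add: cyclic_triangles_def)
  then have fU: "finite U" using finite_subset by blast
  define E where "E = edges (cyclic_triangles k)"
  define N where "N = (2::real)^k"
  have cU: "real (card U) \<le> N"
  proof -
    have "card U \<le> 2^k" using card_mono[OF _ U] by simp
    then show ?thesis unfolding N_def by (metis of_nat_le_iff of_nat_numeral of_nat_power)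
  qed
  \<comment> \<open>Clearing the diagonal makes the matrix exactly skew, so sums may run over
    degenerate triples as well.\<close>
  define b where "b x y = (if x = y then 0 else skew_hadamard k x y)" for x y
  have less: "x < 2^k" if "x \<in> U" for x using U that by auto
  have b_skew: "b y x = - b x y" if "x \<in> U" "y \<in> U" for x y
    using skew_hadamard_skew[OF less[OF that(1)] less[OF that(2)]] by (auto simp: b_def)
  define S where "S = (\<Sum>y\<in>U. (\<Sum>x\<in>U. b y x)\<^sup>2)"
  have S: "S \<le> 4 * N\<^sup>2"
  proof -
    have "(\<Sum>x\<in>U. b y x)\<^sup>2 \<le> 2 * (\<Sum>x\<in>U. skew_hadamard k y x)\<^sup>2 + 2" if y: "y \<in> U" for y
    proof -
      have diag: "skew_hadamard k y y = 1" using skew_hadamard_skew[OF less[OF y] less[OF y]] by simp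
      have "(\<Sum>x\<in>U. b y x) = (\<Sum>x\<in>U. skew_hadamard k y x - (if x = y then 1 else 0))"
        using diag by (intro sum.cong) (auto simp: b_def)
      also have "\<dots> = (\<Sum>x\<in>U. skew_hadamard k y x) - 1" using y fU by (simp add: sum_subtractf)
      finally have eq: "(\<Sum>x\<in>U. b y x) = (\<Sum>x\<in>U. skew_hadamard k y x) - 1" .
      have "(s - 1)\<^sup>2 \<le> 2 * s\<^sup>2 + 2" for s :: real
        using zero_le_power2[of "s + 1"] by (simp add: power2_eq_square algebra_simps)
      then show ?thesis unfolding eq .
    qed
    then have "S \<le> (\<Sum>y\<in>U. 2 * (\<Sum>x\<in>U. skew_hadamard k y x)\<^sup>2 + 2)" unfolding S_def by (rule sum_mono)
    also have "\<dots> = 2 * (\<Sum>y\<in>U. (\<Sum>x\<in>U. skew_hadamard k y x)\<^sup>2) + 2 * real (card U)"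
      by (simp add: sum.distrib sum_distrib_left)
    also have "(\<Sum>y\<in>U. (\<Sum>x\<in>U. skew_hadamard k y x)\<^sup>2) \<le> (\<Sum>y<2^k. (\<Sum>x\<in>U. skew_hadamard k y x)\<^sup>2)"
      using U by (intro sum_mono2) auto
    also have "\<dots> = N * real (card U)" using skew_hadamard_square_sum[OF U] by (simp add: N_def)
    finally have "S \<le> 2 * (N * real (card U)) + 2 * real (card U)" by simp
    also have "\<dots> \<le> 2 * (N * N) + 2 * (N * N)"
    proof -
      have "1 \<le> N" by (simp add: N_def)
      then have "real (card U) \<le> N * N" using cU mult_mono[of 1 N "real (card U)" N] by simp
      moreover have "N * real (card U) \<le> N * N" using cU \<open>1 \<le> N\<close> by (intro mult_left_mono) auto
      ultimately show ?thesis by linarith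
    qed
    finally show ?thesis by (simp add: power2_eq_square)
  qed
  \<comment> \<open>Reversing the first arc of a path turns each inner sum into minus the square of
    a row sum. The other two products are the same sum with the variables renamed.\<close>
  have path: "(\<Sum>x\<in>U. \<Sum>y\<in>U. \<Sum>z\<in>U. b x y * b y z) = - S"
  proof -
    have "(\<Sum>x\<in>U. \<Sum>y\<in>U. \<Sum>z\<in>U. b x y * b y z) = (\<Sum>y\<in>U. \<Sum>x\<in>U. \<Sum>z\<in>U. b x y * b y z)" by (rule sum.swap)
    also have "\<dots> = (\<Sum>y\<in>U. \<Sum>x\<in>U. \<Sum>z\<in>U. - (b y x * b y z))"
    proof (intro sum.cong refl)
      fix x y z assume "y \<in> U" "x \<in> U"
      then show "b x y * b y z = - (b y x * b y z)" using b_skew[of y x] by simp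
    qed
    also have "\<dots> = - S" by (simp add: S_def power2_eq_square sum_product sum_negf)
    finally show ?thesis .
  qed
  let ?D = "\<lambda>x y z. x \<noteq> y \<and> y \<noteq> z \<and> x \<noteq> z"
  have "6 * real (card ([U]\<^bsup>3\<^esup> \<inter> E)) = 6 * (\<Sum>e\<in>[U]\<^bsup>3\<^esup>. of_bool (e \<in> E))"
    using finite_imp_finite_nsets[OF fU] by simp
  also have "\<dots> = (\<Sum>x\<in>U. \<Sum>y\<in>U. \<Sum>z\<in>U. of_bool (?D x y z) * of_bool ({x,y,z} \<in> E))"
    by (rule sum_ordered_triples[OF fU, symmetric])
  also have "\<dots> \<ge> (\<Sum>x\<in>U. \<Sum>y\<in>U. \<Sum>z\<in>U. of_bool (?D x y z) / 4 + (b x y * b y z) / 4 + (b y z * b z x) / 4 + (b z x * b x y) / 4)"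
  proof (intro sum_mono)
    fix x y z assume xyz: "x \<in> U" "y \<in> U" "z \<in> U"
    \<comment> \<open>three signs \<open>p, q, r\<close> are equal with indicator \<open>(1 + p q + q r + r p) / 4\<close>\<close>
    have pm: "b x y = 1 \<or> b x y = -1" if "x \<noteq> y" for x y using that skew_hadamard_values by (simp add: b_def)
    show "of_bool (?D x y z) / 4 + (b x y * b y z) / 4 + (b y z * b z x) / 4 + (b z x * b x y) / 4
      \<le> (of_bool (?D x y z) * of_bool ({x,y,z} \<in> E) :: real)"
    proof (cases "?D x y z")
      case True
      have "{x,y,z} \<in> E \<longleftrightarrow> b x y = b y z \<and> b y z = b z x"
        using cyclic_triangles_edge[of x k y z] True less[OF xyz(1)] less[OF xyz(2)] less[OF xyz(3)]
        by (simp add: E_def b_def)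
      then show ?thesis using True pm[of x y] pm[of y z] pm[of z x] by auto
    next
      case False
      \<comment> \<open>On a degenerate triple only one product can survive, and skewness makes it
        minus a square, so the lower bound stays valid.\<close>
      then consider "x = y" | "y = z" | "x = z" by blast
      then show ?thesis
      proof cases
        case 1
        then show ?thesis using b_skew[of x z] xyz by (simp add: b_def[of x x])
      next
        case 2
        then show ?thesis using b_skew[of x y] xyz by (simp add: b_def[of y y])
      next
        case 3
        then show ?thesis using b_skew[of x y] xyz by (simp add: b_def[of x x])
      qed
    qed
  qed
  also have "(\<Sum>x\<in>U. \<Sum>y\<in>U. \<Sum>z\<in>U. of_bool (?D x y z) / 4 + (b x y * b y z) / 4 + (b y z * b z x) / 4 + (b z x * b x y) / 4)
    = (\<Sum>x\<in>U. \<Sum>y\<in>U. \<Sum>z\<in>U. of_bool (?D x y z)) / 4 + (\<Sum>x\<in>U. \<Sum>y\<in>U. \<Sum>z\<in>U. b x y * b y z) / 4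
     + (\<Sum>x\<in>U. \<Sum>y\<in>U. \<Sum>z\<in>U. b y z * b z x) / 4 + (\<Sum>x\<in>U. \<Sum>y\<in>U. \<Sum>z\<in>U. b z x * b x y) / 4"
    by (simp only: sum.distrib sum_divide_distrib)
  also have "(\<Sum>x\<in>U. \<Sum>y\<in>U. \<Sum>z\<in>U. b y z * b z x) = - S"
  proof -
    have "(\<Sum>x\<in>U. \<Sum>y\<in>U. \<Sum>z\<in>U. b y z * b z x) = (\<Sum>y\<in>U. \<Sum>x\<in>U. \<Sum>z\<in>U. b y z * b z x)" by (rule sum.swap)
    also have "\<dots> = (\<Sum>y\<in>U. \<Sum>z\<in>U. \<Sum>x\<in>U. b y z * b z x)" by (rule sum.cong[OF refl], rule sum.swap)
    finally show ?thesis using path by simp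
  qed
  also have "(\<Sum>x\<in>U. \<Sum>y\<in>U. \<Sum>z\<in>U. b z x * b x y) = - S"
  proof -
    have "(\<Sum>x\<in>U. \<Sum>y\<in>U. \<Sum>z\<in>U. b z x * b x y) = (\<Sum>x\<in>U. \<Sum>z\<in>U. \<Sum>y\<in>U. b z x * b x y)"
      by (rule sum.cong[OF refl], rule sum.swap)
    also have "\<dots> = (\<Sum>z\<in>U. \<Sum>x\<in>U. \<Sum>y\<in>U. b z x * b x y)" by (rule sum.swap)
    finally show ?thesis using path by simp
  qed
  also have "(\<Sum>x\<in>U. \<Sum>y\<in>U. \<Sum>z\<in>U. of_bool (?D x y z)) = 6 * real (card U choose 3)"
    using sum_ordered_triples[OF fU, of "\<lambda>_. 1"] by simp
  finally have "6 * real (card U choose 3) / 4 - 3 * S / 4 \<le> 6 * real (card ([U]\<^bsup>3\<^esup> \<inter> E))" using path by simp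
  then have "1/4 * real (card U choose 3) - N\<^sup>2 \<le> real (card ([U]\<^bsup>3\<^esup> \<inter> E))" using S zero_le_power2[of N] by linarith
  moreover have "N\<^sup>2 \<le> \<mu> * N ^ 3"
  proof -
    have "1 \<le> \<mu> * N" using \<mu> k by (simp add: N_def field_simps)
    then have "1 * N\<^sup>2 \<le> \<mu> * N * N\<^sup>2" by (intro mult_right_mono) auto
    then show ?thesis by (simp add: power2_eq_square power3_eq_cube mult.assoc)
  qed
  moreover have "real (card (verts (cyclic_triangles k))) = N" by (simp add: cyclic_triangles_def N_def)
  ultimately show "1/4 * real (card U choose 3) - \<mu> * real (card (verts (cyclic_triangles k))) ^ 3
    \<le> real (card ([U]\<^bsup>3\<^esup> \<inter> edges (cyclic_triangles k)))" by (simp add: E_def)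
qed

section \<open>The uniform Turan density of wheels\<close>

definition attained_density :: "'b hypergraph \<Rightarrow> real \<Rightarrow> bool" where
  "attained_density F d \<longleftrightarrow> d \<in> {0..1} \<and> (\<forall>\<mu>>0. \<forall>n\<^sub>0::nat. \<exists>H :: nat hypergraph.
     three_graph H \<and> free_of F H \<and> mu_dense d \<mu> H \<and> card (verts H) \<ge> n\<^sub>0)"

text \<open>In both cases of the theorem the supremum is attained, so it is treated as a
  maximum.\<close>

lemma uniform_turan_densityI:
  assumes "attained_density F d" "\<And>d'. attained_density F d' \<Longrightarrow> d' \<le> d"
  shows "uniform_turan_density F = d"
  unfolding uniform_turan_density_def
  by (rule cSup_eq_maximum) (use assms in \<open>auto simp: attained_density_def\<close>)

lemma exists_ge_average:
  fixes g :: "'v \<Rightarrow> real"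
  assumes "finite V" "V \<noteq> {}" "c * real (card V) \<le> sum g V"
  shows "\<exists>x\<in>V. c \<le> g x"
proof (rule ccontr)
  assume "\<not> ?thesis"
  then have "sum g V < (\<Sum>x\<in>V. c)" using assms by (intro sum_strict_mono) auto
  then show False using assms by (simp add: mult.commute)
qed

lemma obtain_large_nat:
  obtains n :: nat where "n \<ge> n\<^sub>0" "real n > a" "real n \<ge> b"
proof -
  obtain m where m: "max a b < real m" using reals_Archimedean2 by blast
  show ?thesis by (rule that[of "max n\<^sub>0 m"]) (use m in auto)
qed

lemma attained_density_even_wheel_le:
  assumes t: "even t" "3 \<le> t" and d: "attained_density (wheel t) d"
  shows "d \<le> 1/4"
proof (rule ccontr)
  assume "\<not> d \<le> 1/4"
  define \<epsilon> where "\<epsilon> = d - 1/4"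
  have \<epsilon>: "0 < \<epsilon>" "\<epsilon> \<le> 3/4" "1/4 + \<epsilon> = d" using d \<open>\<not> d \<le> 1/4\<close> by (auto simp: \<epsilon>_def attained_density_def)
  obtain k where k: "t = 2 * k + 2" "0 < k"
  proof -
    obtain j where "t = 2 * j" using t by (auto elim: evenE)
    then show ?thesis using t that[of "j - 1"] by auto
  qed
  obtain \<tau> \<mu> n\<^sub>0 where \<tau>: "0 < \<tau>" and \<mu>: "0 < \<mu>" and many: "\<And>H::nat hypergraph. three_graph H \<Longrightarrow> mu_dense d \<mu> H \<Longrightarrow> n\<^sub>0 \<le> card (verts H) \<Longrightarrow>
    (\<exists>x. \<tau> * real (card (verts H)) ^ 3 < triangle_count (\<lambda>y z. {x,y,z} \<in> edges H) (verts H))"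
    using dense_link_has_many_triangles[OF \<epsilon>(1,2), where ?'v=nat] unfolding \<epsilon>(3) by blast
  obtain n where n: "n \<ge> n\<^sub>0 + 1" "real n > (2 * real k / \<tau>) ^ Suc k" "real n \<ge> 2 * real k / \<tau>"
    by (rule obtain_large_nat)
  obtain H :: "nat hypergraph" where H: "three_graph H" "free_of (wheel t) H" "mu_dense d \<mu> H" "n \<le> card (verts H)"
    using d \<mu> unfolding attained_density_def by blast
  define V where "V = verts H"
  have V: "finite V" "V \<noteq> {}" using H n by (auto simp: three_graph_def V_def)
  obtain x where x: "\<tau> * real (card V) ^ 3 < triangle_count (\<lambda>y z. {x,y,z} \<in> edges H) V"
    using many[OF H(1,3)] H(4) n unfolding V_def by auto
  \<comment> \<open>Triangles in the link of \<open>x\<close>, with the corner \<open>y\<close>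
    singled out: averaging fixes \<open>y\<close>, and \<open>R y\<close> is then a dense
    relation.\<close>
  define R where "R y z w \<longleftrightarrow> {x,y,z} \<in> edges H \<and> {x,z,w} \<in> edges H \<and> {x,y,w} \<in> edges H" for y z w
  have "\<tau> * (real (card V))\<^sup>2 * real (card V) \<le> (\<Sum>y\<in>V. edge_count (R y) V V)"
    using x by (simp add: triangle_count_def edge_count_def R_def power2_eq_square power3_eq_cube mult.assoc)
  then obtain y where y: "\<tau> * (real (card V))\<^sup>2 \<le> edge_count (R y) V V"
    using exists_ge_average[OF V] by blast
  obtain X Y where XY: "card X = k" "card Y = k" "\<And>z w. z \<in> X \<Longrightarrow> w \<in> Y \<Longrightarrow> R y z w"
    by (rule kovari_sos_turan[OF V(1) k(2) \<tau> _ _ y]) (use n H(4) in \<open>auto simp: V_def\<close>)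
  have "contains_copy H (wheel (2 * k + 2))"
    by (rule contains_even_wheel[OF H(1) k(2) XY(1,2), of x y]) (use XY(3) in \<open>auto simp: R_def\<close>)
  then show False using H(2) by (simp add: free_of_def k)
qed

lemma attained_density_odd_wheel_le:
  assumes t: "odd t" "3 \<le> t" and d: "attained_density (wheel t) d"
  shows "d \<le> 0"
proof (rule ccontr)
  assume "\<not> d \<le> 0"
  then have d0: "0 < d" by simp
  obtain k where k: "t = 2 * k + 1" "0 < k" using t by (auto elim!: oddE)
  \<comment> \<open>With \<open>N\<close> vertices there are at least \<open>(N/3)^3\<close>
    triples; a density error of \<open>d/54\<close> leaves \<open>d/54 * N^3\<close> edges, and
    their six orderings give \<open>d/9\<close>.\<close>
  define \<delta> where "\<delta> = d / 9"
  have \<delta>: "0 < \<delta>" using d0 by (simp add: \<delta>_def)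
  obtain n where n: "n \<ge> 3" "real n > (2 * real k / \<delta>) ^ Suc k" "real n \<ge> 2 * real k / \<delta>"
    by (rule obtain_large_nat)
  have "0 < d / 54" using d0 by simp
  then obtain H :: "nat hypergraph" where H: "three_graph H" "free_of (wheel t) H" "mu_dense d (d / 54) H" "n \<le> card (verts H)"
    using d unfolding attained_density_def by blast
  define V where "V = verts H"
  define N where "N = real (card V)"
  have V: "finite V" "V \<noteq> {}" "3 \<le> card V" using H n by (auto simp: three_graph_def V_def)
  have "d * N ^ 3 / 54 \<le> real (card ([V]\<^bsup>3\<^esup> \<inter> edges H))"
  proof -
    have "(N / 3) ^ 3 \<le> real (card V choose 3)"
      using binomial_ge_n_over_k_pow_k[of 3 "card V", where ?'a=real] V by (simp add: N_def)
    then have "d * (N / 3) ^ 3 \<le> d * real (card V choose 3)" using d0 by (intro mult_left_mono) auto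
    moreover have "d * real (card V choose 3) - d / 54 * N ^ 3 \<le> real (card ([V]\<^bsup>3\<^esup> \<inter> edges H))"
      using H(3) by (auto simp: mu_dense_def V_def N_def)
    ultimately show ?thesis by (simp add: power_divide)
  qed
  moreover have "6 * real (card ([V]\<^bsup>3\<^esup> \<inter> edges H)) \<le> (\<Sum>x\<in>V. edge_count (\<lambda>y z. {x,y,z} \<in> edges H) V V)"
  proof -
    have "6 * real (card ([V]\<^bsup>3\<^esup> \<inter> edges H)) = 6 * (\<Sum>e\<in>[V]\<^bsup>3\<^esup>. of_bool (e \<in> edges H))"
      using finite_imp_finite_nsets[OF V(1)] by simp
    also have "\<dots> = (\<Sum>x\<in>V. \<Sum>y\<in>V. \<Sum>z\<in>V. of_bool (x \<noteq> y \<and> y \<noteq> z \<and> x \<noteq> z) * of_bool ({x,y,z} \<in> edges H))"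
      by (rule sum_ordered_triples[OF V(1), symmetric])
    also have "\<dots> \<le> (\<Sum>x\<in>V. edge_count (\<lambda>y z. {x,y,z} \<in> edges H) V V)"
      unfolding edge_count_def by (intro sum_mono) auto
    finally show ?thesis .
  qed
  ultimately have "\<delta> * N\<^sup>2 * real (card V) \<le> (\<Sum>x\<in>V. edge_count (\<lambda>y z. {x,y,z} \<in> edges H) V V)"
    by (simp add: \<delta>_def N_def power2_eq_square power3_eq_cube)
  then obtain x where x: "\<delta> * (real (card V))\<^sup>2 \<le> edge_count (\<lambda>y z. {x,y,z} \<in> edges H) V V"
    using exists_ge_average[OF V(1,2)] unfolding N_def by blast
  obtain X Y where XY: "card X = k" "card Y = k" "\<And>y z. y \<in> X \<Longrightarrow> z \<in> Y \<Longrightarrow> {x,y,z} \<in> edges H"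
    by (rule kovari_sos_turan[OF V(1) k(2) \<delta> _ _ x]) (use n H(4) in \<open>auto simp: V_def\<close>)
  have "contains_copy H (wheel (2 * k + 1))"
    by (rule contains_odd_wheel[OF H(1) k(2) XY(1,2), of x]) (rule XY(3))
  then show False using H(2) by (simp add: free_of_def k)
qed

lemma attained_density_wheel_0:
  assumes "3 \<le> t" shows "attained_density (wheel t) 0"
proof -
  have "\<exists>H :: nat hypergraph. three_graph H \<and> free_of (wheel t) H \<and> mu_dense 0 \<mu> H \<and> card (verts H) \<ge> n\<^sub>0"
    if "0 < \<mu>" for \<mu> :: real and n\<^sub>0
  proof (intro exI conjI)
    let ?H = "({..<n\<^sub>0}, {}) :: nat hypergraph"
    show "three_graph ?H" by (simp add: three_graph_def)
    show "free_of (wheel t) ?H"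
      using assms by (auto simp: free_of_def contains_wheel_iff)
    show "mu_dense 0 \<mu> ?H" using that by (simp add: mu_dense_def)
  qed simp
  then show ?thesis by (simp add: attained_density_def)
qed

lemma attained_density_even_wheel:
  assumes "even t" "3 \<le> t" shows "attained_density (wheel t) (1/4)"
proof -
  have "\<exists>H :: nat hypergraph. three_graph H \<and> free_of (wheel t) H \<and> mu_dense (1/4) \<mu> H \<and> card (verts H) \<ge> n\<^sub>0"
    if \<mu>: "0 < \<mu>" for \<mu> :: real and n\<^sub>0
  proof -
    obtain k where k: "k \<ge> n\<^sub>0" "real k > 1 / \<mu>" "real k \<ge> 0" by (rule obtain_large_nat)
    have "real k \<le> 2 ^ k" using of_nat_less_two_power[of k, where ?'a=real] by simp
    then have "1 / \<mu> \<le> 2 ^ k" using k by linarith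
    moreover have "n\<^sub>0 \<le> 2 ^ k" using k less_exp[of k] by linarith
    ultimately show ?thesis
      using three_graph_cyclic_triangles cyclic_triangles_free_of_even_wheel[OF assms] cyclic_triangles_dense[OF \<mu>]
      by (intro exI[of _ "cyclic_triangles k"]) (auto simp: cyclic_triangles_def)
  qed
  then show ?thesis by (simp add: attained_density_def)
qed

theorem theorem1p7:
  fixes t :: nat
  assumes "t \<ge> 3"
  shows "(even t \<longrightarrow> uniform_turan_density (wheel t) = 1 / 4) \<and>
         (odd t \<longrightarrow> uniform_turan_density (wheel t) = 0)"
proof (intro conjI impI)
  show "uniform_turan_density (wheel t) = 1 / 4" if "even t"
    using that assms by (intro uniform_turan_densityI attained_density_even_wheel attained_density_even_wheel_le)
  show "uniform_turan_density (wheel t) = 0" if "odd t"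
    using that assms by (intro uniform_turan_densityI attained_density_wheel_0 attained_density_odd_wheel_le)
qed

end
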